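(* Suppose Assumption A1 holds and $\mathbf X\sim\mu\in\mathcal P_{ac}(\mathbb R^p)$. Then there exists a $\mu$-a.e. unique Borel measurable map $R:\mathbb R^p\to\mathbb R^p$ such that the law of $(\mathbf X,R(\mathbf X))$ is the unique element of $\Pi(\mu,\nu)$ with a $c$-cyclically monotone support. Moreover: (i) there is a lower semicontinuous convex function $\psi:\mathbb R^p\to(-\infty,+\infty]$ with $R(\mathbf x)=q(\nabla\psi(\mathbf x))$ for $\mu$-a.e. $\mathbf x$; (ii) $\nabla\psi$ is the $\mu_S$-a.e. unique gradient of a convex function pushing $\mu_S$ forward to $\nu_S$; (iii) $\nabla\psi(Q\mathbf x)=Q\nabla\psi(\mathbf x)$ for every $Q\in\mathcal G$ and every $\mathbf x$ at which $\psi$ is differentiable (with $Q\mathbf x$ also a differentiability point); (iv) $\nabla\psi(\mathbf X)=S(\mathbf X,R(\mathbf X))R(\mathbf X)$ almost surely, where $S(\mathbf x,\mathbf h)\in\arg\min_{Q\in\mathcal G}\|Q^\top\mathbf x-\mathbf h\|^2$ (the product $S(\mathbf X,R(\mathbf X))R(\mathbf X)$ being a.s. the same for every choice of minimizer); (v) if $\mu$ and $\nu$ have finite second moments, then the law of $(\mathbf X,R(\mathbf X))$ is the unique minimizer of $\mathbb E[c(\mathbf X,\mathbf H)]$ over $(\mathbf X,\mathbf H)$ with law in $\Pi(\mu,\nu)$.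
   Context: Let $p\ge1$, $\mathcal G$ a compact subgroup of $\mathrm O(p)$, $\mathrm{Uniform}(\mathcal G)$ its normalized Haar measure, and $\mathcal P_{ac}(\mathbb R^p)$ the Borel probability measures on $\mathbb R^p$ with a Lebesgue density. $\nu$ is a fixed Borel probability measure on $\mathbb R^p$ (reference distribution). Cost: $c(\mathbf x,\mathbf h)=\min_{Q\in\mathcal G}\|Q^\top\mathbf x-\mathbf h\|^2$. $\Pi(\mu,\nu)$ is the set of Borel probability measures on $\mathbb R^p\times\mathbb R^p$ with marginals $\mu,\nu$. A set $\Gamma\subset\mathbb R^p\times\mathbb R^p$ is $c$-cyclically monotone if for all $N\in\mathbb N$ and $(\mathbf x_1,\mathbf y_1),\dots,(\mathbf x_N,\mathbf y_N)\in\Gamma$, $\sum_{i=1}^N c(\mathbf x_i,\mathbf y_i)\le\sum_{i=1}^N c(\mathbf x_i,\mathbf y_{i+1})$ with $\mathbf y_{N+1}=\mathbf y_1$. Assumption A1: there is a Borel set $B\subset\mathbb R^p$ with $\nu(B)=1$ such that for every $\mathbf x\in\mathbb R^p$ the orbit $\{Q\mathbf x:Q\in\mathcal G\}$ meets $B$ in at most one point. Under A1 the quotient map $q:\mathcal G B\to B$ (where $\mathcal G B=\{Q\mathbf x:Q\in\mathcal G,\mathbf x\in B\}$) is defined by $q(Q\mathbf x)=\mathbf x$ for $\mathbf x\in B$, $Q\in\mathcal G$. Let $S\sim\mathrm{Uniform}(\mathcal G)$ be independent of $\mathbf X\sim\mu$ and $\mathbf H\sim\nu$; $\mu_S$ and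 $\nu_S$ denote the laws of $S\mathbf X$ and $S\mathbf H$. *)

theory Defs
  imports "HOL-Analysis.Analysis" "HOL-Probability.Probability"
begin

type_synonym 'n rvec = "real^'n"
type_synonym 'n rmat = "real^'n^'n"

definition compact_orth_subgroup :: "'n::finite rmat set \<Rightarrow> bool" where
  "compact_orth_subgroup G \<longleftrightarrow>
     G \<subseteq> {Q. orthogonal_matrix Q} \<and> mat 1 \<in> G \<and>
     (\<forall>Q\<in>G. \<forall>P\<in>G. Q ** P \<in> G) \<and> (\<forall>Q\<in>G. transpose Q \<in> G) \<and> compact G"

definition haar_uniform :: "'n::finite rmat set \<Rightarrow> 'n rmat measure \<Rightarrow> bool" where
  "haar_uniform G H \<longleftrightarrow> prob_space H \<and> sets H = sets borel \<and> emeasure H G = 1 \<and>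
     (\<forall>Q\<in>G. distr H borel (\<lambda>M. Q ** M) = H)"

definition orbit_cost :: "'n::finite rmat set \<Rightarrow> 'n rvec \<Rightarrow> 'n rvec \<Rightarrow> real" where
  "orbit_cost G x h = (INF Q\<in>G. (norm (transpose Q *v x - h))\<^sup>2)"

definition couplings :: "'a::euclidean_space measure \<Rightarrow> 'a measure \<Rightarrow> ('a \<times> 'a) measure set" where
  "couplings M N = {\<pi>. sets \<pi> = sets borel \<and> distr \<pi> borel fst = M \<and> distr \<pi> borel snd = N}"

definition msupport :: "'a::metric_space measure \<Rightarrow> 'a set" where
  "msupport M = {z. \<forall>e>0. emeasure M (ball z e) > 0}"

definition cyclically_monotone :: "('a \<Rightarrow> 'a \<Rightarrow> real) \<Rightarrow> ('a \<times> 'a) set \<Rightarrow> bool" where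
  "cyclically_monotone c \<Gamma> \<longleftrightarrow>
     (\<forall>N::nat. \<forall>xs ys :: nat \<Rightarrow> 'a. N \<ge> 1 \<longrightarrow> (\<forall>i<N. (xs i, ys i) \<in> \<Gamma>) \<longrightarrow>
        (\<Sum>i<N. c (xs i) (ys i)) \<le> (\<Sum>i<N. c (xs i) (ys (Suc i mod N))))"

definition A1_set :: "'n::finite rmat set \<Rightarrow> 'n rvec measure \<Rightarrow> 'n rvec set \<Rightarrow> bool" where
  "A1_set G \<nu> B \<longleftrightarrow> B \<in> sets borel \<and> emeasure \<nu> B = 1 \<and>
     (\<forall>x. \<forall>b1\<in>B. \<forall>b2\<in>B. (\<exists>Q1\<in>G. b1 = Q1 *v x) \<longrightarrow> (\<exists>Q2\<in>G. b2 = Q2 *v x) \<longrightarrow> b1 = b2)"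

definition orbit_set :: "'n::finite rmat set \<Rightarrow> 'n rvec set \<Rightarrow> 'n rvec set" where
  "orbit_set G B = {Q *v x | Q x. Q \<in> G \<and> x \<in> B}"

definition quot_map :: "'n::finite rmat set \<Rightarrow> 'n rvec set \<Rightarrow> 'n rvec \<Rightarrow> 'n rvec" where
  "quot_map G B y = (THE x. x \<in> B \<and> (\<exists>Q\<in>G. y = Q *v x))"

definition ereal_convex :: "('a::real_vector \<Rightarrow> ereal) \<Rightarrow> bool" where
  "ereal_convex \<psi> \<longleftrightarrow> (\<forall>x. \<psi> x \<noteq> -\<infinity>) \<and>
     (\<forall>x y. \<forall>t::real. 0 \<le> t \<and> t \<le> 1 \<longrightarrow>
        \<psi> ((1 - t) *\<^sub>R x + t *\<^sub>R y) \<le> ereal (1 - t) * \<psi> x + ereal t * \<psi> y)"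

definition ereal_lsc :: "('a::topological_space \<Rightarrow> ereal) \<Rightarrow> bool" where
  "ereal_lsc \<psi> \<longleftrightarrow> (\<forall>x. \<psi> x \<le> Liminf (at x) \<psi>)"

definition has_grad_at :: "('a::real_inner \<Rightarrow> ereal) \<Rightarrow> 'a \<Rightarrow> 'a \<Rightarrow> bool" where
  "has_grad_at \<psi> x g \<longleftrightarrow> (\<exists>e>0. \<forall>y\<in>ball x e. \<psi> y \<noteq> \<infinity> \<and> \<psi> y \<noteq> -\<infinity>) \<and>
     ((\<lambda>y. real_of_ereal (\<psi> y)) has_derivative (\<lambda>h. g \<bullet> h)) (at x)"

definition ediff_at :: "('a::real_inner \<Rightarrow> ereal) \<Rightarrow> 'a \<Rightarrow> bool" where
  "ediff_at \<psi> x \<longleftrightarrow> (\<exists>g. has_grad_at \<psi> x g)"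

definition egrad :: "('a::real_inner \<Rightarrow> ereal) \<Rightarrow> 'a \<Rightarrow> 'a" where
  "egrad \<psi> x = (if ediff_at \<psi> x then (THE g. has_grad_at \<psi> x g) else 0)"

text \<open>Law of S X with S ~ Uniform(G) independent of X ~ M.\<close>
definition sym_law :: "'n::finite rmat measure \<Rightarrow> 'n rvec measure \<Rightarrow> 'n rvec measure" where
  "sym_law H M = distr (H \<Otimes>\<^sub>M M) borel (\<lambda>(Q, x). Q *v x)"

end

theory Submission
  imports Defs
begin

text \<open>
  With \<open>m x h = max {x \<bullet> Q h | Q \<in> G}\<close> the cost is \<open>\<bar>x\<bar>\<^sup>2 + \<bar>h\<bar>\<^sup>2 - 2 m x h\<close>, so cyclical monotonicity is a
  property of the \<open>G\<close>-invariant kernel \<open>m\<close>, and Rockafellar's potentials for \<open>m\<close> are convex, lower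
  semicontinuous and \<open>G\<close>-invariant.

  Existence, without moments or weak compactness of couplings: approximate both measures by finitely
  supported ones, take optimal finite couplings, and let \<open>\<Gamma>\<close> be the Kuratowski limit of their supports
  along a subsequence. Fatou's lemma gives \<open>\<nu> U \<le> \<mu> (\<Gamma>\<inverse> K)\<close> for open \<open>U\<close> inside compact \<open>K\<close>.
  Where the potential \<open>\<psi>\<close> of \<open>\<Gamma>\<close> is differentiable, \<open>(x, h) \<in> \<Gamma>\<close> forces \<open>\<nabla>\<psi> x\<close> into the orbit of \<open>h\<close>;
  hence \<open>\<nu>\<close> is dominated by, and so equals, the image of \<open>\<mu>\<close> under \<open>R = q \<circ> \<nabla>\<psi>\<close>.

  Uniqueness: if two couplings with the same marginals live on the contact sets of two potentials,
  comparing the laws of the differences of the potentials and of their conjugates shows that each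
  coupling lives on both contact sets. With second moments the potentials are integrable, and
  optimality is Kantorovich duality.
\<close>

section \<open>Cyclically monotone relations and finite optimal couplings\<close>

text \<open>The kernel sees \<open>h\<close> only through its orbit, and this shapes the argument.
  If \<open>(x, h)\<close> is a contact pair and \<open>Q\<close> attains \<open>m x h\<close>, then
  \<open>z \<bullet> Q h\<close> lies below \<open>m z h\<close> with equality at
  \<open>z = x\<close>; so \<open>Q h\<close> is a subgradient and must equal the gradient. The
  relation therefore controls the gradient only on \<open>G\<close>-invariant sets, and the
  comparison with \<nu> is first proved there; Assumption A1 then picks the point of the orbit.
  Domination turns into equality because both sides have total mass one, so it can be applied to
  complements. The density of \<mu> enters at a single place: it makes the potential differentiable
  almost everywhere. The averaged law is reached through the invariance of the differentiability
  set, not through a density of its own. Before (v) no potential may be integrated, which is why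
  couplings are compared through tail probabilities of differences of potentials. The same
  comparison with the inner product as kernel gives the uniqueness in (ii).\<close>

lemma sum_cyclic_shift:
  fixes f :: "nat \<Rightarrow> 'b::comm_monoid_add"
  shows "(\<Sum>i<N. f (Suc i mod N)) = (\<Sum>i<N. f i)"
proof (cases N)
  case (Suc n)
  have "(\<Sum>i<N. f (Suc i mod N)) = (\<Sum>i<n. f (Suc i)) + f 0"
    by (simp add: Suc)
  also have "\<dots> = (\<Sum>i<Suc n. f i)"
    by (subst sum.lessThan_Suc_shift) (simp add: add.commute)
  finally show ?thesis by (simp add: Suc)
qed simp

lemma cyclically_monotone_subset:
  "cyclically_monotone c \<Gamma> \<Longrightarrow> \<Delta> \<subseteq> \<Gamma> \<Longrightarrow> cyclically_monotone c \<Delta>"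
  unfolding cyclically_monotone_def by (meson subsetD)

text \<open>Around a cycle the \<open>f\<close> terms are the same on both sides and the
  \<open>g\<close> terms are merely permuted. This is how the orbit cost is traded for
  \<open>- m\<close>.\<close>

lemma cyclically_monotone_affine:
  assumes "\<And>x y. c x y = f x + g y + k * d x y" and "k > 0"
  shows "cyclically_monotone c \<Gamma> \<longleftrightarrow> cyclically_monotone d \<Gamma>"
proof -
  have "((\<Sum>i<N. c (xs i) (ys i)) \<le> (\<Sum>i<N. c (xs i) (ys (Suc i mod N)))) \<longleftrightarrow>
        ((\<Sum>i<N. d (xs i) (ys i)) \<le> (\<Sum>i<N. d (xs i) (ys (Suc i mod N))))"
    for N and xs ys :: "nat \<Rightarrow> 'a"
    using assms(2) sum_cyclic_shift[of "\<lambda>i. g (ys i)" N]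
    by (simp add: assms(1) sum.distrib flip: sum_distrib_left)
  then show ?thesis unfolding cyclically_monotone_def by presburger
qed

lemma compact_box_fun:
  "compact (PiE UNIV (\<lambda>i. {a i..b i}) :: ('i \<Rightarrow> real) set)"
proof -
  have "compactin (product_topology (\<lambda>i. euclidean) UNIV) (PiE UNIV (\<lambda>i. {a i..b i}))"
    by (subst compactin_PiE) simp
  then show ?thesis by (simp add: euclidean_product_topology)
qed

text \<open>Take a minimiser of the linear cost over the transport polytope. Were a cycle in its
  support to violate the inequality, moving a little mass from each \<open>(xs k, ys k)\<close> to
  \<open>xs k\<close> paired with the next \<open>ys\<close> would keep the marginals and lower the
  cost.\<close>

lemma finite_optimal_coupling:
  fixes c :: "'a \<Rightarrow> 'a \<Rightarrow> real" and a b :: "'a \<Rightarrow> real"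
  assumes fin: "finite I" "finite J"
    and a: "\<And>i. i \<in> I \<Longrightarrow> 0 \<le> a i" "sum a I = 1"
    and b: "\<And>j. j \<in> J \<Longrightarrow> 0 \<le> b j" "sum b J = 1"
  obtains p where "\<And>z. 0 \<le> p z"
    "\<And>i. i \<in> I \<Longrightarrow> (\<Sum>j\<in>J. p (i,j)) = a i"
    "\<And>j. j \<in> J \<Longrightarrow> (\<Sum>i\<in>I. p (i,j)) = b j"
    "cyclically_monotone c {z \<in> I \<times> J. p z > 0}"
proof -
  \<comment> \<open>Plans are functions on the whole type whose coordinates off
    \<open>I \<times> J\<close> are pinned to 0, so compactness is that of a product of
    intervals.\<close>
  define Box :: "('a \<times> 'a \<Rightarrow> real) set" where
    "Box = PiE UNIV (\<lambda>z. {0..if z \<in> I \<times> J then 1 else 0})"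
  define P where "P = Box \<inter> (\<Inter>i\<in>I. {p. (\<Sum>j\<in>J. p (i,j)) = a i}) \<inter> (\<Inter>j\<in>J. {p. (\<Sum>i\<in>I. p (i,j)) = b j})"
  define F where "F p = (\<Sum>z\<in>I\<times>J. c (fst z) (snd z) * p z)" for p :: "'a \<times> 'a \<Rightarrow> real"
  have "compact P" unfolding P_def Box_def
    by (intro compact_Int_closed compact_box_fun closed_INT ballI closed_Collect_eq continuous_intros
        continuous_on_product_coordinates)
  moreover have a1: "a i \<le> 1" if "i \<in> I" for i
    using member_le_sum[of i I a] that a fin by auto
  have b1: "b i \<le> 1" if "i \<in> J" for i
    using member_le_sum[of i J b] that b fin by auto
  have "(\<lambda>(i,j). if (i,j) \<in> I \<times> J then a i * b j else 0) \<in> P"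
    using a b a1 b1 unfolding P_def Box_def
    by (auto simp: PiE_def Pi_def mult_le_one simp flip: sum_distrib_left sum_distrib_right)
  then have "P \<noteq> {}" by blast
  moreover have "continuous_on P F" unfolding F_def
    by (intro continuous_intros continuous_on_subset[OF continuous_on_product_coordinates]) auto
  ultimately obtain p where p: "p \<in> P" and opt: "\<And>q. q \<in> P \<Longrightarrow> F p \<le> F q"
    using continuous_attains_inf[of P F] by blast
  have p0: "0 \<le> p z" for z using p unfolding P_def Box_def by (cases z) (auto simp: PiE_def Pi_def)
  have "p z \<le> (if z \<in> I \<times> J then 1 else 0)" for z
    using p unfolding P_def Box_def by (cases z) (simp add: PiE_def Pi_def)
  then have pz: "p z = 0" if "z \<notin> I \<times> J" for z
    using p0[of z] that by (metis antisym)
  have pa: "(\<Sum>j\<in>J. p (i,j)) = a i" if "i \<in> I" for i using p that unfolding P_def by auto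
  have pb: "(\<Sum>i\<in>I. p (i,j)) = b j" if "j \<in> J" for j using p that unfolding P_def by auto
  have "cyclically_monotone c {z \<in> I \<times> J. p z > 0}"
    unfolding cyclically_monotone_def
  proof (intro allI impI)
    fix N :: nat and xs ys :: "nat \<Rightarrow> 'a"
    assume N: "1 \<le> N" and mem: "\<forall>i<N. (xs i, ys i) \<in> {z \<in> I \<times> J. p z > 0}"
    define zs where "zs k = ys (Suc k mod N)" for k
    have xI: "xs k \<in> I" and yJ: "ys k \<in> J" if "k < N" for k using mem that by auto
    have zJ: "zs k \<in> J" if "k < N" for k unfolding zs_def using yJ[of "Suc k mod N"] N by auto
    \<comment> \<open>The net change per unit moved. A pair can occur several times in the cycle and
      may then lose up to \<open>N\<close> units, hence the step \<open>e = m / N\<close>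
      below.\<close>
    define d :: "'a \<times> 'a \<Rightarrow> real" where "d z = (\<Sum>k<N. of_bool ((xs k, zs k) = z) - of_bool ((xs k, ys k) = z))" for z
    define m where "m = Min ((\<lambda>k. p (xs k, ys k)) ` {..<N})"
    have m: "m > 0" "\<And>k. k < N \<Longrightarrow> m \<le> p (xs k, ys k)"
      using mem N unfolding m_def by (auto simp: lessThan_empty_iff Min_gr_iff)
    define e where "e = m / N"
    have e: "e > 0" "e * N = m" using m N by (auto simp: e_def)
    define q where "q z = p z + e * d z" for z
    have d_out: "d z = 0" if "z \<notin> I \<times> J" for z
      unfolding d_def using that xI yJ zJ by (intro sum.neutral) auto
    have q0: "0 \<le> q z" for z
    proof (cases "\<exists>k<N. (xs k, ys k) = z")
      case True
      have "d z \<ge> (\<Sum>k<N. -1)" unfolding d_def by (intro sum_mono) auto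
      then have "e * d z \<ge> - m" using mult_left_mono[of "- real N" "d z" e] e by simp
      then show ?thesis using True m unfolding q_def by force
    next
      case False
      then have "d z \<ge> 0" unfolding d_def by (intro sum_nonneg) auto
      then show ?thesis using e p0[of z] by (simp add: q_def)
    qed
    have row: "(\<Sum>j\<in>J. d (i,j)) = 0" for i
    proof -
      have "(\<Sum>j\<in>J. d (i,j)) = (\<Sum>k<N. \<Sum>j\<in>J. of_bool ((xs k, zs k) = (i,j)) - of_bool ((xs k, ys k) = (i,j)))"
        unfolding d_def by (rule sum.swap)
      also have "\<dots> = (\<Sum>k<N. of_bool (xs k = i) - of_bool (xs k = i))"
      proof (intro sum.cong refl)
        fix k assume "k \<in> {..<N}"
        then have "zs k \<in> J" "ys k \<in> J" using zJ yJ by auto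
        then show "(\<Sum>j\<in>J. of_bool ((xs k, zs k) = (i,j)) - of_bool ((xs k, ys k) = (i,j))) =
          (of_bool (xs k = i) - of_bool (xs k = i) :: real)"
          using fin by (cases "xs k = i") (auto simp: sum_subtractf of_bool_def)
      qed
      finally show ?thesis by simp
    qed
    have col: "(\<Sum>i\<in>I. d (i,j)) = 0" for j
    proof -
      have "(\<Sum>i\<in>I. d (i,j)) = (\<Sum>k<N. \<Sum>i\<in>I. of_bool ((xs k, zs k) = (i,j)) - of_bool ((xs k, ys k) = (i,j)))"
        unfolding d_def by (rule sum.swap)
      also have "\<dots> = (\<Sum>k<N. of_bool (zs k = j) - of_bool (ys k = j))"
      proof (intro sum.cong refl)
        fix k assume "k \<in> {..<N}"
        then have "xs k \<in> I" using xI by auto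
        then show "(\<Sum>i\<in>I. of_bool ((xs k, zs k) = (i,j)) - of_bool ((xs k, ys k) = (i,j))) =
          (of_bool (zs k = j) - of_bool (ys k = j) :: real)"
          using fin by (cases "zs k = j"; cases "ys k = j") (auto simp: sum_subtractf of_bool_def sum_negf)
      qed
      also have "\<dots> = 0"
        using sum_cyclic_shift[of "\<lambda>k. of_bool (ys k = j) :: real" N]
        by (simp only: sum_subtractf zs_def)
      finally show ?thesis .
    qed
    have qa: "(\<Sum>j\<in>J. q (i,j)) = a i" if "i \<in> I" for i
      unfolding q_def using pa[OF that] row[of i] by (simp add: sum.distrib flip: sum_distrib_left)
    have qb: "(\<Sum>i\<in>I. q (i,j)) = b j" if "j \<in> J" for j
      unfolding q_def using pb[OF that] col[of j] by (simp add: sum.distrib flip: sum_distrib_left)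
    have q1: "q (i,j) \<le> 1" if "i \<in> I" "j \<in> J" for i j
      using member_le_sum[of j J "\<lambda>j. q (i,j)"] that q0 fin qa[of i] a1[of i] by auto
    have "q \<in> P" unfolding P_def Box_def
      using q0 qa qb q1 d_out pz by (auto simp: PiE_def Pi_def) (auto simp: q_def)
    then have "F p \<le> F q" by (rule opt)
    also have "F q = F p + e * (\<Sum>z\<in>I\<times>J. c (fst z) (snd z) * d z)"
      by (simp add: F_def q_def algebra_simps sum.distrib sum_distrib_left)
    also have "(\<Sum>z\<in>I\<times>J. c (fst z) (snd z) * d z) =
        (\<Sum>k<N. \<Sum>z\<in>I\<times>J. c (fst z) (snd z) * (of_bool ((xs k, zs k) = z) - of_bool ((xs k, ys k) = z)))"
      unfolding d_def sum_distrib_left by (rule sum.swap)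
    also have "\<dots> = (\<Sum>k<N. c (xs k) (zs k) - c (xs k) (ys k))"
    proof (intro sum.cong refl)
      fix k assume "k \<in> {..<N}"
      then have "(xs k, zs k) \<in> I \<times> J" "(xs k, ys k) \<in> I \<times> J" using xI yJ zJ by auto
      then show "(\<Sum>z\<in>I\<times>J. c (fst z) (snd z) * (of_bool ((xs k, zs k) = z) - of_bool ((xs k, ys k) = z))) =
         c (xs k) (zs k) - c (xs k) (ys k)"
        using fin by (simp add: right_diff_distrib sum_subtractf of_bool_def if_distrib[of "\<lambda>x. _ * x"] cong: if_cong)
    qed
    finally show "(\<Sum>i<N. c (xs i) (ys i)) \<le> (\<Sum>i<N. c (xs i) (ys (Suc i mod N)))"
      using e by (simp add: sum_subtractf zs_def zero_le_mult_iff)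
  qed
  with p0 pa pb show ?thesis using that by blast
qed

section \<open>Limits of cyclically monotone relations\<close>

text \<open>A diagonal sequence over a countable basis makes every basic set either eventually hit
  or eventually missed, so the upper and lower Kuratowski limits coincide.\<close>

lemma kuratowski_convergent_subsequence:
  fixes \<Gamma> :: "nat \<Rightarrow> 'a::second_countable_topology set"
  obtains r where "strict_mono r"
    "\<And>z. (\<And>U. open U \<Longrightarrow> z \<in> U \<Longrightarrow> \<exists>\<^sub>F n in sequentially. \<Gamma> (r n) \<inter> U \<noteq> {}) \<Longrightarrow>
         (\<And>U. open U \<Longrightarrow> z \<in> U \<Longrightarrow> \<forall>\<^sub>F n in sequentially. \<Gamma> (r n) \<inter> U \<noteq> {})"
proof -
  obtain A :: "nat \<Rightarrow> 'a set" where A: "\<And>n. open (A n)"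
    "\<And>S x. open S \<Longrightarrow> x \<in> S \<Longrightarrow> \<exists>n. x \<in> A n \<and> A n \<subseteq> S"
  proof -
    obtain \<B> :: "'a set set" where B: "countable \<B>" "topological_basis \<B>"
      using ex_countable_basis by blast
    have "\<B> \<noteq> {}"
      using topological_basisE[OF B(2) open_UNIV, of undefined] by auto
    show ?thesis
    proof (rule that[of "from_nat_into \<B>"])
      show "open (from_nat_into \<B> n)" for n
        using B(2) from_nat_into[OF \<open>\<B> \<noteq> {}\<close>] topological_basis_open by blast
      show "\<exists>n. x \<in> from_nat_into \<B> n \<and> from_nat_into \<B> n \<subseteq> S" if "open S" "x \<in> S" for S x
        using topological_basisE[OF B(2) that] from_nat_into_surj[OF B(1)] by metis
    qed
  qed
  define P where "P k s \<longleftrightarrow> (\<forall>\<^sub>F n in sequentially. \<Gamma> (s n) \<inter> A k \<noteq> {}) \<or>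
    (\<forall>\<^sub>F n in sequentially. \<Gamma> (s n) \<inter> A k = {})" for k and s :: "nat \<Rightarrow> nat"
  have stable: "P k (s \<circ> r)" if "strict_mono r" "P k s" for k s r
    using that eventually_subseq[OF that(1)] unfolding P_def by (auto simp: o_def)
  interpret subseqs P
  proof
    fix k and s :: "nat \<Rightarrow> nat" assume "strict_mono s"
    show "\<exists>r'. strict_mono r' \<and> P k (s \<circ> r')"
    proof (cases "\<forall>\<^sub>F n in sequentially. \<Gamma> (s n) \<inter> A k = {}")
      case True
      then show ?thesis by (intro exI[of _ id]) (auto simp: P_def strict_mono_def)
    next
      case False
      then have "infinite {n. \<Gamma> (s n) \<inter> A k \<noteq> {}}"
        by (simp add: frequently_cofinite[symmetric] cofinite_eq_sequentially frequently_def)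
      then obtain r :: "nat \<Rightarrow> nat" where "strict_mono r" "\<And>n. r n \<in> {n. \<Gamma> (s n) \<inter> A k \<noteq> {}}"
        using infinite_enumerate by blast
      then have "strict_mono r \<and> P k (s \<circ> r)" by (simp add: P_def)
      then show ?thesis by blast
    qed
  qed
  have P: "P k diagseq" for k
  proof -
    have "P k (diagseq \<circ> ((+) (Suc k)))" by (rule diagseq_holds[OF stable])
    moreover have "diagseq \<circ> ((+) (Suc k)) = (\<lambda>n. diagseq (n + Suc k))" by (simp add: fun_eq_iff add.commute)
    ultimately show ?thesis
      using eventually_sequentially_seg[of "\<lambda>n. \<Gamma> (diagseq n) \<inter> A k \<noteq> {}" "Suc k"]
        eventually_sequentially_seg[of "\<lambda>n. \<Gamma> (diagseq n) \<inter> A k = {}" "Suc k"]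
      unfolding P_def by metis
  qed
  show ?thesis
  proof (rule that[OF subseq_diagseq])
    fix z U
    assume fr: "\<And>U. open U \<Longrightarrow> z \<in> U \<Longrightarrow> \<exists>\<^sub>F n in sequentially. \<Gamma> (diagseq n) \<inter> U \<noteq> {}"
      and U: "open U" "z \<in> U"
    obtain k where k: "z \<in> A k" "A k \<subseteq> U" using A(2)[OF U] by blast
    have "\<not> (\<forall>\<^sub>F n in sequentially. \<Gamma> (diagseq n) \<inter> A k = {})"
      using fr[OF A(1) k(1)] by (simp add: frequently_def)
    then have "\<forall>\<^sub>F n in sequentially. \<Gamma> (diagseq n) \<inter> A k \<noteq> {}"
      using P[of k] by (simp add: P_def)
    then show "\<forall>\<^sub>F n in sequentially. \<Gamma> (diagseq n) \<inter> U \<noteq> {}"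
      by (rule eventually_mono) (use k in auto)
  qed
qed

text \<open>Only finitely many points enter one inequality; each is a limit of points of
  \<open>\<Gamma> n\<close>, and continuity of \<open>c\<close> carries the inequality over.\<close>

lemma cyclically_monotone_limit:
  fixes c :: "'a::metric_space \<Rightarrow> 'a \<Rightarrow> real"
  assumes cont: "continuous_on UNIV (\<lambda>z. c (fst z) (snd z))"
    and mono: "\<And>n. cyclically_monotone c (\<Gamma> n)"
    and lim: "\<And>z U. z \<in> \<Delta> \<Longrightarrow> open U \<Longrightarrow> z \<in> U \<Longrightarrow> \<forall>\<^sub>F n in sequentially. \<Gamma> n \<inter> U \<noteq> {}"
  shows "cyclically_monotone c \<Delta>"
  unfolding cyclically_monotone_def
proof (intro allI impI)
  fix N :: nat and xs ys :: "nat \<Rightarrow> 'a"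
  assume N: "1 \<le> N" and mem: "\<forall>i<N. (xs i, ys i) \<in> \<Delta>"
  have "\<exists>z. (\<forall>n. \<Gamma> n \<noteq> {} \<longrightarrow> z n \<in> \<Gamma> n) \<and> z \<longlonglongrightarrow> (xs i, ys i)" if "i < N" for i
  proof -
    define p where "p = (xs i, ys i)"
    have ev: "\<forall>\<^sub>F n in sequentially. \<Gamma> n \<inter> ball p e \<noteq> {}" if "e > 0" for e
      using lim[of p "ball p e"] mem \<open>i < N\<close> that by (auto simp: p_def)
    \<comment> \<open>\<open>\<Gamma> n\<close> may fail to be closed and then have no nearest
      point; a point within \<open>1 / Suc n\<close> of the infimum serves.\<close>
    define z where "z n = (SOME z. z \<in> \<Gamma> n \<and> dist p z < infdist p (\<Gamma> n) + 1 / Suc n)" for n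
    have z: "z n \<in> \<Gamma> n \<and> dist p (z n) < infdist p (\<Gamma> n) + 1 / Suc n" if "\<Gamma> n \<noteq> {}" for n
      unfolding z_def
    proof (rule someI_ex)
      show "\<exists>z. z \<in> \<Gamma> n \<and> dist p z < infdist p (\<Gamma> n) + 1 / Suc n"
        using that cInf_lessD[of "dist p ` \<Gamma> n" "infdist p (\<Gamma> n) + 1 / Suc n"]
        by (auto simp: infdist_def)
    qed
    have "z \<longlonglongrightarrow> p"
    proof (rule tendstoI)
      fix e :: real assume "e > 0"
      have "\<forall>\<^sub>F n in sequentially. 1 / Suc n < e / 2"
        using order_tendstoD(2)[OF LIMSEQ_inverse_real_of_nat, of "e/2"] \<open>e > 0\<close> by (simp add: inverse_eq_divide)
      moreover have "\<forall>\<^sub>F n in sequentially. \<Gamma> n \<inter> ball p (e/2) \<noteq> {}" using ev[of "e/2"] \<open>e > 0\<close> by simp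
      ultimately show "\<forall>\<^sub>F n in sequentially. dist (z n) p < e"
      proof eventually_elim
        case (elim n)
        then obtain w where "w \<in> \<Gamma> n" "dist p w < e/2" by auto
        then have "infdist p (\<Gamma> n) < e/2" using infdist_le[of w "\<Gamma> n" p] by linarith
        moreover have "dist p (z n) < infdist p (\<Gamma> n) + 1 / Suc n" using z[of n] \<open>w \<in> \<Gamma> n\<close> by auto
        ultimately show ?case using elim(1) unfolding dist_commute[of "z n"] by linarith
      qed
    qed
    then show ?thesis using z by (auto simp: p_def)
  qed
  then obtain z where z: "\<And>i n. i < N \<Longrightarrow> \<Gamma> n \<noteq> {} \<Longrightarrow> z i n \<in> \<Gamma> n" "\<And>i. i < N \<Longrightarrow> z i \<longlonglongrightarrow> (xs i, ys i)"
    by metis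
  have lim2: "(\<lambda>n. c (fst (z i n)) (snd (z j n))) \<longlonglongrightarrow> c (xs i) (ys j)" if "i < N" "j < N" for i j
  proof -
    have "(\<lambda>n. (fst (z i n), snd (z j n))) \<longlonglongrightarrow> (xs i, ys j)"
      using tendsto_fst[OF z(2)[OF that(1)]] tendsto_snd[OF z(2)[OF that(2)]] by (intro tendsto_Pair) auto
    from continuous_on_tendsto_compose[OF cont this] show ?thesis by simp
  qed
  have ne: "\<forall>\<^sub>F n in sequentially. \<Gamma> n \<noteq> {}"
    using lim[of "(xs 0, ys 0)" UNIV] mem N by (auto elim: eventually_mono)
  show "(\<Sum>i<N. c (xs i) (ys i)) \<le> (\<Sum>i<N. c (xs i) (ys (Suc i mod N)))"
  proof (rule tendsto_le[OF sequentially_bot])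
    show "(\<lambda>n. \<Sum>i<N. c (fst (z i n)) (snd (z i n))) \<longlonglongrightarrow> (\<Sum>i<N. c (xs i) (ys i))"
      by (intro tendsto_sum lim2) auto
    show "(\<lambda>n. \<Sum>i<N. c (fst (z i n)) (snd (z (Suc i mod N) n))) \<longlonglongrightarrow> (\<Sum>i<N. c (xs i) (ys (Suc i mod N)))"
      using N by (intro tendsto_sum lim2) auto
    show "\<forall>\<^sub>F n in sequentially. (\<Sum>i<N. c (fst (z i n)) (snd (z i n))) \<le> (\<Sum>i<N. c (fst (z i n)) (snd (z (Suc i mod N) n)))"
      using ne
    proof eventually_elim
      case (elim n)
      then have "\<forall>i<N. (fst (z i n), snd (z i n)) \<in> \<Gamma> n" using z(1) by auto
      then show ?case
        using mono[of n, unfolded cyclically_monotone_def, rule_format, of N "\<lambda>i. fst (z i n)" "\<lambda>i. snd (z i n)"] N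
        by blast
    qed
  qed
qed

lemma cyclically_monotone_closure:
  fixes c :: "'a::metric_space \<Rightarrow> 'a \<Rightarrow> real"
  assumes "continuous_on UNIV (\<lambda>z. c (fst z) (snd z))" "cyclically_monotone c \<Gamma>"
  shows "cyclically_monotone c (closure \<Gamma>)"
proof (rule cyclically_monotone_limit[where \<Gamma> = "\<lambda>_. \<Gamma>"])
  fix z U assume "z \<in> closure \<Gamma>" "open U" "z \<in> U"
  then have "\<Gamma> \<inter> U \<noteq> {}" using open_Int_closure_eq_empty[of U \<Gamma>] by (metis Int_commute disjoint_iff)
  then show "\<forall>\<^sub>F n in sequentially. \<Gamma> \<inter> U \<noteq> {}" by simp
qed (use assms in auto)

text \<open>Projection along a compact factor keeps sets closed. Restricting partners to a compact
  \<open>K\<close> thus gives a Borel set of \<open>x\<close> without recourse to analytic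
  sets.\<close>

lemma closed_section_preimage:
  fixes \<Gamma> :: "('a::euclidean_space \<times> 'b::euclidean_space) set"
  assumes "closed \<Gamma>" "compact K"
  shows "closed {x. \<exists>h\<in>K. (x, h) \<in> \<Gamma>}"
proof -
  have "{x. \<exists>h\<in>K. (x, h) \<in> \<Gamma>} = fst ` (\<Gamma> \<inter> (UNIV \<times> K))" by force
  also have "closed \<dots>"
  proof (unfold closed_sequential_limits, intro allI impI)
    fix x l assume x: "(\<forall>n. x n \<in> fst ` (\<Gamma> \<inter> UNIV \<times> K)) \<and> x \<longlonglongrightarrow> l"
    then have "\<forall>n. \<exists>h. h \<in> K \<and> (x n, h) \<in> \<Gamma>" by force
    then obtain h where h: "\<And>n. h n \<in> K" "\<And>n. (x n, h n) \<in> \<Gamma>" by metis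
    obtain k r where k: "k \<in> K" "strict_mono r" "(h \<circ> r) \<longlonglongrightarrow> k"
      using assms(2) h(1) unfolding compact_def by blast
    have "(\<lambda>n. (x (r n), h (r n))) \<longlonglongrightarrow> (l, k)"
      using x k LIMSEQ_subseq_LIMSEQ[of x l r] by (intro tendsto_Pair) (auto simp: o_def)
    then have "(l, k) \<in> \<Gamma>" using assms(1) h(2) closed_sequentially[of \<Gamma> "\<lambda>n. (x (r n), h (r n))"] by blast
    then show "l \<in> fst ` (\<Gamma> \<inter> UNIV \<times> K)" using k by force
  qed
  finally show ?thesis .
qed

lemma measure_simple_function_vimage:
  fixes s :: "'a::topological_space \<Rightarrow> 'b"
  assumes "finite_measure M" "sets M = sets borel" "simple_function borel s"
  shows "measure M (s -` A) = (\<Sum>i\<in>A \<inter> range s. measure M (s -` {i}))"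
proof -
  interpret finite_measure M by fact
  have fin: "finite (range s)" and meas: "\<And>i. s -` {i} \<in> sets M"
    using assms(3) simple_functionD(2)[OF assms(3)] by (auto simp: simple_function_def assms(2))
  have "s -` A = (\<Union>i\<in>A \<inter> range s. s -` {i})" by auto
  also have "measure M \<dots> = (\<Sum>i\<in>A \<inter> range s. measure M (s -` {i}))"
    using fin meas by (intro finite_measure_finite_Union) (auto simp: disjoint_family_on_def)
  finally show ?thesis .
qed

theorem exists_cyclically_monotone_relation:
  fixes M N :: "'a::euclidean_space measure"
  assumes M: "prob_space M" "sets M = sets borel" and N: "prob_space N" "sets N = sets borel"
    and cont: "continuous_on UNIV (\<lambda>z. c (fst z) (snd z))"
  obtains \<Gamma> where "closed \<Gamma>" "cyclically_monotone c \<Gamma>"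
    "\<And>U K. open U \<Longrightarrow> compact K \<Longrightarrow> U \<subseteq> K \<Longrightarrow> measure N U \<le> measure M {x. \<exists>h\<in>K. (x, h) \<in> \<Gamma>}"
proof -
  interpret M: prob_space M by fact
  interpret N: prob_space N by fact
  have sp: "space M = UNIV" "space N = UNIV"
    using sets_eq_imp_space_eq[OF M(2)] sets_eq_imp_space_eq[OF N(2)] by auto
  \<comment> \<open>Simple functions converging pointwise to the identity: the images of
    \<open>M\<close> and \<open>N\<close> under \<open>s n\<close> are the finitely supported
    approximations.\<close>
  obtain s :: "nat \<Rightarrow> 'a \<Rightarrow> 'a" where s: "\<And>i. simple_function borel (s i)" "\<And>x. (\<lambda>i. s i x) \<longlonglongrightarrow> x"
    using borel_measurable_implies_sequence_metric[of "\<lambda>x. x" borel 0] by auto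
  have fin: "finite (range (s n))" for n using s(1)[of n] by (auto simp: simple_function_def)
  have ex: "\<exists>\<Gamma>. cyclically_monotone c \<Gamma> \<and>
      (\<forall>K. measure N (s n -` K) \<le> measure M (s n -` {x. \<exists>h\<in>K. (x, h) \<in> \<Gamma>}))" for n
  proof -
    define I where "I = range (s n)"
    define a where "a i = measure M (s n -` {i})" for i
    define b where "b i = measure N (s n -` {i})" for i
    have a: "measure M (s n -` A) = sum a (A \<inter> I)" for A
      unfolding a_def I_def by (intro measure_simple_function_vimage s M(2) M.finite_measure_axioms)
    have b: "measure N (s n -` A) = sum b (A \<inter> I)" for A
      unfolding b_def I_def by (intro measure_simple_function_vimage s N(2) N.finite_measure_axioms)
    have sums: "sum a I = 1" "sum b I = 1"
      using a[of UNIV] b[of UNIV] M.prob_space N.prob_space sp by auto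
    have "finite I" using fin by (simp add: I_def)
    have nn: "0 \<le> a i" "0 \<le> b i" for i by (auto simp: a_def b_def)
    obtain p where p: "\<And>z. 0 \<le> p z" "\<And>i. i \<in> I \<Longrightarrow> (\<Sum>j\<in>I. p (i,j)) = a i"
      "\<And>j. j \<in> I \<Longrightarrow> (\<Sum>i\<in>I. p (i,j)) = b j" "cyclically_monotone c {z \<in> I \<times> I. p z > 0}"
      by (rule finite_optimal_coupling[OF \<open>finite I\<close> \<open>finite I\<close> nn(1) sums(1) nn(2) sums(2), of c]) blast
    define \<Gamma> where "\<Gamma> = {z \<in> I \<times> I. p z > 0}"
    have "measure N (s n -` K) \<le> measure M (s n -` {x. \<exists>h\<in>K. (x, h) \<in> \<Gamma>})" for K
    proof -
      let ?D = "{x. \<exists>h\<in>K. (x, h) \<in> \<Gamma>}"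
      have "measure N (s n -` K) = (\<Sum>j\<in>K \<inter> I. \<Sum>i\<in>I. p (i,j))"
        unfolding b by (intro sum.cong refl p(3)[symmetric]) auto
      also have "\<dots> = (\<Sum>i\<in>I. \<Sum>j\<in>K \<inter> I. p (i,j))" by (rule sum.swap)
      \<comment> \<open>A row whose point has no partner in \<open>K\<close> sends no mass into
        \<open>K\<close>.\<close>
      also have "\<dots> = (\<Sum>i\<in>?D \<inter> I. \<Sum>j\<in>K \<inter> I. p (i,j))"
      proof (intro sum.mono_neutral_right)
        show "\<forall>i\<in>I - ?D \<inter> I. (\<Sum>j\<in>K \<inter> I. p (i,j)) = 0"
          using p(1) by (auto simp: \<Gamma>_def not_less intro!: sum.neutral antisym)
      qed (use \<open>finite I\<close> in auto)
      also have "\<dots> \<le> (\<Sum>i\<in>?D \<inter> I. a i)"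
        using \<open>finite I\<close> p(1) by (intro sum_mono) (auto simp: p(2)[symmetric] intro!: sum_mono2)
      finally show ?thesis unfolding a .
    qed
    then show ?thesis using p(4) unfolding \<Gamma>_def by blast
  qed
  obtain \<Gamma>0 where \<Gamma>0: "\<And>n. cyclically_monotone c (\<Gamma>0 n)"
    "\<And>n K. measure N (s n -` K) \<le> measure M (s n -` {x. \<exists>h\<in>K. (x, h) \<in> \<Gamma>0 n})"
    using choice[of "\<lambda>n \<Gamma>. cyclically_monotone c \<Gamma> \<and>
      (\<forall>K. measure N (s n -` K) \<le> measure M (s n -` {x. \<exists>h\<in>K. (x, h) \<in> \<Gamma>}))"] ex by blast
  obtain r where r: "strict_mono r"
    "\<And>z U. (\<And>U. open U \<Longrightarrow> z \<in> U \<Longrightarrow> \<exists>\<^sub>F n in sequentially. \<Gamma>0 (r n) \<inter> U \<noteq> {}) \<Longrightarrow>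
         open U \<Longrightarrow> z \<in> U \<Longrightarrow> \<forall>\<^sub>F n in sequentially. \<Gamma>0 (r n) \<inter> U \<noteq> {}"
    by (rule kuratowski_convergent_subsequence[of \<Gamma>0]) blast
  define \<Gamma>' where "\<Gamma>' n = \<Gamma>0 (r n)" for n
  define t where "t n = s (r n)" for n
  have t: "(\<lambda>n. t n x) \<longlonglongrightarrow> x" for x
    using LIMSEQ_subseq_LIMSEQ[OF s(2) r(1)] by (auto simp: t_def o_def)
  have t_meas: "t n -` A \<in> sets borel" for n A
    using simple_functionD(2)[OF s(1)[of "r n"], of A] by (simp add: t_def)
  \<comment> \<open>The upper limit, closed by its form. The choice of \<open>r\<close> makes it a
    lower limit as well, which is what \<open>cyclically_monotone_limit\<close> asks for.\<close>
  define \<Gamma> where "\<Gamma> = {z. \<forall>U. open U \<longrightarrow> z \<in> U \<longrightarrow> (\<exists>\<^sub>F n in sequentially. \<Gamma>' n \<inter> U \<noteq> {})}"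
  show ?thesis
  proof (rule that)
    show "closed \<Gamma>"
    proof -
      have "\<Gamma> = - \<Union>{U. open U \<and> \<not> (\<exists>\<^sub>F n in sequentially. \<Gamma>' n \<inter> U \<noteq> {})}" unfolding \<Gamma>_def by blast
      then show ?thesis by (auto intro!: closed_Compl open_Union)
    qed
    show "cyclically_monotone c \<Gamma>"
    proof (rule cyclically_monotone_limit[OF cont, of \<Gamma>'])
      show "cyclically_monotone c (\<Gamma>' n)" for n unfolding \<Gamma>'_def by (rule \<Gamma>0)
      show "\<forall>\<^sub>F n in sequentially. \<Gamma>' n \<inter> U \<noteq> {}" if "z \<in> \<Gamma>" "open U" "z \<in> U" for z U
        using r(2)[of z U] that unfolding \<Gamma>_def \<Gamma>'_def by blast
    qed
    fix U K :: "'a set" assume U: "open U" and K: "compact K" and UK: "U \<subseteq> K"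
    \<comment> \<open>Fatou's lemma for sets. \<open>V n\<close> increases to \<open>U\<close>
      because \<open>U\<close> is open and \<open>t k y\<close> tends to \<open>y\<close>; a point
      of all \<open>W n\<close> has partners in \<open>K\<close> infinitely often, and these
      accumulate because \<open>K\<close> is compact.\<close>
    define V where "V n = {y \<in> U. \<forall>k\<ge>n. t k y \<in> U}" for n
    define W where "W n = {x. \<exists>k\<ge>n. \<exists>h\<in>K. (t k x, h) \<in> \<Gamma>' k}" for n
    let ?D = "{x. \<exists>h\<in>K. (x, h) \<in> \<Gamma>}"
    have Vm: "V n \<in> sets N" for n
    proof -
      have "V n = U \<inter> (\<Inter>k\<in>{n..}. t k -` U)" unfolding V_def by auto
      then show ?thesis using U t_meas by (auto simp: N(2) intro!: sets.Int sets.countable_INT')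
    qed
    have Wm: "W n \<in> sets M" for n
    proof -
      have "W n = (\<Union>k\<in>{n..}. t k -` {x. \<exists>h\<in>K. (x, h) \<in> \<Gamma>' k})" unfolding W_def by auto
      moreover have "(\<Union>k\<in>{n..}. t k -` {x. \<exists>h\<in>K. (x, h) \<in> \<Gamma>' k}) \<in> sets borel"
        by (intro sets.countable_UN' image_subsetI t_meas) simp
      ultimately show ?thesis by (simp only: M(2))
    qed
    have VW: "measure N (V n) \<le> measure M (W n)" for n
    proof -
      have "measure N (V n) \<le> measure N (t n -` K)"
        using UK t_meas by (intro N.finite_measure_mono) (auto simp: V_def N(2))
      also have "\<dots> \<le> measure M (t n -` {x. \<exists>h\<in>K. (x, h) \<in> \<Gamma>' n})"
        unfolding t_def \<Gamma>'_def by (rule \<Gamma>0)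
      also have "\<dots> \<le> measure M (W n)" using Wm by (intro M.finite_measure_mono) (auto simp: W_def)
      finally show ?thesis .
    qed
    have limV: "(\<lambda>n. measure N (V n)) \<longlonglongrightarrow> measure N (\<Union>n. V n)"
    proof (rule N.finite_Lim_measure_incseq)
      show "incseq V" unfolding incseq_def V_def using order_trans by blast
    qed (use Vm in auto)
    have UV: "(\<Union>n. V n) = U"
    proof (intro equalityI subsetI)
      fix y assume "y \<in> U"
      then have "\<forall>\<^sub>F k in sequentially. t k y \<in> U" using topological_tendstoD[OF t U] by blast
      then show "y \<in> (\<Union>n. V n)" using \<open>y \<in> U\<close> by (auto simp: V_def eventually_sequentially)
    qed (auto simp: V_def)
    have limW: "(\<lambda>n. measure M (W n)) \<longlonglongrightarrow> measure M (\<Inter>n. W n)"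
    proof (rule M.finite_Lim_measure_decseq)
      show "decseq W" unfolding decseq_def W_def using order_trans by blast
    qed (use Wm in auto)
    have "measure N U \<le> measure M (\<Inter>n. W n)"
      using LIMSEQ_le[OF limV limW] VW by (simp add: UV)
    also have "\<dots> \<le> measure M ?D"
    proof (rule M.finite_measure_mono)
      show "?D \<in> sets M" using closed_section_preimage[OF \<open>closed \<Gamma>\<close> K] by (simp add: M(2))
      show "(\<Inter>n. W n) \<subseteq> ?D"
      proof
        fix x assume "x \<in> (\<Inter>n. W n)"
        then have "\<forall>n. \<exists>k. k \<ge> n \<and> (\<exists>h\<in>K. (t k x, h) \<in> \<Gamma>' k)" by (auto simp: W_def)
        then have "infinite {k. \<exists>h\<in>K. (t k x, h) \<in> \<Gamma>' k}"
          by (simp add: infinite_nat_iff_unbounded_le)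
        then obtain q :: "nat \<Rightarrow> nat" where q: "strict_mono q" "\<And>n. \<exists>h\<in>K. (t (q n) x, h) \<in> \<Gamma>' (q n)"
          using infinite_enumerate by blast
        then obtain h where h: "\<And>n. h n \<in> K" "\<And>n. (t (q n) x, h n) \<in> \<Gamma>' (q n)" by metis
        obtain k u where k: "k \<in> K" "strict_mono u" "(h \<circ> u) \<longlonglongrightarrow> k"
          using K h(1) unfolding compact_def by blast
        have qu: "strict_mono (\<lambda>n. q (u n))" using q(1) k(2) by (simp add: strict_mono_def)
        have lim: "(\<lambda>n. (t (q (u n)) x, h (u n))) \<longlonglongrightarrow> (x, k)"
          using LIMSEQ_subseq_LIMSEQ[OF t qu] k(3) by (intro tendsto_Pair) (auto simp: o_def)
        have "(x, k) \<in> \<Gamma>" unfolding \<Gamma>_def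
        proof (intro CollectI allI impI)
          fix O' assume O': "open O'" "(x, k) \<in> O'"
          obtain n0 where n0: "\<And>n. n \<ge> n0 \<Longrightarrow> (t (q (u n)) x, h (u n)) \<in> O'"
            using topological_tendstoD[OF lim O'] by (auto simp: eventually_sequentially)
          show "\<exists>\<^sub>F n in sequentially. \<Gamma>' n \<inter> O' \<noteq> {}"
            unfolding frequently_sequentially
          proof
            fix n
            have "q (u (max n n0)) \<ge> n" using seq_suble[OF qu, of "max n n0"] by simp
            moreover have "\<Gamma>' (q (u (max n n0))) \<inter> O' \<noteq> {}"
              using n0[of "max n n0"] h(2)[of "u (max n n0)"] by auto
            ultimately show "\<exists>k\<ge>n. \<Gamma>' k \<inter> O' \<noteq> {}" by blast
          qed
        qed
        then show "x \<in> ?D" using k(1) by blast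
      qed
    qed
    finally show "measure N U \<le> measure M ?D" .
  qed
qed

section \<open>Potentials, conjugates and contact sets\<close>

text \<open>The potential of a cyclically monotone relation is the supremum of
  \<open>chain_value m x\<^sub>0 h\<^sub>0 x\<close> over all chains in the relation (Rockafellar).\<close>

fun chain_value :: "('a \<Rightarrow> 'a \<Rightarrow> real) \<Rightarrow> 'a \<Rightarrow> 'a \<Rightarrow> 'a \<Rightarrow> ('a \<times> 'a) list \<Rightarrow> real" where
  "chain_value m x0 h0 x [] = m x h0 - m x0 h0"
| "chain_value m x0 h0 x (z # zs) = m x (snd z) - m (fst z) (snd z) + chain_value m x0 h0 (fst z) zs"

definition chain_potential ::
  "('a \<Rightarrow> 'a \<Rightarrow> real) \<Rightarrow> ('a \<times> 'a) set \<Rightarrow> 'a \<times> 'a \<Rightarrow> 'a \<Rightarrow> ereal" where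
  "chain_potential m \<Gamma> z0 x = (SUP zs\<in>lists \<Gamma>. ereal (chain_value m (fst z0) (snd z0) x zs))"

text \<open>Contact set of a potential \<open>f\<close> with effective domain \<open>A\<close>: at its points
  \<open>f\<close> and its conjugate satisfy Fenchel's equality.\<close>

definition contact :: "('a \<Rightarrow> 'b \<Rightarrow> real) \<Rightarrow> 'a set \<Rightarrow> ('a \<Rightarrow> real) \<Rightarrow> 'a \<Rightarrow> 'b \<Rightarrow> bool" where
  "contact m A f x h \<longleftrightarrow> x \<in> A \<and> (\<forall>z\<in>A. f x + m z h - m x h \<le> f z)"

definition conjugate :: "('a \<Rightarrow> 'b \<Rightarrow> real) \<Rightarrow> 'a set \<Rightarrow> ('a \<Rightarrow> real) \<Rightarrow> 'b \<Rightarrow> ereal" where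
  "conjugate m A f h = (SUP x\<in>A. ereal (m x h - f x))"

text \<open>The entry \<open>h\<close> is a dummy: only the first component of the head is read. It
  allows the points at which \<open>m\<close> is evaluated to be indexed by one list.\<close>

lemma chain_value_eq_sum:
  "chain_value m x0 h0 x zs =
    (\<Sum>i<length zs. m (fst (((x, h)#zs) ! i)) (snd (zs ! i)) - m (fst (zs ! i)) (snd (zs ! i)))
     + m (fst (((x, h)#zs) ! length zs)) h0 - m x0 h0"
proof (induction zs arbitrary: x h)
  case (Cons z zs)
  show ?case
    unfolding chain_value.simps Cons.IH[of "fst z" "snd z"] length_Cons sum.lessThan_Suc_shift
    by simp
qed simp

text \<open>A chain evaluated at \<open>fst z0\<close> closes up, together with \<open>z0\<close>,
  to a cycle in \<open>\<Gamma>\<close>; its value is the difference of the two sides of that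
  cycle's inequality.\<close>

lemma chain_value_nonpos:
  assumes cm: "cyclically_monotone (\<lambda>x h. - m x h) \<Gamma>" and z0: "z0 \<in> \<Gamma>" and zs: "zs \<in> lists \<Gamma>"
  shows "chain_value m (fst z0) (snd z0) (fst z0) zs \<le> 0"
proof -
  define L where "L = z0 # zs"
  define n where "n = length zs"
  have "set L \<subseteq> \<Gamma>" "length L = Suc n" using z0 zs by (auto simp: L_def n_def lists_eq_set)
  then have "\<forall>i<Suc n. (fst (L ! i), snd (L ! i)) \<in> \<Gamma>"
    using nth_mem[of _ L] by auto
  then have "(\<Sum>i<Suc n. - m (fst (L ! i)) (snd (L ! i))) \<le> (\<Sum>i<Suc n. - m (fst (L ! i)) (snd (L ! (Suc i mod Suc n))))"
    using cm[unfolded cyclically_monotone_def, rule_format, of "Suc n" "\<lambda>i. fst (L ! i)" "\<lambda>i. snd (L ! i)"] by simp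
  also have "(\<Sum>i<Suc n. - m (fst (L ! i)) (snd (L ! (Suc i mod Suc n)))) =
     (\<Sum>i<n. - m (fst (L ! i)) (snd (zs ! i))) - m (fst (L ! n)) (snd z0)"
    by (simp add: L_def)
  also have "(\<Sum>i<Suc n. - m (fst (L ! i)) (snd (L ! i))) = - m (fst z0) (snd z0) + (\<Sum>i<n. - m (fst (zs ! i)) (snd (zs ! i)))"
    by (subst sum.lessThan_Suc_shift) (simp add: L_def)
  finally show ?thesis
    unfolding chain_value_eq_sum[where h = "snd z0"] by (simp add: L_def n_def sum_subtractf sum_negf)
qed

lemma chain_potential_not_MInf: "chain_potential m \<Gamma> z0 x \<noteq> -\<infinity>"
proof -
  have "ereal (chain_value m (fst z0) (snd z0) x []) \<le> chain_potential m \<Gamma> z0 x"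
    unfolding chain_potential_def by (intro SUP_upper) auto
  then show ?thesis by auto
qed

text \<open>Prepending \<open>(x', h')\<close> to a chain evaluated at \<open>x'\<close> gives a
  chain evaluated at \<open>x\<close>.\<close>

lemma chain_potential_step:
  assumes "(x', h') \<in> \<Gamma>"
  shows "chain_potential m \<Gamma> z0 x' + ereal (m x h' - m x' h') \<le> chain_potential m \<Gamma> z0 x"
proof -
  have "chain_potential m \<Gamma> z0 x' \<le> chain_potential m \<Gamma> z0 x - ereal (m x h' - m x' h')"
    unfolding chain_potential_def[of _ _ _ x']
  proof (rule SUP_least)
    fix zs assume "zs \<in> lists \<Gamma>"
    then have "ereal (chain_value m (fst z0) (snd z0) x ((x', h') # zs)) \<le> chain_potential m \<Gamma> z0 x"
      using assms unfolding chain_potential_def by (intro SUP_upper) auto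
    then show "ereal (chain_value m (fst z0) (snd z0) x' zs) \<le> chain_potential m \<Gamma> z0 x - ereal (m x h' - m x' h')"
      by (cases "chain_potential m \<Gamma> z0 x") auto
  qed
  then show ?thesis by (simp add: ereal_le_minus)
qed

lemma chain_potential_base:
  assumes "cyclically_monotone (\<lambda>x h. - m x h) \<Gamma>" "z0 \<in> \<Gamma>"
  shows "chain_potential m \<Gamma> z0 (fst z0) \<le> 0"
  unfolding chain_potential_def
  using chain_value_nonpos[OF assms] by (intro SUP_least) (simp add: zero_ereal_def)

text \<open>Comparison with the base point, where the potential is at most 0, makes it finite at
  \<open>x\<close>; the rest is \<open>chain_potential_step\<close>.\<close>

lemma chain_potential_contact:
  assumes cm: "cyclically_monotone (\<lambda>x h. - m x h) \<Gamma>" and z0: "z0 \<in> \<Gamma>" and xh: "(x, h) \<in> \<Gamma>"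
  defines "\<psi> \<equiv> chain_potential m \<Gamma> z0"
  shows "contact m {x. \<psi> x \<noteq> \<infinity>} (\<lambda>x. real_of_ereal (\<psi> x)) x h"
proof -
  have step: "\<psi> x + ereal (m z h - m x h) \<le> \<psi> z" for z
    unfolding \<psi>_def using chain_potential_step[OF xh] .
  have "\<psi> (fst z0) \<le> 0" unfolding \<psi>_def by (rule chain_potential_base[OF cm z0])
  then have fin: "\<psi> x \<noteq> \<infinity>" using step[of "fst z0"] by auto
  have "real_of_ereal (\<psi> x) + m z h - m x h \<le> real_of_ereal (\<psi> z)" if "\<psi> z \<noteq> \<infinity>" for z
    using step[of z] fin that chain_potential_not_MInf[of m \<Gamma> z0] unfolding \<psi>_def
    by (cases "chain_potential m \<Gamma> z0 x"; cases "chain_potential m \<Gamma> z0 z") auto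
  with fin show ?thesis unfolding contact_def by auto
qed

lemma conjugate_contact:
  assumes "contact m A f x h"
  shows "conjugate m A f h = ereal (m x h - f x)"
  unfolding conjugate_def
proof (rule antisym)
  show "(SUP x\<in>A. ereal (m x h - f x)) \<le> ereal (m x h - f x)"
    using assms by (intro SUP_least) (force simp: contact_def)
  show "ereal (m x h - f x) \<le> (SUP x\<in>A. ereal (m x h - f x))"
    using assms by (intro SUP_upper) (auto simp: contact_def)
qed

lemma conjugate_ge:
  "x \<in> A \<Longrightarrow> ereal (m x h - f x) \<le> conjugate m A f h"
  unfolding conjugate_def by (rule SUP_upper)

lemma contact_iff_conjugate_le:
  assumes "x \<in> A"
  shows "contact m A f x h \<longleftrightarrow> conjugate m A f h \<le> ereal (m x h - f x)"
  using assms unfolding contact_def conjugate_def by (auto simp: SUP_le_iff algebra_simps)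

text \<open>\<open>I\<close> may be uncountable: measurability comes from superlevel sets being
  unions of open sets.\<close>

lemma borel_measurable_SUP_continuous:
  fixes k :: "'i \<Rightarrow> 'b::topological_space \<Rightarrow> real"
  assumes "\<And>i. i \<in> I \<Longrightarrow> continuous_on UNIV (k i)"
  shows "(\<lambda>y. SUP i\<in>I. ereal (k i y)) \<in> borel_measurable borel"
proof (rule borel_measurableI_greater)
  fix a :: ereal
  have "{y. a < (SUP i\<in>I. ereal (k i y))} = (\<Union>i\<in>I. {y. a < ereal (k i y)})"
    by (auto simp: less_SUP_iff)
  also have "open \<dots>"
    using assms by (intro open_UN ballI open_Collect_less continuous_intros continuous_on_ereal) auto
  finally show "{y \<in> space borel. a < (SUP i\<in>I. ereal (k i y))} \<in> sets borel" by simp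
qed

lemma borel_measurable_conjugate:
  fixes m :: "'a \<Rightarrow> 'b::topological_space \<Rightarrow> real"
  assumes "\<And>x. continuous_on UNIV (m x)"
  shows "conjugate m A f \<in> borel_measurable borel"
proof -
  have "conjugate m A f = (\<lambda>h. SUP x\<in>A. ereal (m x h - f x))" by (simp add: conjugate_def fun_eq_iff)
  then show ?thesis using assms borel_measurable_SUP_continuous[of A "\<lambda>x h. m x h - f x"]
    by (simp add: continuous_intros)
qed

lemma couplingsD:
  assumes "\<pi> \<in> couplings M N"
  shows "sets \<pi> = sets borel" "distr \<pi> borel fst = M" "distr \<pi> borel snd = N"
  using assms by (auto simp: couplings_def)

lemma AE_coupling:
  assumes "\<pi> \<in> couplings M N" and [measurable]: "Measurable.pred borel P"
  shows AE_coupling_fst: "(AE z in \<pi>. P (fst z)) \<longleftrightarrow> (AE x in M. P x)"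
    and AE_coupling_snd: "(AE z in \<pi>. P (snd z)) \<longleftrightarrow> (AE h in N. P h)"
proof -
  note c = couplingsD[OF assms(1)]
  have [measurable]: "fst \<in> measurable \<pi> borel" "snd \<in> measurable \<pi> borel"
    by (auto simp: measurable_cong_sets[OF c(1) refl] intro!: borel_measurable_continuous_onI continuous_intros)
  show "(AE z in \<pi>. P (fst z)) \<longleftrightarrow> (AE x in M. P x)"
    unfolding c(2)[symmetric] by (subst AE_distr_iff) auto
  show "(AE z in \<pi>. P (snd z)) \<longleftrightarrow> (AE x in N. P x)"
    unfolding c(3)[symmetric] by (subst AE_distr_iff) auto
qed

text \<open>Let \<open>g\<^sub>i\<close> be the conjugate of \<open>f\<^sub>i\<close>. Then \<open>g\<^sub>2 - g\<^sub>1 \<ge> f\<^sub>1 - f\<^sub>2\<close> holds almost surely for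
  \<open>\<pi>\<^sub>1\<close> and the reverse inequality for \<open>\<pi>\<^sub>2\<close>. Both couplings have the same marginals, so
  \<open>f\<^sub>1 - f\<^sub>2\<close> and \<open>g\<^sub>2 - g\<^sub>1\<close> have the same law and the first inequality is an equality.\<close>

theorem contact_transfer:
  fixes m :: "'a::euclidean_space \<Rightarrow> 'a \<Rightarrow> real"
  assumes \<pi>: "\<pi>\<^sub>1 \<in> couplings M N" "\<pi>\<^sub>2 \<in> couplings M N" and "prob_space \<pi>\<^sub>1" "prob_space \<pi>\<^sub>2"
    and cont: "\<And>x. continuous_on UNIV (m x)"
    and A: "A\<^sub>1 \<in> sets borel" "A\<^sub>2 \<in> sets borel"
    and f: "f\<^sub>1 \<in> borel_measurable borel" "f\<^sub>2 \<in> borel_measurable borel"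
    and c1: "AE z in \<pi>\<^sub>1. contact m A\<^sub>1 f\<^sub>1 (fst z) (snd z)"
    and c2: "AE z in \<pi>\<^sub>2. contact m A\<^sub>2 f\<^sub>2 (fst z) (snd z)"
  shows "AE z in \<pi>\<^sub>1. contact m A\<^sub>2 f\<^sub>2 (fst z) (snd z)"
proof -
  interpret p1: prob_space \<pi>\<^sub>1 by fact
  interpret p2: prob_space \<pi>\<^sub>2 by fact
  note s1 = couplingsD(1)[OF \<pi>(1)] and s2 = couplingsD(1)[OF \<pi>(2)]
  note [measurable] = f A
  define g\<^sub>1 where "g\<^sub>1 = conjugate m A\<^sub>1 f\<^sub>1"
  define g\<^sub>2 where "g\<^sub>2 = conjugate m A\<^sub>2 f\<^sub>2"
  have [measurable]: "g\<^sub>1 \<in> borel_measurable borel" "g\<^sub>2 \<in> borel_measurable borel"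
    unfolding g\<^sub>1_def g\<^sub>2_def by (rule borel_measurable_conjugate[OF cont])+
  have fin1: "AE z in \<pi>\<^sub>1. fst z \<in> A\<^sub>1 \<and> \<bar>g\<^sub>1 (snd z)\<bar> \<noteq> \<infinity>"
    using c1 by eventually_elim (auto simp: g\<^sub>1_def conjugate_contact contact_def)
  have fin2: "AE z in \<pi>\<^sub>2. fst z \<in> A\<^sub>2 \<and> \<bar>g\<^sub>2 (snd z)\<bar> \<noteq> \<infinity>"
    using c2 by eventually_elim (auto simp: g\<^sub>2_def conjugate_contact contact_def)
  \<comment> \<open>Membership in the domain and finiteness of the conjugate involve one coordinate
    each, so they travel between the couplings through the common marginals.\<close>
  have "AE x in M. x \<in> A\<^sub>1" "AE h in N. \<bar>g\<^sub>1 h\<bar> \<noteq> \<infinity>" "AE x in M. x \<in> A\<^sub>2" "AE h in N. \<bar>g\<^sub>2 h\<bar> \<noteq> \<infinity>"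
    using fin1 fin2 AE_coupling_fst[OF \<pi>(1), of "\<lambda>x. x \<in> A\<^sub>1"] AE_coupling_fst[OF \<pi>(2), of "\<lambda>x. x \<in> A\<^sub>2"]
      AE_coupling_snd[OF \<pi>(1), of "\<lambda>h. \<bar>g\<^sub>1 h\<bar> \<noteq> \<infinity>"] AE_coupling_snd[OF \<pi>(2), of "\<lambda>h. \<bar>g\<^sub>2 h\<bar> \<noteq> \<infinity>"]
    by auto
  then have fin: "AE z in \<pi>\<^sub>1. fst z \<in> A\<^sub>2 \<and> \<bar>g\<^sub>2 (snd z)\<bar> \<noteq> \<infinity>" "AE z in \<pi>\<^sub>2. fst z \<in> A\<^sub>1 \<and> \<bar>g\<^sub>1 (snd z)\<bar> \<noteq> \<infinity>"
    using AE_coupling_fst[OF \<pi>(2), of "\<lambda>x. x \<in> A\<^sub>1"] AE_coupling_fst[OF \<pi>(1), of "\<lambda>x. x \<in> A\<^sub>2"]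
      AE_coupling_snd[OF \<pi>(2), of "\<lambda>h. \<bar>g\<^sub>1 h\<bar> \<noteq> \<infinity>"] AE_coupling_snd[OF \<pi>(1), of "\<lambda>h. \<bar>g\<^sub>2 h\<bar> \<noteq> \<infinity>"]
    by auto
  define u where "u x = f\<^sub>1 x - f\<^sub>2 x" for x
  define v where "v h = real_of_ereal (g\<^sub>2 h) - real_of_ereal (g\<^sub>1 h)" for h
  have [measurable]: "u \<in> borel_measurable borel" "v \<in> borel_measurable borel"
    unfolding u_def v_def by measurable
  have [measurable]: "fst \<in> measurable \<pi>\<^sub>1 borel" "snd \<in> measurable \<pi>\<^sub>1 borel" "fst \<in> measurable \<pi>\<^sub>2 borel" "snd \<in> measurable \<pi>\<^sub>2 borel"
    by (auto simp: measurable_cong_sets[OF s1 refl] measurable_cong_sets[OF s2 refl]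
        intro!: borel_measurable_continuous_onI continuous_intros)
  have uv: "AE z in \<pi>\<^sub>1. u (fst z) \<le> v (snd z)"
    using c1 fin(1)
  proof eventually_elim
    case (elim z)
    then show ?case
      using conjugate_contact[OF elim(1)] conjugate_ge[of "fst z" A\<^sub>2 m "snd z" f\<^sub>2]
      by (cases "g\<^sub>2 (snd z)") (auto simp: u_def v_def g\<^sub>1_def g\<^sub>2_def)
  qed
  have vu: "AE z in \<pi>\<^sub>2. v (snd z) \<le> u (fst z)"
    using c2 fin(2)
  proof eventually_elim
    case (elim z)
    then show ?case
      using conjugate_contact[OF elim(1)] conjugate_ge[of "fst z" A\<^sub>1 m "snd z" f\<^sub>1]
      by (cases "g\<^sub>1 (snd z)") (auto simp: u_def v_def g\<^sub>1_def g\<^sub>2_def)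
  qed
  have law_fst: "measure \<pi>\<^sub>1 {z \<in> space \<pi>\<^sub>1. u (fst z) > t} = measure \<pi>\<^sub>2 {z \<in> space \<pi>\<^sub>2. u (fst z) > t}" for t
  proof -
    have "measure \<pi>\<^sub>1 {z \<in> space \<pi>\<^sub>1. u (fst z) > t} = measure (distr \<pi>\<^sub>1 borel fst) {x. u x > t}"
      by (subst measure_distr) (auto intro!: arg_cong[where f = "measure _"])
    also have "\<dots> = measure (distr \<pi>\<^sub>2 borel fst) {x. u x > t}"
      using couplingsD[OF \<pi>(1)] couplingsD[OF \<pi>(2)] by simp
    also have "\<dots> = measure \<pi>\<^sub>2 {z \<in> space \<pi>\<^sub>2. u (fst z) > t}"
      by (subst measure_distr) (auto intro!: arg_cong[where f = "measure _"])
    finally show ?thesis .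
  qed
  have law_snd: "measure \<pi>\<^sub>1 {z \<in> space \<pi>\<^sub>1. v (snd z) > t} = measure \<pi>\<^sub>2 {z \<in> space \<pi>\<^sub>2. v (snd z) > t}" for t
  proof -
    have "measure \<pi>\<^sub>1 {z \<in> space \<pi>\<^sub>1. v (snd z) > t} = measure (distr \<pi>\<^sub>1 borel snd) {x. v x > t}"
      by (subst measure_distr) (auto intro!: arg_cong[where f = "measure _"])
    also have "\<dots> = measure (distr \<pi>\<^sub>2 borel snd) {x. v x > t}"
      using couplingsD[OF \<pi>(1)] couplingsD[OF \<pi>(2)] by simp
    also have "\<dots> = measure \<pi>\<^sub>2 {z \<in> space \<pi>\<^sub>2. v (snd z) > t}"
      by (subst measure_distr) (auto intro!: arg_cong[where f = "measure _"])
    finally show ?thesis .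
  qed
  \<comment> \<open>Without integrability the expectations of \<open>u\<close> and \<open>v\<close>
    cannot be compared. Tail probabilities can: for each rational \<open>q\<close> the event
    \<open>u \<le> q < v\<close> is null, and countably many \<open>q\<close> separate
    \<open>u\<close> from \<open>v\<close>.\<close>
  have "AE z in \<pi>\<^sub>1. \<forall>q::rat. \<not> (v (snd z) > of_rat q \<and> u (fst z) \<le> of_rat q)"
    unfolding AE_all_countable
  proof
    fix q :: rat
    let ?t = "of_rat q :: real"
    have "measure \<pi>\<^sub>1 {z \<in> space \<pi>\<^sub>1. v (snd z) > ?t} = measure \<pi>\<^sub>2 {z \<in> space \<pi>\<^sub>2. v (snd z) > ?t}" by (rule law_snd)
    also have "\<dots> \<le> measure \<pi>\<^sub>2 {z \<in> space \<pi>\<^sub>2. u (fst z) > ?t}"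
      using vu by (intro p2.finite_measure_mono_AE) auto
    finally have le: "measure \<pi>\<^sub>1 {z \<in> space \<pi>\<^sub>1. v (snd z) > ?t} \<le> measure \<pi>\<^sub>1 {z \<in> space \<pi>\<^sub>1. u (fst z) > ?t}"
      by (simp add: law_fst)
    have "measure \<pi>\<^sub>1 {z \<in> space \<pi>\<^sub>1. v (snd z) > ?t} =
        measure \<pi>\<^sub>1 {z \<in> space \<pi>\<^sub>1. v (snd z) > ?t \<and> u (fst z) > ?t} +
        measure \<pi>\<^sub>1 {z \<in> space \<pi>\<^sub>1. v (snd z) > ?t \<and> u (fst z) \<le> ?t}"
      by (subst p1.finite_measure_Union[symmetric]) (auto intro!: arg_cong[where f = "measure _"])
    moreover have "measure \<pi>\<^sub>1 {z \<in> space \<pi>\<^sub>1. v (snd z) > ?t \<and> u (fst z) > ?t} = measure \<pi>\<^sub>1 {z \<in> space \<pi>\<^sub>1. u (fst z) > ?t}"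
      using uv by (intro p1.finite_measure_eq_AE) auto
    ultimately have "measure \<pi>\<^sub>1 {z \<in> space \<pi>\<^sub>1. v (snd z) > ?t \<and> u (fst z) \<le> ?t} = 0"
      using le measure_nonneg[of \<pi>\<^sub>1] by (smt (verit))
    then show "AE z in \<pi>\<^sub>1. \<not> (v (snd z) > ?t \<and> u (fst z) \<le> ?t)"
      by (subst (asm) p1.prob_eq_0) auto
  qed
  then have "AE z in \<pi>\<^sub>1. v (snd z) \<le> u (fst z)"
  proof eventually_elim
    case (elim z)
    show ?case
    proof (rule ccontr)
      assume "\<not> v (snd z) \<le> u (fst z)"
      then obtain q where "u (fst z) < of_rat q" "of_rat q < v (snd z)"
        using of_rat_dense[of "u (fst z)" "v (snd z)"] by auto
      then show False using elim by (meson less_imp_le)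
    qed
  qed
  with c1 fin(1) show ?thesis
  proof eventually_elim
    case (elim z)
    then show ?case
      using conjugate_contact[OF elim(1)] contact_iff_conjugate_le[of "fst z" A\<^sub>2 m f\<^sub>2 "snd z"]
      by (cases "g\<^sub>2 (snd z)") (auto simp: u_def v_def g\<^sub>1_def g\<^sub>2_def)
  qed
qed

section \<open>Gradients of extended-valued convex functions\<close>

lemma has_grad_at_unique:
  assumes "has_grad_at \<phi> x g" "has_grad_at \<phi> x g'" shows "g = g'"
proof -
  have "(\<lambda>h. g \<bullet> h) = (\<lambda>h. g' \<bullet> h)"
    using assms has_derivative_unique unfolding has_grad_at_def by blast
  then have "\<forall>h. g \<bullet> h = g' \<bullet> h" by meson
  then show ?thesis using vector_eq_ldot[of g g'] by (metis inner_commute)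
qed

lemma has_grad_at_egrad: "ediff_at \<phi> x \<Longrightarrow> has_grad_at \<phi> x (egrad \<phi> x)"
  using has_grad_at_unique theI[of "has_grad_at \<phi> x"] unfolding egrad_def ediff_at_def by metis

lemma egrad_eqI: "has_grad_at \<phi> x g \<Longrightarrow> egrad \<phi> x = g"
  using has_grad_at_egrad has_grad_at_unique unfolding ediff_at_def by blast

lemma has_grad_at_interior:
  "has_grad_at \<phi> x g \<Longrightarrow> x \<in> interior {y. \<phi> y \<noteq> \<infinity>}"
  unfolding has_grad_at_def mem_interior by blast

lemma ereal_convex_on_domain:
  assumes "ereal_convex \<phi>"
  shows "convex_on {x. \<phi> x \<noteq> \<infinity>} (\<lambda>x. real_of_ereal (\<phi> x))"
proof -
  have fin: "\<bar>\<phi> x\<bar> \<noteq> \<infinity>" if "\<phi> x \<noteq> \<infinity>" for x using assms that by (auto simp: ereal_convex_def)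
  have le: "\<phi> ((1 - t) *\<^sub>R x + t *\<^sub>R y) \<le> ereal ((1 - t) * real_of_ereal (\<phi> x) + t * real_of_ereal (\<phi> y))"
    if "\<phi> x \<noteq> \<infinity>" "\<phi> y \<noteq> \<infinity>" "0 \<le> t" "t \<le> 1" for x y t
  proof -
    have "\<phi> ((1 - t) *\<^sub>R x + t *\<^sub>R y) \<le> ereal (1 - t) * \<phi> x + ereal t * \<phi> y"
      using assms that(3,4) by (auto simp: ereal_convex_def)
    then show ?thesis using fin[OF that(1)] fin[OF that(2)] by (cases "\<phi> x"; cases "\<phi> y") auto
  qed
  have conv: "convex {x. \<phi> x \<noteq> \<infinity>}"
    unfolding convex_alt
  proof (intro ballI allI impI)
    fix x y t assume "x \<in> {x. \<phi> x \<noteq> \<infinity>}" "y \<in> {x. \<phi> x \<noteq> \<infinity>}" "0 \<le> t \<and> t \<le> (1::real)"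
    then show "(1 - t) *\<^sub>R x + t *\<^sub>R y \<in> {x. \<phi> x \<noteq> \<infinity>}" using le[of x y t] by auto
  qed
  show ?thesis
  proof (rule convex_onI[OF _ conv])
    fix t :: real and x y assume h: "0 < t" "t < 1" "x \<in> {x. \<phi> x \<noteq> \<infinity>}" "y \<in> {x. \<phi> x \<noteq> \<infinity>}"
    then have "(1 - t) *\<^sub>R x + t *\<^sub>R y \<in> {x. \<phi> x \<noteq> \<infinity>}" using conv by (simp add: convex_alt)
    then show "real_of_ereal (\<phi> ((1 - t) *\<^sub>R x + t *\<^sub>R y)) \<le> (1 - t) * real_of_ereal (\<phi> x) + t * real_of_ereal (\<phi> y)"
      using le[of x y t] h fin[of "(1 - t) *\<^sub>R x + t *\<^sub>R y"]
      by (cases "\<phi> ((1 - t) *\<^sub>R x + t *\<^sub>R y)") auto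
  qed
qed

lemma gradient_inequality:
  assumes conv: "ereal_convex \<phi>" and g: "has_grad_at \<phi> x g" and z: "\<phi> z \<noteq> \<infinity>"
  shows "real_of_ereal (\<phi> x) + g \<bullet> (z - x) \<le> real_of_ereal (\<phi> z)"
proof -
  define f where "f y = real_of_ereal (\<phi> y)" for y
  have xd: "\<phi> x \<noteq> \<infinity>" using has_grad_at_interior[OF g] interior_subset by blast
  have cf: "convex_on {x. \<phi> x \<noteq> \<infinity>} f" unfolding f_def by (rule ereal_convex_on_domain[OF conv])
  have der: "(f has_derivative (\<lambda>h. g \<bullet> h)) (at x)"
    using g unfolding has_grad_at_def f_def by simp
  have "((\<lambda>t. f (x + t *\<^sub>R (z - x))) has_derivative (\<lambda>t. g \<bullet> (t *\<^sub>R (z - x)))) (at 0)"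
    by (rule has_derivative_compose[of "\<lambda>t::real. x + t *\<^sub>R (z - x)" "\<lambda>t. t *\<^sub>R (z - x)" 0 UNIV f "\<lambda>h. g \<bullet> h"])
       (use der in \<open>auto intro!: derivative_eq_intros\<close>)
  then have "((\<lambda>t. f (x + t *\<^sub>R (z - x))) has_real_derivative (g \<bullet> (z - x))) (at 0)"
    by (simp add: has_field_derivative_def mult.commute[of _ "g \<bullet> (z - x)"])
  then have "((\<lambda>t. (f (x + t *\<^sub>R (z - x)) - f x) / t) \<longlongrightarrow> g \<bullet> (z - x)) (at 0)"
    by (simp add: has_field_derivative_iff)
  then have "((\<lambda>t. (f (x + t *\<^sub>R (z - x)) - f x) / t) \<longlongrightarrow> g \<bullet> (z - x)) (at_right 0)"
    by (simp add: filterlim_at_split)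
  moreover have "\<forall>\<^sub>F t in at_right 0. (f (x + t *\<^sub>R (z - x)) - f x) / t \<le> f z - f x"
    unfolding eventually_at_right_field
  proof (intro exI[of _ "1::real"] conjI allI impI)
    fix t :: real assume t: "0 < t" "t < 1"
    have "f ((1 - t) *\<^sub>R x + t *\<^sub>R z) \<le> (1 - t) * f x + t * f z"
      using convex_onD[OF cf, of t x z] t xd z by simp
    moreover have "(1 - t) *\<^sub>R x + t *\<^sub>R z = x + t *\<^sub>R (z - x)" by (simp add: algebra_simps)
    ultimately show "(f (x + t *\<^sub>R (z - x)) - f x) / t \<le> f z - f x"
      using t by (simp add: field_simps)
  qed simp
  ultimately have "g \<bullet> (z - x) \<le> f z - f x"
    using tendsto_upperbound trivial_limit_at_right_real by blast
  then show ?thesis by (simp add: f_def)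
qed

lemma subgradient_eq_gradient:
  assumes g: "has_grad_at \<phi> x g"
    and sub: "\<And>z. \<phi> z \<noteq> \<infinity> \<Longrightarrow> real_of_ereal (\<phi> x) + y \<bullet> (z - x) \<le> real_of_ereal (\<phi> z)"
  shows "y = g"
proof -
  let ?f = "\<lambda>z. real_of_ereal (\<phi> z) - y \<bullet> (z - x)"
  have "(?f has_derivative (\<lambda>h. g \<bullet> h - y \<bullet> h)) (at x)"
    using g unfolding has_grad_at_def by (auto intro!: derivative_eq_intros)
  moreover have "\<forall>z\<in>interior {y. \<phi> y \<noteq> \<infinity>}. ?f x \<le> ?f z"
    using sub interior_subset by force
  ultimately have "(\<lambda>h. g \<bullet> h - y \<bullet> h) = (\<lambda>h. 0)"
    using differential_zero_maxmin[OF has_grad_at_interior[OF g] open_interior] by blast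
  then have "g \<bullet> (g - y) - y \<bullet> (g - y) = 0" by meson
  then show ?thesis by (simp flip: inner_diff_left)
qed

section \<open>Almost everywhere differentiability of convex functions and measurability of the
  gradient\<close>

lemma convex_on_slopes:
  fixes F :: "real \<Rightarrow> real"
  assumes "convex_on J F" "a \<in> J" "c \<in> J" "a < b" "b < c"
  shows "(F b - F a) / (b - a) \<le> (F c - F a) / (c - a)"
    and "(F c - F a) / (c - a) \<le> (F c - F b) / (c - b)"
    and "(F b - F a) / (b - a) \<le> (F c - F b) / (c - b)"
proof -
  show "(F b - F a) / (b - a) \<le> (F c - F a) / (c - a)"
    using convex_on_slope_le(1)[OF assms] by (metis minus_diff_eq minus_divide_divide)
  moreover show "(F c - F a) / (c - a) \<le> (F c - F b) / (c - b)"
    using convex_on_slope_le(2)[OF assms] by (metis minus_diff_eq minus_divide_divide)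
  ultimately show "(F b - F a) / (b - a) \<le> (F c - F b) / (c - b)" by linarith
qed

lemma convex_on_line:
  assumes "convex_on U f"
  shows "convex_on {t. x + t *\<^sub>R v \<in> U} (\<lambda>t. f (x + t *\<^sub>R v))"
proof -
  have eq: "x + ((1 - u) * s + u * t) *\<^sub>R v = (1 - u) *\<^sub>R (x + s *\<^sub>R v) + u *\<^sub>R (x + t *\<^sub>R v)" for u s t
    by (simp add: algebra_simps)
  have U: "convex U" using assms by (simp add: convex_on_def)
  have "convex {t. x + t *\<^sub>R v \<in> U}"
    unfolding convex_alt using U by (auto simp: eq convex_alt)
  then show ?thesis
    by (intro convex_onI) (use convex_onD[OF assms] in \<open>auto simp: eq\<close>)
qed

text \<open>For convex \<open>f\<close> this says that the two one-sided derivatives along \<open>v\<close> agree, because the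
  symmetric second difference quotient is monotone in the step. The quantifiers are countable, so
  that the set of such points is visibly Borel.\<close>

definition smooth_along :: "'a::real_vector set \<Rightarrow> ('a \<Rightarrow> real) \<Rightarrow> 'a \<Rightarrow> 'a \<Rightarrow> bool" where
  "smooth_along U f v x \<longleftrightarrow> (\<forall>k::nat. \<exists>n::nat.
     x + inverse (Suc n) *\<^sub>R v \<in> U \<and> x - inverse (Suc n) *\<^sub>R v \<in> U \<and>
     real (Suc n) * (f (x + inverse (Suc n) *\<^sub>R v) + f (x - inverse (Suc n) *\<^sub>R v) - 2 * f x) < inverse (Suc k))"

text \<open>\<open>g\<close> is the right derivative, the infimum of the right slopes; smoothness
  yields a left and a right slope that bracket it within \<open>e\<close>. Only the upper estimate
  is recorded, because convexity later supplies the lower one by reflection.\<close>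

lemma smooth_along_tangent:
  fixes x v :: "'a::real_normed_vector"
  assumes conv: "convex_on U f" and xU: "x \<in> U" and sm: "smooth_along U f v x"
  obtains g where "\<And>e. e > 0 \<Longrightarrow> \<exists>d>0. \<forall>s. \<bar>s\<bar> < d \<longrightarrow> x + s *\<^sub>R v \<in> U \<and> f (x + s *\<^sub>R v) \<le> f x + g * s + e * \<bar>s\<bar>"
proof -
  define F where "F s = f (x + s *\<^sub>R v)" for s
  define J where "J = {s. x + s *\<^sub>R v \<in> U}"
  have cF: "convex_on J F" unfolding F_def J_def by (rule convex_on_line[OF conv])
  have J0: "0 \<in> J" using xU by (simp add: J_def)
  define g where "g = Inf ((\<lambda>t. (F t - F 0) / t) ` {t\<in>J. t > 0})"
  have ex: "\<exists>t>0. t \<in> J \<and> -t \<in> J \<and> (F t - F 0) / t - (F 0 - F (-t)) / t < e" if e: "e > 0" for e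
  proof -
    obtain k where k: "inverse (Suc k) < e" using reals_Archimedean[OF e] by auto
    obtain n where n: "x + inverse (Suc n) *\<^sub>R v \<in> U" "x - inverse (Suc n) *\<^sub>R v \<in> U"
      "real (Suc n) * (f (x + inverse (Suc n) *\<^sub>R v) + f (x - inverse (Suc n) *\<^sub>R v) - 2 * f x) < inverse (Suc k)"
      using sm unfolding smooth_along_def by blast
    define t :: real where "t = inverse (Suc n)"
    have "(F t - F 0) / t - (F 0 - F (-t)) / t = real (Suc n) * (F t + F (-t) - 2 * F 0)"
      unfolding t_def by (simp add: field_simps)
    also have "\<dots> < e" using n(3) k unfolding F_def t_def by simp
    finally show ?thesis using n(1,2) by (intro exI[of _ t]) (auto simp: J_def t_def)
  qed
  have left_right: "(F 0 - F (-s)) / s \<le> (F t - F 0) / t" if "s > 0" "-s \<in> J" "t > 0" "t \<in> J" for s t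
    using convex_on_slopes(3)[OF cF, of "-s" t 0] that by simp
  obtain t0 where t0: "t0 > 0" "t0 \<in> J" "-t0 \<in> J" using ex[of 1] by auto
  have bdd: "bdd_below ((\<lambda>t. (F t - F 0) / t) ` {t\<in>J. t > 0})"
    using left_right t0 by (intro bdd_belowI2[of _ "(F 0 - F (-t0)) / t0"]) auto
  have g_le: "g \<le> (F t - F 0) / t" if "t > 0" "t \<in> J" for t
    unfolding g_def using that bdd by (intro cInf_lower) auto
  have g_ge: "(F 0 - F (-s)) / s \<le> g" if "s > 0" "-s \<in> J" for s
    unfolding g_def using t0 left_right that by (intro cInf_greatest) auto
  show ?thesis
  proof (rule that[of g])
    fix e :: real assume "e > 0"
    obtain t where t: "t > 0" "t \<in> J" "-t \<in> J" "(F t - F 0) / t - (F 0 - F (-t)) / t < e"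
      using ex[OF \<open>e > 0\<close>] by auto
    have "s \<in> J \<and> F s \<le> F 0 + g * s + e * \<bar>s\<bar>" if s: "\<bar>s\<bar> < t" for s
    proof
      have "convex J" using cF by (simp add: convex_on_def)
      then have "closed_segment (-t) t \<subseteq> J" using t by (intro closed_segment_subset) auto
      then show sJ: "s \<in> J" using s t(1) by (auto simp: closed_segment_eq_real_ivl abs_less_iff subset_iff)
      consider "s = 0" | "s > 0" | "s < 0" by linarith
      then show "F s \<le> F 0 + g * s + e * \<bar>s\<bar>"
      proof cases
        case 2
        have "(F s - F 0) / s \<le> (F t - F 0) / t"
          using convex_on_slopes(1)[OF cF J0 t(2), of s] 2 s by simp
        also have "\<dots> \<le> g + e" using t(4) g_ge[OF t(1) t(3)] by linarith
        finally show ?thesis using 2 by (simp add: field_simps)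
      next
        case 3
        have "(F 0 - F (-t)) / t \<le> (F 0 - F s) / (- s)"
          using convex_on_slopes(2)[OF cF t(3) J0, of s] 3 s by simp
        moreover have "g - e \<le> (F 0 - F (-t)) / t" using t(4) g_le[OF t(1) t(2)] by linarith
        ultimately have "g - e \<le> (F 0 - F s) / (- s)" by linarith
        then have "(g - e) * (- s) \<le> F 0 - F s" using 3 by (subst (asm) pos_le_divide_eq) auto
        then show ?thesis using 3 by (simp add: algebra_simps)
      qed simp
    qed
    then show "\<exists>d>0. \<forall>s. \<bar>s\<bar> < d \<longrightarrow> x + s *\<^sub>R v \<in> U \<and> f (x + s *\<^sub>R v) \<le> f x + g * s + e * \<bar>s\<bar>"
      using t(1) by (intro exI[of _ t]) (auto simp: F_def J_def)
  qed
qed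

text \<open>With \<open>n\<close> the dimension, \<open>x + h\<close> is the average of
  \<open>n\<close> points, each displaced from \<open>x\<close> along one axis by \<open>n\<close>
  times that coordinate of \<open>h\<close>; convexity turns the axis estimates into an upper bound.
  The lower bound follows since \<open>x\<close> is the midpoint of \<open>y\<close> and its
  reflection \<open>2x - y\<close>.\<close>

lemma smooth_along_imp_differentiable:
  fixes f :: "'a::euclidean_space \<Rightarrow> real"
  assumes conv: "convex_on U f" and xU: "x \<in> U" and sm: "\<And>i. i \<in> Basis \<Longrightarrow> smooth_along U f i x"
  shows "\<exists>g. (f has_derivative (\<lambda>h. g \<bullet> h)) (at x)"
proof -
  have "\<forall>i\<in>Basis. \<exists>g. \<forall>e>0. \<exists>d>0. \<forall>s. \<bar>s\<bar> < d \<longrightarrow> x + s *\<^sub>R i \<in> U \<and> f (x + s *\<^sub>R i) \<le> f x + g * s + e * \<bar>s\<bar>"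
    using smooth_along_tangent[OF conv xU sm] by metis
  then obtain G where G: "\<And>i e. i \<in> Basis \<Longrightarrow> e > 0 \<Longrightarrow>
      \<exists>d>0. \<forall>s. \<bar>s\<bar> < d \<longrightarrow> x + s *\<^sub>R i \<in> U \<and> f (x + s *\<^sub>R i) \<le> f x + G i * s + e * \<bar>s\<bar>"
    by metis
  define g where "g = (\<Sum>i\<in>Basis. G i *\<^sub>R i)"
  have gh: "g \<bullet> h = (\<Sum>i\<in>Basis. G i * (h \<bullet> i))" for h
    by (simp add: g_def inner_sum_left inner_commute[of h])
  let ?n = "real DIM('a)"
  have n: "?n > 0" by simp
  have "(f has_derivative (\<lambda>h. g \<bullet> h)) (at x)"
    unfolding has_derivative_at_alt
  proof (intro conjI allI impI bounded_linear_inner_right)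
    fix e :: real assume e: "e > 0"
    have "\<forall>i\<in>Basis. \<exists>d>0. \<forall>s. \<bar>s\<bar> < d \<longrightarrow> x + s *\<^sub>R i \<in> U \<and> f (x + s *\<^sub>R i) \<le> f x + G i * s + (e / ?n) * \<bar>s\<bar>"
      using G[OF _ divide_pos_pos[OF e n]] by blast
    then obtain D where D: "\<And>i. i \<in> Basis \<Longrightarrow> D i > 0"
      "\<And>i s. i \<in> Basis \<Longrightarrow> \<bar>s\<bar> < D i \<Longrightarrow> x + s *\<^sub>R i \<in> U \<and> f (x + s *\<^sub>R i) \<le> f x + G i * s + (e / ?n) * \<bar>s\<bar>"
      by metis
    \<comment> \<open>The axis displacements are \<open>n\<close> times the coordinates of
      \<open>h\<close>, hence the division.\<close>
    define d where "d = Min (D ` (Basis :: 'a set)) / ?n"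
    have d: "d > 0" using D(1) n unfolding d_def by (simp add: Min_gr_iff)
    have dD: "?n * d \<le> D i" if "i \<in> Basis" for i using that unfolding d_def by simp
    have upper: "f (x + h) \<le> f x + g \<bullet> h + e * norm h" and in_U: "x + h \<in> U" if h: "norm h < d" for h
    proof -
      have s: "\<bar>?n * (h \<bullet> i)\<bar> < D i" if "i \<in> Basis" for i
      proof -
        have "?n * \<bar>h \<bullet> i\<bar> < ?n * d" using h Basis_le_norm[OF that, of h] n by simp
        then show ?thesis using dD[OF that] unfolding abs_mult by (simp only: abs_of_nat)
      qed
      have eq: "x + h = (\<Sum>i\<in>Basis. (1 / ?n) *\<^sub>R (x + (?n * (h \<bullet> i)) *\<^sub>R i))"
        by (simp add: scaleR_add_right sum.distrib euclidean_representation sum_constant_scaleR)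
      have mem: "x + (?n * (h \<bullet> i)) *\<^sub>R i \<in> U" if "i \<in> Basis" for i using D(2)[OF that s[OF that]] by simp
      have "f (x + h) \<le> (\<Sum>i\<in>Basis. (1 / ?n) * f (x + (?n * (h \<bullet> i)) *\<^sub>R i))"
        unfolding eq using mem by (intro convex_on_sum[OF _ _ conv]) auto
      also have "\<dots> \<le> (\<Sum>i\<in>Basis. (1 / ?n) * (f x + G i * (?n * (h \<bullet> i)) + (e / ?n) * \<bar>?n * (h \<bullet> i)\<bar>))"
        using D(2) s by (intro sum_mono mult_left_mono) auto
      also have "\<dots> = (\<Sum>i\<in>Basis. f x / ?n + G i * (h \<bullet> i) + (e / ?n) * \<bar>h \<bullet> i\<bar>)"
        by (intro sum.cong) (auto simp: field_simps abs_mult)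
      also have "\<dots> \<le> (\<Sum>i\<in>Basis. f x / ?n + G i * (h \<bullet> i) + (e / ?n) * norm h)"
        using e Basis_le_norm[of _ h] by (intro sum_mono add_left_mono mult_left_mono) auto
      also have "\<dots> = f x + g \<bullet> h + e * norm h" by (simp add: sum.distrib gh)
      finally show "f (x + h) \<le> f x + g \<bullet> h + e * norm h" .
      have "convex U" using conv by (simp add: convex_on_def)
      then show "x + h \<in> U" unfolding eq using mem by (intro convex_sum) auto
    qed
    have "norm (f y - f x - g \<bullet> (y - x)) \<le> e * norm (y - x)" if y: "norm (y - x) < d" for y
    proof -
      have "f ((1 - 1/2) *\<^sub>R y + (1/2) *\<^sub>R (x + (x - y))) \<le> (1 - 1/2) * f y + (1/2) * f (x + (x - y))"
        using in_U[of "y - x"] in_U[of "x - y"] y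
        by (intro convex_onD[OF conv]) (auto simp: norm_minus_commute)
      moreover have "(1 - 1/2) *\<^sub>R y + (1/2) *\<^sub>R (x + (x - y)) = x"
        by (simp add: algebra_simps flip: scaleR_left.add)
      ultimately have "2 * f x \<le> f y + f (x + (x - y))" by simp
      then show ?thesis
        using upper[of "y - x"] upper[of "x - y"] y
        by (auto simp: norm_minus_commute[of x y] inner_diff_right abs_le_iff)
    qed
    then show "\<exists>d>0. \<forall>y. norm (y - x) < d \<longrightarrow> norm (f y - f x - g \<bullet> (y - x)) \<le> e * norm (y - x)"
      using d by blast
  qed
  then show ?thesis by blast
qed

lemma difference_quotient_tendsto:
  fixes f :: "'a::real_inner \<Rightarrow> real"
  assumes der: "(f has_derivative (\<lambda>h. g \<bullet> h)) (at x)"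
  shows "(\<lambda>n. real (Suc n) * (f (x + inverse (Suc n) *\<^sub>R w) - f x)) \<longlonglongrightarrow> g \<bullet> w"
proof -
  have "((\<lambda>t. f (x + t *\<^sub>R w)) has_derivative (\<lambda>t. g \<bullet> (t *\<^sub>R w))) (at 0)"
    by (rule has_derivative_compose[of "\<lambda>t::real. x + t *\<^sub>R w" "\<lambda>t. t *\<^sub>R w" 0 UNIV f "\<lambda>h. g \<bullet> h"])
       (use der in \<open>auto intro!: derivative_eq_intros\<close>)
  then have "((\<lambda>t. f (x + t *\<^sub>R w)) has_real_derivative (g \<bullet> w)) (at 0)"
    by (simp add: has_field_derivative_def mult.commute[of _ "g \<bullet> w"])
  then have "((\<lambda>t. (f (x + t *\<^sub>R w) - f x) / t) \<longlongrightarrow> g \<bullet> w) (at 0)"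
    by (simp add: has_field_derivative_iff)
  moreover have "filterlim (\<lambda>n. inverse (real (Suc n))) (at 0) sequentially"
    using LIMSEQ_inverse_real_of_nat by (auto simp: filterlim_at)
  ultimately have "(\<lambda>n. (f (x + inverse (real (Suc n)) *\<^sub>R w) - f x) / inverse (real (Suc n))) \<longlonglongrightarrow> g \<bullet> w"
    by (rule filterlim_compose)
  then show ?thesis by (simp add: divide_inverse mult.commute)
qed

text \<open>The symmetric second difference quotient is the sum of the difference quotients along
  \<open>v\<close> and \<open>-v\<close>, whose limits cancel.\<close>

lemma differentiable_imp_smooth_along:
  fixes f :: "'a::real_inner \<Rightarrow> real"
  assumes der: "(f has_derivative (\<lambda>h. g \<bullet> h)) (at x)" and U: "open U" "x \<in> U"
  shows "smooth_along U f v x"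
  unfolding smooth_along_def
proof
  fix k :: nat
  note lim = difference_quotient_tendsto[OF der]
  have "(\<lambda>n. real (Suc n) * (f (x + inverse (Suc n) *\<^sub>R v) - f x) + real (Suc n) * (f (x + inverse (Suc n) *\<^sub>R (-v)) - f x)) \<longlonglongrightarrow> g \<bullet> v + g \<bullet> (-v)"
    by (intro tendsto_add lim)
  then have "(\<lambda>n. real (Suc n) * (f (x + inverse (Suc n) *\<^sub>R v) + f (x - inverse (Suc n) *\<^sub>R v) - 2 * f x)) \<longlonglongrightarrow> 0"
    by (simp add: algebra_simps)
  then have e1: "\<forall>\<^sub>F n in sequentially. real (Suc n) * (f (x + inverse (Suc n) *\<^sub>R v) + f (x - inverse (Suc n) *\<^sub>R v) - 2 * f x) < inverse (Suc k)"
    by (rule order_tendstoD) simp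
  have xlim: "(\<lambda>n. x + inverse (Suc n) *\<^sub>R w) \<longlonglongrightarrow> x" for w
  proof -
    have "(\<lambda>n. x + inverse (Suc n) *\<^sub>R w) \<longlonglongrightarrow> x + 0 *\<^sub>R w"
      by (intro tendsto_intros LIMSEQ_inverse_real_of_nat)
    then show ?thesis by simp
  qed
  have "\<forall>\<^sub>F n in sequentially. x + inverse (Suc n) *\<^sub>R v \<in> U" "\<forall>\<^sub>F n in sequentially. x - inverse (Suc n) *\<^sub>R v \<in> U"
    using topological_tendstoD[OF xlim[of v] U] topological_tendstoD[OF xlim[of "-v"] U] by simp_all
  with e1 have "\<forall>\<^sub>F n in sequentially. x + inverse (Suc n) *\<^sub>R v \<in> U \<and> x - inverse (Suc n) *\<^sub>R v \<in> U \<and>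
     real (Suc n) * (f (x + inverse (Suc n) *\<^sub>R v) + f (x - inverse (Suc n) *\<^sub>R v) - 2 * f x) < inverse (Suc k)"
    by eventually_elim auto
  then show "\<exists>n::nat. x + inverse (Suc n) *\<^sub>R v \<in> U \<and> x - inverse (Suc n) *\<^sub>R v \<in> U \<and>
     real (Suc n) * (f (x + inverse (Suc n) *\<^sub>R v) + f (x - inverse (Suc n) *\<^sub>R v) - 2 * f x) < inverse (Suc k)"
    by (auto simp: eventually_sequentially)
qed

text \<open>On a line the right derivative \<open>r\<close> is monotone and so has countably many
  discontinuities. Where it is continuous, \<open>r (t + h) - r (t - h)\<close> bounds the second
  difference quotient.\<close>

lemma countable_not_smooth_along_line:
  fixes x v :: "'a::real_normed_vector"
  assumes U: "open U" and conv: "convex_on U f"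
  shows "countable {t. x + t *\<^sub>R v \<in> U \<and> \<not> smooth_along U f v (x + t *\<^sub>R v)}"
proof -
  define F where "F s = f (x + s *\<^sub>R v)" for s
  define J where "J = {s. x + s *\<^sub>R v \<in> U}"
  have cF: "convex_on J F" unfolding F_def J_def by (rule convex_on_line[OF conv])
  have "open J"
    unfolding J_def using open_vimage[OF U, of "\<lambda>s. x + s *\<^sub>R v"]
    by (simp add: vimage_def continuous_intros)
  define r where "r t = Inf ((\<lambda>s. (F s - F t) / (s - t)) ` {s\<in>J. s > t})" for t
  have nbhd: "\<exists>d>0. \<forall>s. \<bar>s - t\<bar> < d \<longrightarrow> s \<in> J" if "t \<in> J" for t
    using \<open>open J\<close> that unfolding open_dist by (auto simp: dist_real_def)
  have bdd: "bdd_below ((\<lambda>s. (F s - F t) / (s - t)) ` {s\<in>J. s > t})" if tJ: "t \<in> J" for t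
  proof -
    obtain d where d: "d > 0" "\<forall>s. \<bar>s - t\<bar> < d \<longrightarrow> s \<in> J" using nbhd[OF tJ] by auto
    have "t - d/2 \<in> J" using d by auto
    then show ?thesis using convex_on_slopes(3)[OF cF, of "t - d/2" _ t] d(1)
      by (intro bdd_belowI2[of _ "(F t - F (t - d/2)) / (t - (t - d/2))"]) auto
  qed
  have r_le: "r t \<le> (F s - F t) / (s - t)" if "t \<in> J" "s \<in> J" "t < s" for s t
    unfolding r_def using that bdd by (intro cInf_lower) auto
  have r_ge: "(F t - F s) / (t - s) \<le> r t" if st: "s \<in> J" "t \<in> J" "s < t" for s t
  proof -
    obtain d where d: "d > 0" "\<forall>s. \<bar>s - t\<bar> < d \<longrightarrow> s \<in> J" using nbhd[OF st(2)] by auto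
    then have "t + d/2 \<in> {s\<in>J. s > t}" by auto
    then show ?thesis unfolding r_def
      using convex_on_slopes(3)[OF cF, of s _ t] st by (intro cInf_greatest) auto
  qed
  have "mono_on J r"
  proof (rule mono_onI)
    fix s t assume "s \<in> J" "t \<in> J" "s \<le> t"
    then show "r s \<le> r t" using r_le[of s t] r_ge[of s t] by (cases "s = t") auto
  qed
  then have "countable {t\<in>J. \<not> isCont r t}" using mono_on_ctble_discont_open[OF \<open>open J\<close>] by blast
  moreover have "smooth_along U f v (x + t *\<^sub>R v)" if t: "t \<in> J" "isCont r t" for t
    unfolding smooth_along_def
  proof
    fix k :: nat
    obtain d where d: "d > 0" "\<forall>s. \<bar>s - t\<bar> < d \<longrightarrow> s \<in> J" using nbhd[OF t(1)] by auto
    obtain e where e: "e > 0" "\<And>s. \<bar>s - t\<bar> < e \<Longrightarrow> \<bar>r s - r t\<bar> < inverse (Suc k) / 2"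
      using t(2) unfolding continuous_at_eps_delta
      by (metis dist_real_def half_gt_zero inverse_positive_iff_positive of_nat_0_less_iff zero_less_Suc)
    obtain n where n: "inverse (Suc n) < min d e" using reals_Archimedean[of "min d e"] d(1) e(1) by auto
    define h :: real where "h = inverse (Suc n)"
    have h: "0 < h" "h < d" "h < e" using n by (auto simp: h_def)
    have J: "t + h \<in> J" "t - h \<in> J" using d h by auto
    have "real (Suc n) * (F (t + h) + F (t - h) - 2 * F t) = (F (t + h) - F t) / (t + h - t) - (F t - F (t - h)) / (t - (t - h))"
      unfolding h_def by (simp add: field_simps)
    also have "\<dots> \<le> r (t + h) - r (t - h)"
      using r_ge[OF t(1) J(1)] r_le[OF J(2) t(1)] h by (intro diff_mono) auto
    also have "\<dots> < inverse (Suc k)"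
    proof -
      have "\<bar>r (t + h) - r t\<bar> < inverse (Suc k) / 2" "\<bar>r (t - h) - r t\<bar> < inverse (Suc k) / 2"
        using e(2)[of "t + h"] e(2)[of "t - h"] h by simp_all
      then show ?thesis by linarith
    qed
    finally show "\<exists>n::nat. x + t *\<^sub>R v + inverse (Suc n) *\<^sub>R v \<in> U \<and> x + t *\<^sub>R v - inverse (Suc n) *\<^sub>R v \<in> U \<and>
      real (Suc n) * (f (x + t *\<^sub>R v + inverse (Suc n) *\<^sub>R v) + f (x + t *\<^sub>R v - inverse (Suc n) *\<^sub>R v) - 2 * f (x + t *\<^sub>R v)) < inverse (Suc k)"
      using J by (intro exI[of _ n]) (simp add: F_def J_def h_def algebra_simps)
  qed
  ultimately show ?thesis by (elim countable_subset[rotated]) (auto simp: J_def)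
qed

text \<open>Integrate the volume of the translates of \<open>N\<close> along \<open>v\<close> over
  all real times. Translation invariance gives infinity times the volume of \<open>N\<close>; Fubini
  gives 0.\<close>

lemma null_set_if_countable_on_lines:
  fixes N :: "'a::euclidean_space set"
  assumes [measurable]: "N \<in> sets borel" and ctb: "\<And>x. countable {t. x + t *\<^sub>R v \<in> N}"
  shows "N \<in> null_sets lborel"
proof -
  have "(\<integral>\<^sup>+t. emeasure lborel N \<partial>(lborel :: real measure)) = (\<integral>\<^sup>+t. (\<integral>\<^sup>+x. indicator N (x + t *\<^sub>R v) \<partial>lborel) \<partial>lborel)"
  proof (intro nn_integral_cong)
    fix t :: real
    have "emeasure lborel N = emeasure (distr lborel borel ((+) (t *\<^sub>R v))) N" by (simp add: lborel_distr_plus)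
    also have "\<dots> = (\<integral>\<^sup>+x. indicator N x \<partial>distr lborel borel ((+) (t *\<^sub>R v)))" by simp
    also have "\<dots> = (\<integral>\<^sup>+x. indicator N (x + t *\<^sub>R v) \<partial>lborel)"
      by (subst nn_integral_distr) (auto simp: add.commute)
    finally show "emeasure lborel N = (\<integral>\<^sup>+x. indicator N (x + t *\<^sub>R v) \<partial>lborel)" .
  qed
  also have "\<dots> = (\<integral>\<^sup>+x. (\<integral>\<^sup>+t. indicator N (x + t *\<^sub>R v) \<partial>lborel) \<partial>lborel)"
    by (rule lborel_pair.Fubini') measurable
  also have "\<dots> = (\<integral>\<^sup>+x. 0 \<partial>(lborel :: 'a measure))"
  proof (intro nn_integral_cong)
    fix x :: 'a
    have "(\<integral>\<^sup>+t. indicator N (x + t *\<^sub>R v) \<partial>lborel) = (\<integral>\<^sup>+t. indicator {t. x + t *\<^sub>R v \<in> N} t \<partial>(lborel :: real measure))"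
      by (intro nn_integral_cong) (auto simp: indicator_def)
    also have "\<dots> = emeasure lborel {t. x + t *\<^sub>R v \<in> N}" by (intro nn_integral_indicator) simp
    also have "\<dots> = 0" using ctb by (rule emeasure_lborel_countable)
    finally show "(\<integral>\<^sup>+t. indicator N (x + t *\<^sub>R v) \<partial>lborel) = 0" .
  qed
  finally have "emeasure lborel N * \<infinity> = 0" by simp
  then show ?thesis by (auto simp: null_sets_def)
qed

lemma ereal_convex_on_interior:
  assumes "ereal_convex (\<phi> :: 'a::real_normed_vector \<Rightarrow> ereal)"
  shows "convex_on (interior {x. \<phi> x \<noteq> \<infinity>}) (\<lambda>x. real_of_ereal (\<phi> x))"
proof -
  have "convex_on {x. \<phi> x \<noteq> \<infinity>} (\<lambda>x. real_of_ereal (\<phi> x))" by (rule ereal_convex_on_domain[OF assms])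
  then show ?thesis
    by (rule convex_on_subset[OF _ interior_subset convex_interior]) (use \<open>convex_on _ _\<close> in \<open>simp add: convex_on_def\<close>)
qed

lemma ediff_at_iff_smooth_along:
  fixes \<phi> :: "'a::euclidean_space \<Rightarrow> ereal"
  assumes "ereal_convex \<phi>"
  defines "U \<equiv> interior {x. \<phi> x \<noteq> \<infinity>}" and "f \<equiv> \<lambda>x. real_of_ereal (\<phi> x)"
  shows "ediff_at \<phi> x \<longleftrightarrow> x \<in> U \<and> (\<forall>i\<in>Basis. smooth_along U f i x)"
proof
  assume "ediff_at \<phi> x"
  then obtain g where g: "has_grad_at \<phi> x g" by (auto simp: ediff_at_def)
  then have "x \<in> U" "(f has_derivative (\<lambda>h. g \<bullet> h)) (at x)"
    using has_grad_at_interior[OF g] by (auto simp: has_grad_at_def U_def f_def)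
  then show "x \<in> U \<and> (\<forall>i\<in>Basis. smooth_along U f i x)"
    using differentiable_imp_smooth_along[of f g x U] by (auto simp: U_def)
next
  assume r: "x \<in> U \<and> (\<forall>i\<in>Basis. smooth_along U f i x)"
  have "convex_on U f"
    unfolding U_def f_def by (rule ereal_convex_on_interior[OF assms(1)])
  then obtain g where g: "(f has_derivative (\<lambda>h. g \<bullet> h)) (at x)"
    using smooth_along_imp_differentiable r by blast
  obtain e where "e > 0" "ball x e \<subseteq> {x. \<phi> x \<noteq> \<infinity>}" using r unfolding U_def mem_interior by blast
  with g show "ediff_at \<phi> x"
    using assms(1) unfolding ediff_at_def has_grad_at_def f_def ereal_convex_def by blast
qed

lemma borel_measurable_pred_smooth_along [measurable]:
  fixes U :: "'a::euclidean_space set"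
  assumes [measurable]: "U \<in> sets borel" "f \<in> borel_measurable borel"
  shows "Measurable.pred borel (smooth_along U f v)"
  unfolding smooth_along_def by measurable

lemma borel_ediff_at:
  fixes \<phi> :: "'a::euclidean_space \<Rightarrow> ereal"
  assumes "ereal_convex \<phi>" and [measurable]: "\<phi> \<in> borel_measurable borel"
  shows "Measurable.pred borel (ediff_at \<phi>)"
proof -
  define U where "U = interior {x. \<phi> x \<noteq> \<infinity>}"
  define f where "f x = real_of_ereal (\<phi> x)" for x
  have [measurable]: "U \<in> sets borel" "f \<in> borel_measurable borel" unfolding U_def f_def by auto
  have "ediff_at \<phi> = (\<lambda>x. x \<in> U \<and> (\<forall>i\<in>Basis. smooth_along U f i x))"
    using ediff_at_iff_smooth_along[OF assms(1)] by (simp add: fun_eq_iff U_def f_def[abs_def])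
  moreover have "Measurable.pred borel (\<lambda>x. \<forall>i\<in>Basis. smooth_along U f i x)"
    by (rule pred_intros_finite(3)) measurable
  ultimately show ?thesis by simp
qed

lemma borel_measurable_egrad:
  fixes \<phi> :: "'a::euclidean_space \<Rightarrow> ereal"
  assumes "ereal_convex \<phi>" and [measurable]: "\<phi> \<in> borel_measurable borel"
  shows "egrad \<phi> \<in> borel_measurable borel"
proof (rule borel_measurable_euclidean_space[THEN iffD2], intro ballI)
  fix i :: 'a assume "i \<in> Basis"
  note [measurable] = borel_ediff_at[OF assms]
  define f where "f x = real_of_ereal (\<phi> x)" for x
  have [measurable]: "f \<in> borel_measurable borel" unfolding f_def by measurable
  \<comment> \<open>The default 0 is that of \<open>egrad\<close>, so that the limit holds at every
    point.\<close>
  define q where "q n x = (if ediff_at \<phi> x then real (Suc n) * (f (x + inverse (Suc n) *\<^sub>R i) - f x) else 0)" for n :: nat and x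
  have lim: "(\<lambda>n. q n x) \<longlonglongrightarrow> egrad \<phi> x \<bullet> i" for x
  proof (cases "ediff_at \<phi> x")
    case True
    then have der: "(f has_derivative (\<lambda>h. egrad \<phi> x \<bullet> h)) (at x)"
      using has_grad_at_egrad[OF True] by (simp add: has_grad_at_def f_def[abs_def])
    show ?thesis using difference_quotient_tendsto[OF der, of i] True by (simp add: q_def)
  qed (simp add: q_def egrad_def)
  have "q n \<in> borel_measurable borel" for n unfolding q_def by measurable
  then show "(\<lambda>x. egrad \<phi> x \<bullet> i) \<in> borel_measurable borel"
    using lim by (rule borel_measurable_LIMSEQ_metric)
qed

text \<open>The frontier of the convex effective domain is null. Inside, differentiability fails
  only where smoothness along some axis fails, and that set is countable on every line parallel to
  the axis.\<close>

lemma AE_ediff_at: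
  fixes \<phi> :: "'a::euclidean_space \<Rightarrow> ereal"
  assumes conv: "ereal_convex \<phi>" and [measurable]: "\<phi> \<in> borel_measurable borel"
  shows "AE x in lborel. \<phi> x \<noteq> \<infinity> \<longrightarrow> ediff_at \<phi> x"
proof -
  let ?D = "{x. \<phi> x \<noteq> \<infinity>}"
  define U where "U = interior ?D"
  define f where "f x = real_of_ereal (\<phi> x)" for x
  have [measurable]: "f \<in> borel_measurable borel" "U \<in> sets borel" unfolding f_def U_def by auto
  have cD: "convex ?D" using ereal_convex_on_domain[OF conv] by (simp add: convex_on_def)
  have cU: "convex_on U f"
    unfolding U_def f_def by (rule ereal_convex_on_interior[OF conv])
  have "frontier ?D \<in> null_sets lborel"
    using negligible_convex_frontier[OF cD]
    by (auto simp: null_sets_completion_iff negligible_iff_null_sets)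
  then have fr: "AE x in lborel. x \<notin> frontier ?D" by (rule AE_not_in)
  have sm: "AE x in lborel. \<forall>i\<in>Basis. x \<in> U \<longrightarrow> smooth_along U f i x"
  proof (intro AE_finite_allI finite_Basis)
    fix i :: 'a
    let ?N = "{x. x \<in> U \<and> \<not> smooth_along U f i x}"
    have "?N \<in> null_sets lborel"
    proof (rule null_set_if_countable_on_lines)
      show "?N \<in> sets borel" by measurable
      show "countable {t. x + t *\<^sub>R i \<in> ?N}" for x
        using countable_not_smooth_along_line[OF _ cU, of x i] by (simp add: U_def)
    qed
    then have "AE x in lborel. x \<notin> ?N" by (rule AE_not_in)
    then show "AE x in lborel. x \<in> U \<longrightarrow> smooth_along U f i x" by eventually_elim auto
  qed
  from fr sm show ?thesis
  proof eventually_elim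
    case (elim x)
    show ?case
    proof
      assume "\<phi> x \<noteq> \<infinity>"
      then have "x \<in> closure ?D" using closure_subset[of ?D] by auto
      then have "x \<in> U" using elim(1) by (auto simp: frontier_def U_def)
      then show "ediff_at \<phi> x"
        using elim(2) ediff_at_iff_smooth_along[OF conv, of x] by (simp add: U_def f_def[abs_def])
    qed
  qed
qed

section \<open>Compact groups of orthogonal matrices\<close>

definition orbit_corr :: "'n::finite rmat set \<Rightarrow> 'n rvec \<Rightarrow> 'n rvec \<Rightarrow> real" where
  "orbit_corr G x h = (SUP Q\<in>G. x \<bullet> (Q *v h))"

text \<open>As a simp rule it would turn \<open>transpose Q *v x\<close> into \<open>x v* Q\<close>
  and hide the action of the group element \<open>transpose Q\<close>.\<close>

declare transpose_matrix_vector [simp del]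

lemma inner_matrix_vector_transpose: "x \<bullet> (Q *v y) = (transpose Q *v x) \<bullet> y"
  for x :: "real^'m" and Q :: "real^'n^'m"
  by (simp add: transpose_matrix_vector dot_lmul_matrix)

lemma continuous_on_matrix_vector_mult [continuous_intros]:
  fixes f :: "'b::topological_space \<Rightarrow> real^'n^'m"
  assumes "continuous_on S f" "continuous_on S g"
  shows "continuous_on S (\<lambda>z. f z *v g z)"
  unfolding matrix_vector_mult_def using assms by (intro continuous_intros)

lemma continuous_on_matrix_matrix_mult [continuous_intros]:
  fixes f :: "'b::topological_space \<Rightarrow> real^'n^'m" and g :: "'b \<Rightarrow> real^'k^'n"
  assumes "continuous_on S f" "continuous_on S g"
  shows "continuous_on S (\<lambda>z. f z ** g z)"
  unfolding matrix_matrix_mult_def using assms by (intro continuous_intros)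

lemma continuous_on_transpose [continuous_intros]:
  fixes f :: "'b::topological_space \<Rightarrow> real^'n^'m"
  assumes "continuous_on S f"
  shows "continuous_on S (\<lambda>z. transpose (f z))"
  unfolding transpose_def using assms by (intro continuous_intros)

lemma borel_measurable_matrix_vector_mult [measurable (raw)]:
  fixes f :: "'b \<Rightarrow> real^'n^'m"
  assumes [measurable]: "f \<in> borel_measurable M" "g \<in> borel_measurable M"
  shows "(\<lambda>z. f z *v g z) \<in> borel_measurable M"
proof -
  have "(\<lambda>z. fst z *v snd z) \<in> borel_measurable (borel :: ((real^'n^'m) \<times> (real^'n)) measure)"
    by (intro borel_measurable_continuous_onI continuous_intros)
  moreover have "(\<lambda>z. (f z, g z)) \<in> borel_measurable M" by measurable
  ultimately have "(\<lambda>z. fst z *v snd z) \<circ> (\<lambda>z. (f z, g z)) \<in> borel_measurable M"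
    by (rule measurable_comp[rotated])
  then show ?thesis by (simp add: o_def)
qed

lemma borel_measurable_matrix_matrix_mult [measurable (raw)]:
  fixes f :: "'b \<Rightarrow> real^'n^'m" and g :: "'b \<Rightarrow> real^'k^'n"
  assumes [measurable]: "f \<in> borel_measurable M" "g \<in> borel_measurable M"
  shows "(\<lambda>z. f z ** g z) \<in> borel_measurable M"
proof -
  have "(\<lambda>z. fst z ** snd z) \<in> borel_measurable (borel :: ((real^'n^'m) \<times> (real^'k^'n)) measure)"
    by (intro borel_measurable_continuous_onI continuous_intros)
  moreover have "(\<lambda>z. (f z, g z)) \<in> borel_measurable M" by measurable
  ultimately have "(\<lambda>z. fst z ** snd z) \<circ> (\<lambda>z. (f z, g z)) \<in> borel_measurable M"
    by (rule measurable_comp[rotated])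
  then show ?thesis by (simp add: o_def)
qed

lemma borel_measurable_transpose [measurable (raw)]:
  fixes f :: "'b \<Rightarrow> real^'n^'m"
  assumes "f \<in> borel_measurable M"
  shows "(\<lambda>z. transpose (f z)) \<in> borel_measurable M"
proof -
  have "(transpose :: real^'n^'m \<Rightarrow> _) \<in> borel_measurable borel"
    using continuous_on_transpose[OF continuous_on_id, of UNIV]
    by (intro borel_measurable_continuous_onI) (simp add: id_def)
  then show ?thesis using assms by (rule measurable_compose[rotated])
qed

locale orth_group =
  fixes G :: "'n::finite rmat set"
  assumes compact_orth_subgroup: "compact_orth_subgroup G"
begin

abbreviation m :: "'n rvec \<Rightarrow> 'n rvec \<Rightarrow> real" where "m \<equiv> orbit_corr G"

lemma orthogonal: "Q \<in> G \<Longrightarrow> orthogonal_matrix Q"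
  and one: "mat 1 \<in> G"
  and mult: "Q \<in> G \<Longrightarrow> P \<in> G \<Longrightarrow> Q ** P \<in> G"
  and transp: "Q \<in> G \<Longrightarrow> transpose Q \<in> G"
  and compact: "compact G"
  using compact_orth_subgroup by (auto simp: compact_orth_subgroup_def)

lemma nonempty: "G \<noteq> {}" using one by auto

lemma transpose_mult_self: "Q \<in> G \<Longrightarrow> transpose Q ** Q = mat 1" "Q \<in> G \<Longrightarrow> Q ** transpose Q = mat 1"
  using orthogonal by (auto simp: orthogonal_matrix_def)

lemma transpose_act [simp]: "Q \<in> G \<Longrightarrow> transpose Q *v (Q *v x) = x" "Q \<in> G \<Longrightarrow> Q *v (transpose Q *v x) = x"
  by (simp_all add: matrix_vector_mul_assoc transpose_mult_self)

lemma inner_act: "Q \<in> G \<Longrightarrow> (Q *v x) \<bullet> (Q *v y) = x \<bullet> y"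
  by (simp add: inner_matrix_vector_transpose)

lemma norm_act: "Q \<in> G \<Longrightarrow> norm (Q *v x) = norm x"
  by (simp add: norm_eq_sqrt_inner inner_act)

lemma bdd_above_corr: "bdd_above ((\<lambda>Q. x \<bullet> (Q *v h)) ` G)"
proof (rule bdd_aboveI2)
  fix Q assume "Q \<in> G"
  then show "x \<bullet> (Q *v h) \<le> norm x * norm h"
    using norm_cauchy_schwarz[of x "Q *v h"] by (simp add: norm_act)
qed

lemma corr_ge: "Q \<in> G \<Longrightarrow> x \<bullet> (Q *v h) \<le> m x h"
  unfolding orbit_corr_def by (rule cSUP_upper[OF _ bdd_above_corr])

lemma corr_attained:
  obtains Q where "Q \<in> G" "m x h = x \<bullet> (Q *v h)"
proof -
  have "continuous_on G (\<lambda>Q. x \<bullet> (Q *v h))" by (intro continuous_intros)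
  then obtain Q where Q: "Q \<in> G" "\<And>P. P \<in> G \<Longrightarrow> x \<bullet> (P *v h) \<le> x \<bullet> (Q *v h)"
    using continuous_attains_sup[OF compact nonempty] by metis
  then have "m x h \<le> x \<bullet> (Q *v h)" unfolding orbit_corr_def by (intro cSUP_least nonempty)
  then show ?thesis using Q(1) corr_ge[OF Q(1), of x h] that by fastforce
qed

lemma norm_diff_act:
  assumes "Q \<in> G"
  shows "(norm (transpose Q *v x - h))\<^sup>2 = (norm x)\<^sup>2 + (norm h)\<^sup>2 - 2 * (x \<bullet> (Q *v h))"
proof -
  have "(transpose Q *v x) \<bullet> (transpose Q *v x) = x \<bullet> x"
    using inner_act[OF transp[OF assms]] .
  then show ?thesis
    unfolding inner_matrix_vector_transpose[of x Q h]
    by (simp add: power2_norm_eq_inner inner_diff_left inner_diff_right inner_commute)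
qed

lemma orbit_cost_eq: "orbit_cost G x h = (norm x)\<^sup>2 + (norm h)\<^sup>2 - 2 * m x h"
proof (rule antisym)
  obtain Q where Q: "Q \<in> G" "m x h = x \<bullet> (Q *v h)" by (rule corr_attained)
  have bdd: "bdd_below ((\<lambda>Q. (norm (transpose Q *v x - h))\<^sup>2) ` G)" by (rule bdd_belowI2[of _ 0]) simp
  show "orbit_cost G x h \<le> (norm x)\<^sup>2 + (norm h)\<^sup>2 - 2 * m x h"
    unfolding orbit_cost_def Q(2) using cINF_lower[OF bdd Q(1)] norm_diff_act[OF Q(1)] by simp
  show "(norm x)\<^sup>2 + (norm h)\<^sup>2 - 2 * m x h \<le> orbit_cost G x h"
    unfolding orbit_cost_def using corr_ge by (intro cINF_greatest nonempty) (simp add: norm_diff_act)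
qed

text \<open>One inequality for all group elements is enough: applied to the inverse it gives the
  converse.\<close>

lemma corr_act_left: assumes "P \<in> G" shows "m (P *v x) h = m x h"
proof -
  have le: "m (P *v x) h \<le> m x h" if "P \<in> G" for P x
  proof -
    obtain Q where Q: "Q \<in> G" "m (P *v x) h = (P *v x) \<bullet> (Q *v h)" by (rule corr_attained)
    have "(P *v x) \<bullet> (Q *v h) = x \<bullet> ((transpose P ** Q) *v h)"
      using inner_matrix_vector_transpose[of x "transpose P"] by (simp flip: matrix_vector_mul_assoc)
    then show ?thesis using corr_ge[OF mult[OF transp[OF that] Q(1)], of x h] Q by simp
  qed
  show ?thesis using le[OF assms, of x] le[OF transp[OF assms], of "P *v x"] assms by simp
qed

lemma corr_act_right: assumes "P \<in> G" shows "m x (P *v h) = m x h"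
proof -
  have le: "m x (P *v h) \<le> m x h" if "P \<in> G" for P h
  proof -
    obtain Q where Q: "Q \<in> G" "m x (P *v h) = x \<bullet> (Q *v (P *v h))" by (rule corr_attained)
    then show ?thesis using corr_ge[OF mult[OF Q(1) that], of x h] by (simp add: matrix_vector_mul_assoc)
  qed
  show ?thesis using le[OF assms, of h] le[OF transp[OF assms], of "P *v h"] assms by simp
qed

text \<open>The maximiser for \<open>(x, h)\<close> is a competitor for \<open>(x', h')\<close>. The
  estimate serves to show that \<open>m\<close> is jointly continuous.\<close>

lemma corr_diff_le: "m x h - m x' h' \<le> norm (x - x') * norm h + norm x' * norm (h - h')"
proof -
  obtain Q where Q: "Q \<in> G" "m x h = x \<bullet> (Q *v h)" by (rule corr_attained)
  have "m x h - m x' h' \<le> x \<bullet> (Q *v h) - x' \<bullet> (Q *v h')" using corr_ge[OF Q(1), of x' h'] Q(2) by simp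
  also have "\<dots> = (x - x') \<bullet> (Q *v h) + x' \<bullet> (Q *v (h - h'))"
    by (simp add: inner_diff_left inner_diff_right matrix_vector_mult_diff_distrib)
  also have "\<dots> \<le> norm (x - x') * norm (Q *v h) + norm x' * norm (Q *v (h - h'))"
    by (intro add_mono norm_cauchy_schwarz)
  finally show ?thesis using Q(1) by (simp add: norm_act)
qed

lemma continuous_on_corr: "continuous_on UNIV (\<lambda>z. m (fst z) (snd z))"
  unfolding continuous_on_def
proof
  fix z0 :: "'n rvec \<times> 'n rvec"
  let ?b = "\<lambda>z. norm (fst z - fst z0) * (norm (snd z) + norm (snd z0)) + (norm (fst z) + norm (fst z0)) * norm (snd z - snd z0)"
  have "(?b \<longlongrightarrow> norm (fst z0 - fst z0) * (norm (snd z0) + norm (snd z0)) + (norm (fst z0) + norm (fst z0)) * norm (snd z0 - snd z0)) (at z0)"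
    by (intro tendsto_intros)
  then have b: "(?b \<longlongrightarrow> 0) (at z0)" by simp
  have le: "norm (m (fst z) (snd z) - m (fst z0) (snd z0)) \<le> ?b z" for z
    using corr_diff_le[of "fst z" "snd z" "fst z0" "snd z0"] corr_diff_le[of "fst z0" "snd z0" "fst z" "snd z"]
      mult_nonneg_nonneg[OF norm_ge_zero norm_ge_zero, of "fst z - fst z0" "snd z0"] mult_nonneg_nonneg[OF norm_ge_zero norm_ge_zero, of "fst z - fst z0" "snd z"]
      mult_nonneg_nonneg[OF norm_ge_zero norm_ge_zero, of "fst z0" "snd z - snd z0"] mult_nonneg_nonneg[OF norm_ge_zero norm_ge_zero, of "fst z" "snd z - snd z0"]
    unfolding real_norm_def abs_le_iff distrib_left distrib_right
      norm_minus_commute[of "fst z0" "fst z"] norm_minus_commute[of "snd z0" "snd z"]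
    by linarith
  have "((\<lambda>z. m (fst z) (snd z) - m (fst z0) (snd z0)) \<longlongrightarrow> 0) (at z0)"
    by (rule Lim_null_comparison[OF always_eventually[OF allI[OF le]] b])
  then show "((\<lambda>z. m (fst z) (snd z)) \<longlongrightarrow> m (fst z0) (snd z0)) (at z0 within UNIV)"
    by (simp add: LIM_zero_iff)
qed

lemma continuous_on_corr_left: "continuous_on UNIV (\<lambda>x. m x h)"
  using continuous_on_compose2[OF continuous_on_corr, of UNIV "\<lambda>x. (x, h)"] by (simp add: continuous_intros)

lemma continuous_on_corr_right: "continuous_on UNIV (m x)"
  using continuous_on_compose2[OF continuous_on_corr, of UNIV "\<lambda>h. (x, h)"] by (simp add: continuous_intros)

lemma convex_corr:
  assumes "0 \<le> t" "t \<le> 1"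
  shows "m ((1 - t) *\<^sub>R x + t *\<^sub>R y) h \<le> (1 - t) * m x h + t * m y h"
proof -
  obtain Q where Q: "Q \<in> G" "m ((1 - t) *\<^sub>R x + t *\<^sub>R y) h = ((1 - t) *\<^sub>R x + t *\<^sub>R y) \<bullet> (Q *v h)" by (rule corr_attained)
  show ?thesis
    unfolding Q(2) inner_add_left inner_scaleR_left
    using assms corr_ge[OF Q(1)] by (intro add_mono mult_left_mono) auto
qed

lemma cyclically_monotone_cost_iff:
  "cyclically_monotone (orbit_cost G) \<Gamma> \<longleftrightarrow> cyclically_monotone (\<lambda>x h. - m x h) \<Gamma>"
  by (rule cyclically_monotone_affine[of _ "\<lambda>x. (norm x)\<^sup>2" "\<lambda>h. (norm h)\<^sup>2" 2]) (auto simp: orbit_cost_eq)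

lemma continuous_on_cost: "continuous_on UNIV (\<lambda>z. orbit_cost G (fst z) (snd z))"
  unfolding orbit_cost_eq by (intro continuous_intros continuous_on_corr)

lemma contact_imp_gradient:
  assumes "contact m {x. \<psi> x \<noteq> \<infinity>} (\<lambda>x. real_of_ereal (\<psi> x)) x h" "ediff_at \<psi> x"
    and Q: "Q \<in> G" "m x h = x \<bullet> (Q *v h)"
  shows "Q *v h = egrad \<psi> x"
proof (rule subgradient_eq_gradient[OF has_grad_at_egrad[OF assms(2)]])
  fix z assume "\<psi> z \<noteq> \<infinity>"
  then have "real_of_ereal (\<psi> x) + m z h - m x h \<le> real_of_ereal (\<psi> z)"
    using assms(1) by (auto simp: contact_def)
  then show "real_of_ereal (\<psi> x) + (Q *v h) \<bullet> (z - x) \<le> real_of_ereal (\<psi> z)"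
    using corr_ge[OF Q(1), of z h] Q(2) by (simp add: inner_diff_right inner_commute)
qed

text \<open>\<open>\<psi>\<close> agrees with its composition with the linear isometry
  \<open>transpose Q\<close>, so the chain rule applies.\<close>

lemma has_grad_at_act:
  assumes inv: "\<And>Q x. Q \<in> G \<Longrightarrow> \<psi> (Q *v x) = \<psi> x" and Q: "Q \<in> G" and g: "has_grad_at \<psi> x g"
  shows "has_grad_at \<psi> (Q *v x) (Q *v g)"
proof -
  have eq: "\<psi> y = \<psi> (transpose Q *v y)" for y using inv[OF transp[OF Q]] by simp
  obtain e where e: "e > 0" "\<forall>y\<in>ball x e. \<psi> y \<noteq> \<infinity> \<and> \<psi> y \<noteq> -\<infinity>"
    and der: "((\<lambda>y. real_of_ereal (\<psi> y)) has_derivative (\<lambda>h. g \<bullet> h)) (at x)"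
    using g unfolding has_grad_at_def by blast
  have "\<psi> y \<noteq> \<infinity> \<and> \<psi> y \<noteq> -\<infinity>" if "y \<in> ball (Q *v x) e" for y
  proof -
    have "norm (Q *v x - y) = norm (transpose Q *v (Q *v x - y))" by (simp add: norm_act transp Q)
    also have "\<dots> = norm (x - transpose Q *v y)" using Q by (simp add: matrix_vector_mult_diff_distrib)
    finally have "transpose Q *v y \<in> ball x e" using that by (simp add: dist_norm)
    then show ?thesis using e(2) by (subst (1 2) eq) blast
  qed
  moreover have "((\<lambda>y. real_of_ereal (\<psi> (transpose Q *v y))) has_derivative (\<lambda>h. g \<bullet> (transpose Q *v h))) (at (Q *v x))"
  proof (rule has_derivative_compose[of "\<lambda>y. transpose Q *v y" "\<lambda>y. transpose Q *v y" _ UNIV])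
    show "((*v) (transpose Q) has_derivative (*v) (transpose Q)) (at (Q *v x))"
      by (intro bounded_linear_imp_has_derivative matrix_vector_mul_bounded_linear)
  qed (use der Q in simp)
  then have "((\<lambda>y. real_of_ereal (\<psi> y)) has_derivative (\<lambda>h. (Q *v g) \<bullet> h)) (at (Q *v x))"
    by (simp add: inner_matrix_vector_transpose transpose_transpose flip: eq)
  ultimately show ?thesis using e(1) unfolding has_grad_at_def by blast
qed

lemma ediff_at_act_iff:
  assumes inv: "\<And>Q x. Q \<in> G \<Longrightarrow> \<psi> (Q *v x) = \<psi> x" and Q: "Q \<in> G"
  shows "ediff_at \<psi> (Q *v x) \<longleftrightarrow> ediff_at \<psi> x"
  using has_grad_at_act[of \<psi>, OF inv Q, of x] has_grad_at_act[of \<psi>, OF inv transp[OF Q], of "Q *v x"] Q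
  unfolding ediff_at_def by auto

lemma egrad_act:
  assumes inv: "\<And>Q x. Q \<in> G \<Longrightarrow> \<psi> (Q *v x) = \<psi> x" and Q: "Q \<in> G" and "ediff_at \<psi> x"
  shows "egrad \<psi> (Q *v x) = Q *v egrad \<psi> x"
  by (rule egrad_eqI[OF has_grad_at_act[OF inv Q has_grad_at_egrad[OF assms(3)]]])

end

text \<open>As a function of \<open>x\<close>, every chain is \<open>m x h\<close> plus a constant.
  The potential therefore inherits from \<open>m\<close> what survives suprema: convexity, lower
  semicontinuity, invariance.\<close>

lemma chain_value_eq_shift: "\<exists>h a. \<forall>x. chain_value m x0 h0 x zs = m x h + a"
proof (cases zs)
  case Nil
  then show ?thesis by (auto intro!: exI[of _ h0] exI[of _ "- m x0 h0"])
next
  case (Cons z zs')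
  then show ?thesis
    by (intro exI[of _ "snd z"] exI[of _ "- m (fst z) (snd z) + chain_value m x0 h0 (fst z) zs'"]) simp
qed

lemma ereal_convex_SUP:
  fixes k :: "'i \<Rightarrow> 'a::real_vector \<Rightarrow> real"
  assumes "I \<noteq> {}" and k: "\<And>i x y t. i \<in> I \<Longrightarrow> 0 \<le> t \<Longrightarrow> t \<le> 1 \<Longrightarrow> k i ((1 - t) *\<^sub>R x + t *\<^sub>R y) \<le> (1 - t) * k i x + t * k i y"
  shows "ereal_convex (\<lambda>x. SUP i\<in>I. ereal (k i x))"
  unfolding ereal_convex_def
proof (intro conjI allI impI)
  fix x
  obtain i where "i \<in> I" using assms(1) by blast
  then have "ereal (k i x) \<le> (SUP i\<in>I. ereal (k i x))" by (rule SUP_upper)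
  then show "(SUP i\<in>I. ereal (k i x)) \<noteq> -\<infinity>" by auto
next
  fix x y and t :: real assume t: "0 \<le> t \<and> t \<le> 1"
  show "(SUP i\<in>I. ereal (k i ((1 - t) *\<^sub>R x + t *\<^sub>R y))) \<le> ereal (1 - t) * (SUP i\<in>I. ereal (k i x)) + ereal t * (SUP i\<in>I. ereal (k i y))"
  proof (rule SUP_least)
    fix i assume i: "i \<in> I"
    have "ereal (k i ((1 - t) *\<^sub>R x + t *\<^sub>R y)) \<le> ereal (1 - t) * ereal (k i x) + ereal t * ereal (k i y)"
      using k[OF i] t by simp
    also have "\<dots> \<le> ereal (1 - t) * (SUP i\<in>I. ereal (k i x)) + ereal t * (SUP i\<in>I. ereal (k i y))"
      using t i by (intro add_mono ereal_mult_left_mono SUP_upper) auto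
    finally show "ereal (k i ((1 - t) *\<^sub>R x + t *\<^sub>R y)) \<le> ereal (1 - t) * (SUP i\<in>I. ereal (k i x)) + ereal t * (SUP i\<in>I. ereal (k i y))" .
  qed
qed

lemma ereal_lsc_SUP:
  fixes k :: "'i \<Rightarrow> 'a::perfect_space \<Rightarrow> real"
  assumes "\<And>i. i \<in> I \<Longrightarrow> continuous_on UNIV (k i)"
  shows "ereal_lsc (\<lambda>x. SUP i\<in>I. ereal (k i x))"
  unfolding ereal_lsc_def
proof (intro allI SUP_least)
  fix x i assume i: "i \<in> I"
  have "(k i \<longlongrightarrow> k i x) (at x)" using assms[OF i] by (simp add: continuous_on_def)
  then have "Liminf (at x) (\<lambda>y. ereal (k i y)) = ereal (k i x)"
    by (intro lim_imp_Liminf) auto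
  moreover have "Liminf (at x) (\<lambda>y. ereal (k i y)) \<le> Liminf (at x) (\<lambda>y. SUP i\<in>I. ereal (k i y))"
    using i by (intro Liminf_mono always_eventually allI SUP_upper)
  ultimately show "ereal (k i x) \<le> Liminf (at x) (\<lambda>y. SUP i\<in>I. ereal (k i y))" by simp
qed

context orth_group
begin

lemma chain_potential_properties:
  fixes \<Gamma> z0
  defines "\<psi> \<equiv> chain_potential m \<Gamma> z0"
  shows "ereal_convex \<psi>" "ereal_lsc \<psi>" "\<psi> \<in> borel_measurable borel"
    "\<And>Q x. Q \<in> G \<Longrightarrow> \<psi> (Q *v x) = \<psi> x"
proof -
  obtain hh a where k: "\<And>zs x. chain_value m (fst z0) (snd z0) x zs = m x (hh zs) + a zs"
    using chain_value_eq_shift[of m "fst z0" "snd z0"] by metis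
  have eq: "\<psi> = (\<lambda>x. SUP zs\<in>lists \<Gamma>. ereal (m x (hh zs) + a zs))"
    unfolding \<psi>_def chain_potential_def[abs_def] k ..
  have cont: "continuous_on UNIV (\<lambda>x. m x (hh zs) + a zs)" for zs
    by (intro continuous_intros continuous_on_corr_left)
  show "ereal_convex \<psi>" unfolding eq
  proof (rule ereal_convex_SUP)
    fix zs x y and t :: real assume t: "0 \<le> t" "t \<le> 1"
    have "m ((1 - t) *\<^sub>R x + t *\<^sub>R y) (hh zs) \<le> (1 - t) * m x (hh zs) + t * m y (hh zs)" by (rule convex_corr[OF t])
    then show "m ((1 - t) *\<^sub>R x + t *\<^sub>R y) (hh zs) + a zs \<le> (1 - t) * (m x (hh zs) + a zs) + t * (m y (hh zs) + a zs)"
      by (simp add: algebra_simps)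
  qed auto
  show "ereal_lsc \<psi>" unfolding eq by (rule ereal_lsc_SUP[OF cont])
  show "\<psi> \<in> borel_measurable borel" unfolding eq by (rule borel_measurable_SUP_continuous[OF cont])
  show "\<psi> (Q *v x) = \<psi> x" if "Q \<in> G" for Q x unfolding eq by (simp add: corr_act_left[OF that])
qed

end

section \<open>Averaging with respect to Haar measure\<close>

locale haar_group = orth_group G for G :: "'n::finite rmat set" +
  fixes H :: "'n rmat measure"
  assumes haar_uniform: "haar_uniform G H"

sublocale haar_group \<subseteq> H: prob_space H
  using haar_uniform by (simp add: haar_uniform_def)

context haar_group
begin

lemma sets_H [measurable_cong]: "sets H = sets borel"
  using haar_uniform by (simp add: haar_uniform_def)

lemma AE_mem: "AE Q in H. Q \<in> G"
proof -
  have "G \<in> sets H" using compact by (simp add: sets_H compact_imp_closed)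
  then show ?thesis
    using haar_uniform H.emeasure_eq_1_AE[of G] by (simp add: haar_uniform_def H.AE_in_set_eq_1 H.emeasure_eq_measure)
qed

lemma nn_integral_left_mult:
  assumes "P \<in> G" and [measurable]: "f \<in> borel_measurable borel"
  shows "(\<integral>\<^sup>+Q. f (P ** Q) \<partial>H) = (\<integral>\<^sup>+Q. f Q \<partial>H)"
proof -
  have "(\<integral>\<^sup>+Q. f Q \<partial>H) = (\<integral>\<^sup>+Q. f Q \<partial>distr H borel (\<lambda>M. P ** M))"
    using haar_uniform assms(1) by (simp add: haar_uniform_def)
  also have "\<dots> = (\<integral>\<^sup>+Q. f (P ** Q) \<partial>H)" by (rule nn_integral_distr) measurable
  finally show ?thesis by simp
qed

text \<open>Transposition is inversion on \<open>G\<close>. Integrate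
  \<open>f (transpose R ** Q)\<close> over both variables: left invariance in \<open>Q\<close> gives
  the right side, and since the argument is the transpose of \<open>transpose Q ** R\<close>, left
  invariance in \<open>R\<close> gives the left side.\<close>

lemma nn_integral_transpose:
  assumes [measurable]: "f \<in> borel_measurable borel"
  shows "(\<integral>\<^sup>+Q. f (transpose Q) \<partial>H) = (\<integral>\<^sup>+Q. f Q \<partial>H)"
proof -
  interpret pair_sigma_finite H H ..
  have "(\<integral>\<^sup>+Q. f Q \<partial>H) = (\<integral>\<^sup>+R. (\<integral>\<^sup>+Q. f Q \<partial>H) \<partial>H)" by (simp add: H.emeasure_space_1)
  also have "\<dots> = (\<integral>\<^sup>+R. (\<integral>\<^sup>+Q. f (transpose R ** Q) \<partial>H) \<partial>H)"
    using AE_mem by (intro nn_integral_cong_AE) (auto elim!: eventually_mono simp: nn_integral_left_mult transp)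
  also have "\<dots> = (\<integral>\<^sup>+Q. (\<integral>\<^sup>+R. f (transpose R ** Q) \<partial>H) \<partial>H)"
    by (rule Fubini') measurable
  also have "\<dots> = (\<integral>\<^sup>+Q. (\<integral>\<^sup>+R. f (transpose R) \<partial>H) \<partial>H)"
  proof (rule nn_integral_cong_AE)
    show "AE Q in H. (\<integral>\<^sup>+R. f (transpose R ** Q) \<partial>H) = (\<integral>\<^sup>+R. f (transpose R) \<partial>H)"
      using AE_mem
    proof eventually_elim
      case (elim Q)
      have "(\<integral>\<^sup>+R. f (transpose R ** Q) \<partial>H) = (\<integral>\<^sup>+R. f (transpose (transpose Q ** R)) \<partial>H)"
        by (simp add: matrix_transpose_mul)
      also have "\<dots> = (\<integral>\<^sup>+R. f (transpose R) \<partial>H)"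
        by (rule nn_integral_left_mult[OF transp[OF elim], of "\<lambda>R. f (transpose R)"]) measurable
      finally show ?case .
    qed
  qed
  finally show ?thesis by (simp add: H.emeasure_space_1)
qed

text \<open>\<open>haar_uniform\<close> postulates left invariance only; inversion exchanges left
  and right.\<close>

lemma nn_integral_right_mult:
  assumes "P \<in> G" and [measurable]: "f \<in> borel_measurable borel"
  shows "(\<integral>\<^sup>+Q. f (Q ** P) \<partial>H) = (\<integral>\<^sup>+Q. f Q \<partial>H)"
proof -
  have "(\<integral>\<^sup>+Q. f (Q ** P) \<partial>H) = (\<integral>\<^sup>+Q. f (transpose Q ** P) \<partial>H)"
    by (rule nn_integral_transpose[of "\<lambda>Q. f (Q ** P)", symmetric]) measurable
  also have "\<dots> = (\<integral>\<^sup>+Q. f (transpose (transpose P ** Q)) \<partial>H)"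
    by (simp add: matrix_transpose_mul)
  also have "\<dots> = (\<integral>\<^sup>+Q. f (transpose Q) \<partial>H)"
    by (rule nn_integral_left_mult[OF transp[OF assms(1)], of "\<lambda>R. f (transpose R)"]) measurable
  finally show ?thesis by (simp add: nn_integral_transpose)
qed

lemma sets_sym_law [simp, measurable_cong]: "sets (sym_law H M) = sets borel"
  by (simp add: sym_law_def)

lemma nn_integral_sym_law:
  assumes "prob_space M" and M [measurable_cong]: "sets M = sets borel"
    and [measurable]: "f \<in> borel_measurable borel"
  shows "(\<integral>\<^sup>+y. f y \<partial>sym_law H M) = (\<integral>\<^sup>+x. (\<integral>\<^sup>+Q. f (Q *v x) \<partial>H) \<partial>M)"
proof -
  interpret M: prob_space M by fact
  interpret pair_sigma_finite H M ..
  have "(\<integral>\<^sup>+y. f y \<partial>sym_law H M) = (\<integral>\<^sup>+z. f (case z of (Q, x) \<Rightarrow> Q *v x) \<partial>(H \<Otimes>\<^sub>M M))"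
    unfolding sym_law_def by (rule nn_integral_distr) measurable
  also have "\<dots> = (\<integral>\<^sup>+z. (case z of (Q, x) \<Rightarrow> f (Q *v x)) \<partial>(H \<Otimes>\<^sub>M M))"
    by (intro nn_integral_cong) (auto split: prod.split)
  also have "\<dots> = (\<integral>\<^sup>+x. (\<integral>\<^sup>+Q. f (Q *v x) \<partial>H) \<partial>M)"
    using nn_integral_snd[of "\<lambda>(Q, x). f (Q *v x)"] by simp
  finally show ?thesis .
qed

lemma prob_space_sym_law:
  assumes "prob_space M" "sets M = sets borel" shows "prob_space (sym_law H M)"
proof
  interpret M: prob_space M by fact
  have "emeasure (sym_law H M) (space (sym_law H M)) = (\<integral>\<^sup>+y. 1 \<partial>sym_law H M)" by simp
  also have "\<dots> = 1" using nn_integral_sym_law[OF assms, of "\<lambda>_. 1"] by (simp add: H.emeasure_space_1 M.emeasure_space_1)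
  finally show "emeasure (sym_law H M) (space (sym_law H M)) = 1" .
qed

text \<open>For an invariant predicate the inner integral over the group is that of a constant. This
  carries almost sure differentiability from \<mu> to the averaged law.\<close>

lemma AE_sym_law_iff:
  assumes M: "prob_space M" "sets M = sets borel" and P [measurable]: "Measurable.pred borel P"
    and inv: "\<And>Q x. Q \<in> G \<Longrightarrow> P (Q *v x) \<longleftrightarrow> P x"
  shows "(AE x in sym_law H M. P x) \<longleftrightarrow> (AE x in M. P x)"
proof -
  note [measurable_cong] = M(2)
  have "(\<integral>\<^sup>+Q. indicator {x. \<not> P x} (Q *v x) \<partial>H) = (indicator {x. \<not> P x} x :: ennreal)" for x
  proof -
    have "(\<integral>\<^sup>+Q. indicator {x. \<not> P x} (Q *v x) \<partial>H) = (\<integral>\<^sup>+Q. indicator {x. \<not> P x} x \<partial>H)"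
      using AE_mem by (intro nn_integral_cong_AE) (auto elim!: eventually_mono simp: inv indicator_def)
    then show ?thesis by (simp add: H.emeasure_space_1)
  qed
  then have eq: "(\<integral>\<^sup>+x. indicator {x. \<not> P x} x \<partial>sym_law H M) = (\<integral>\<^sup>+x. indicator {x. \<not> P x} x \<partial>M)"
    by (subst nn_integral_sym_law[OF M]) auto
  have "(AE x in N. P x) \<longleftrightarrow> (\<integral>\<^sup>+x. indicator {x. \<not> P x} x \<partial>N) = 0" if [measurable_cong]: "sets N = sets borel" for N
    by (subst nn_integral_0_iff_AE) (auto simp: indicator_def)
  from this[OF sets_sym_law] this[OF M(2)] eq show ?thesis by simp
qed

text \<open>\<open>T (Q x) = (Q P) (R x)\<close>, and \<open>Q P\<close> has the same law as
  \<open>Q\<close>. The element \<open>P\<close> depends on \<open>x\<close> but is used only in the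
  inner integral, with \<open>x\<close> fixed, so no measurable selection enters.\<close>

lemma distr_sym_law_equivariant:
  assumes M: "prob_space M" "sets M = sets borel"
    and [measurable]: "T \<in> borel_measurable borel" "R \<in> borel_measurable borel"
    and T: "AE x in M. (\<forall>Q\<in>G. T (Q *v x) = Q *v T x) \<and> (\<exists>P\<in>G. T x = P *v R x)"
  shows "distr (sym_law H M) borel T = sym_law H (distr M borel R)"
proof (rule measure_eqI)
  note [measurable_cong] = M(2)
  interpret M: prob_space M by fact
  fix A assume "A \<in> sets (distr (sym_law H M) borel T)"
  then have [measurable]: "A \<in> sets borel" by simp
  have "emeasure (distr (sym_law H M) borel T) A = (\<integral>\<^sup>+y. indicator A y \<partial>distr (sym_law H M) borel T)" by simp
  also have "\<dots> = (\<integral>\<^sup>+y. indicator A (T y) \<partial>sym_law H M)" by (rule nn_integral_distr) auto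
  also have "\<dots> = (\<integral>\<^sup>+x. (\<integral>\<^sup>+Q. indicator A (T (Q *v x)) \<partial>H) \<partial>M)"
    by (rule nn_integral_sym_law[OF M]) measurable
  also have "\<dots> = (\<integral>\<^sup>+x. (\<integral>\<^sup>+Q. indicator A (Q *v R x) \<partial>H) \<partial>M)"
  proof (rule nn_integral_cong_AE)
    show "AE x in M. (\<integral>\<^sup>+Q. indicator A (T (Q *v x)) \<partial>H) = (\<integral>\<^sup>+Q. indicator A (Q *v R x) \<partial>H)"
      using T
    proof eventually_elim
      case (elim x)
      then obtain P where P: "P \<in> G" "T x = P *v R x" by blast
      have "(\<integral>\<^sup>+Q. indicator A (T (Q *v x)) \<partial>H) = (\<integral>\<^sup>+Q. indicator A ((Q ** P) *v R x) \<partial>H)"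
        using AE_mem elim P by (intro nn_integral_cong_AE) (auto elim!: eventually_mono simp: matrix_vector_mul_assoc)
      also have "\<dots> = (\<integral>\<^sup>+Q. indicator A (Q *v R x) \<partial>H)"
        by (rule nn_integral_right_mult[OF P(1), of "\<lambda>Q. indicator A (Q *v R x)"]) measurable
      finally show ?case .
    qed
  qed
  also have "\<dots> = (\<integral>\<^sup>+h. (\<integral>\<^sup>+Q. indicator A (Q *v h) \<partial>H) \<partial>distr M borel R)"
    by (rule nn_integral_distr[symmetric]) measurable
  also have "\<dots> = (\<integral>\<^sup>+y. indicator A y \<partial>sym_law H (distr M borel R))"
    by (rule nn_integral_sym_law[symmetric]) (auto intro!: M.prob_space_distr)
  finally show "emeasure (distr (sym_law H M) borel T) A = emeasure (sym_law H (distr M borel R)) A" by simp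
qed simp

end

section \<open>Supports and couplings\<close>

text \<open>Every point off the support lies in a null basic open set, and there are countably many
  of those.\<close>

lemma AE_mem_msupport:
  fixes M :: "'a::{metric_space, second_countable_topology} measure"
  assumes "sets M = sets borel"
  shows "AE z in M. z \<in> msupport M"
proof -
  obtain \<B> :: "'a set set" where B: "countable \<B>" "topological_basis \<B>"
    using ex_countable_basis by blast
  have "(\<Union>b\<in>{b\<in>\<B>. emeasure M b = 0}. b) \<in> null_sets M"
    using B topological_basis_open[OF B(2)] assms by (intro null_sets_UN') (auto simp: null_sets_def)
  then have "AE z in M. z \<notin> (\<Union>b\<in>{b\<in>\<B>. emeasure M b = 0}. b)" by (rule AE_not_in)
  then show ?thesis
  proof eventually_elim
    case (elim z)
    show ?case unfolding msupport_def
    proof (intro CollectI allI impI)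
      fix e :: real assume "e > 0"
      then obtain b where b: "b \<in> \<B>" "z \<in> b" "b \<subseteq> ball z e"
        using topological_basisE[OF B(2) open_ball[of z e], of z] by (auto simp del: open_ball)
      then have "emeasure M b \<noteq> 0" using elim by auto
      moreover have "emeasure M b \<le> emeasure M (ball z e)" using b assms by (intro emeasure_mono) auto
      ultimately show "0 < emeasure M (ball z e)" by (metis le_zero_eq not_gr_zero)
    qed
  qed
qed

text \<open>Since cyclical monotonicity passes to closures, this extends it from a set of full
  measure to the whole support.\<close>

lemma msupport_subset_closure:
  assumes "sets M = sets borel" and "AE z in M. z \<in> S"
  shows "msupport M \<subseteq> closure S"
proof
  fix z assume z: "z \<in> msupport M"
  show "z \<in> closure S" unfolding closure_approachable
  proof (intro allI impI, rule ccontr)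
    fix e :: real assume e: "e > 0" and "\<not> (\<exists>y\<in>S. dist y z < e)"
    then have "AE y in M. y \<notin> ball z e"
      using assms(2) by (auto elim!: eventually_mono simp: dist_commute)
    then have "ball z e \<in> null_sets M" using assms(1) by (subst (asm) AE_iff_null_sets[symmetric]) auto
    then show False using z e by (auto simp: msupport_def null_sets_def)
  qed
qed

lemma prob_space_coupling:
  assumes "\<pi> \<in> couplings M N" "prob_space M" shows "prob_space \<pi>"
proof -
  have "prob_space (distr \<pi> borel fst)" using couplingsD(2)[OF assms(1)] assms(2) by simp
  moreover have "fst \<in> measurable \<pi> borel"
    by (auto simp: measurable_cong_sets[OF couplingsD(1)[OF assms(1)] refl] intro!: borel_measurable_continuous_onI continuous_intros)
  ultimately show ?thesis by (rule prob_space_distrD[rotated])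
qed

lemma coupling_eq_graph:
  fixes M N :: "'a::euclidean_space measure"
  assumes \<pi>: "\<pi> \<in> couplings M N" and [measurable]: "R \<in> borel_measurable borel"
    and graph: "AE z in \<pi>. snd z = R (fst z)"
  shows "\<pi> = distr M borel (\<lambda>x. (x, R x))"
proof -
  note [measurable_cong] = couplingsD(1)[OF \<pi>]
  have fst [measurable]: "fst \<in> measurable \<pi> borel"
    by (auto simp: measurable_cong_sets[OF couplingsD(1)[OF \<pi>] refl] intro!: borel_measurable_continuous_onI continuous_intros)
  have "distr M borel (\<lambda>x. (x, R x)) = distr (distr \<pi> borel fst) borel (\<lambda>x. (x, R x))"
    using couplingsD(2)[OF \<pi>] by simp
  also have "\<dots> = distr \<pi> borel ((\<lambda>x. (x, R x)) \<circ> fst)" by (rule distr_distr) measurable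
  also have "\<dots> = distr \<pi> borel (\<lambda>z. z)"
  proof (rule distr_cong_AE)
    show "(\<lambda>x. (x, R x)) \<circ> fst \<in> borel_measurable \<pi>" by measurable
    show "(\<lambda>z. z) \<in> borel_measurable \<pi>" by (simp add: measurable_cong_sets[OF couplingsD(1)[OF \<pi>] refl])
    show "AE z in \<pi>. ((\<lambda>x. (x, R x)) \<circ> fst) z = z" using graph by eventually_elim (auto simp: prod_eq_iff)
  qed simp_all
  also have "\<dots> = \<pi>" by (rule distr_id2) (simp add: couplingsD(1)[OF \<pi>])
  finally show ?thesis by simp
qed

text \<open>Test the contact inequality at each pair against the preceding first coordinate and add
  up: the values of \<open>f\<close> cancel around the cycle.\<close>

lemma contact_cyclically_monotone:
  "cyclically_monotone (\<lambda>x h. - m x h) {(x, h). contact m A f x h}"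
  unfolding cyclically_monotone_def
proof (intro allI impI)
  fix N :: nat and xs ys assume N: "1 \<le> N" and mem: "\<forall>i<N. (xs i, ys i) \<in> {(x, h). contact m A f x h}"
  have "(\<Sum>i<N. m (xs i) (ys (Suc i mod N))) \<le>
      (\<Sum>i<N. f (xs i) - f (xs (Suc i mod N)) + m (xs (Suc i mod N)) (ys (Suc i mod N)))"
  proof (rule sum_mono)
    fix i assume "i \<in> {..<N}"
    then have "contact m A f (xs (Suc i mod N)) (ys (Suc i mod N))" "xs i \<in> A" using N mem by (auto simp: contact_def)
    then show "m (xs i) (ys (Suc i mod N)) \<le> f (xs i) - f (xs (Suc i mod N)) + m (xs (Suc i mod N)) (ys (Suc i mod N))"
      by (force simp: contact_def)
  qed
  also have "\<dots> = (\<Sum>i<N. m (xs i) (ys i))"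
    using sum_cyclic_shift[of "\<lambda>i. f (xs i)" N] sum_cyclic_shift[of "\<lambda>i. m (xs i) (ys i)" N]
    by (simp add: sum.distrib sum_subtractf)
  finally show "(\<Sum>i<N. - m (xs i) (ys i)) \<le> (\<Sum>i<N. - m (xs i) (ys (Suc i mod N)))"
    by (simp add: sum_negf)
qed

section \<open>The invariant potential and the quotient map\<close>

lemma (in orth_group) compact_orbit_set:
  assumes "compact K" shows "compact (orbit_set G K)"
proof -
  have "orbit_set G K = (\<lambda>z. fst z *v snd z) ` (G \<times> K)" by (force simp: orbit_set_def)
  moreover have "compact ((\<lambda>z. fst z *v snd z) ` (G \<times> K))"
    by (intro compact_continuous_image compact_Times compact assms continuous_intros)
  ultimately show ?thesis by simp
qed

lemma (in orth_group) act_orbit_set: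
  assumes "Q \<in> G" "y \<in> orbit_set G K" shows "Q *v y \<in> orbit_set G K"
proof -
  obtain P x where "P \<in> G" "x \<in> K" "y = P *v x" using assms(2) by (auto simp: orbit_set_def)
  then have "Q *v y = (Q ** P) *v x" "Q ** P \<in> G" using mult[OF assms(1)] by (auto simp: matrix_vector_mul_assoc)
  then show ?thesis using \<open>x \<in> K\<close> unfolding orbit_set_def by blast
qed

text \<open>The last conclusion is restricted to invariant sets because a contact pair ties the
  gradient only to the orbit of \<open>h\<close>.\<close>

theorem (in orth_group) exists_potential:
  assumes \<mu>: "prob_space \<mu>" "sets \<mu> = sets borel" and \<nu>: "prob_space \<nu>" "sets \<nu> = sets borel"
    and ac: "\<And>P. AE x in lborel. P x \<Longrightarrow> AE x in \<mu>. P x"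
  obtains \<psi> where "ereal_convex \<psi>" "ereal_lsc \<psi>" "\<psi> \<in> borel_measurable borel"
    "\<And>Q x. Q \<in> G \<Longrightarrow> \<psi> (Q *v x) = \<psi> x"
    "AE x in \<mu>. ediff_at \<psi> x"
    "AE x in \<mu>. \<exists>h. contact m {x. \<psi> x \<noteq> \<infinity>} (\<lambda>x. real_of_ereal (\<psi> x)) x h"
    "\<And>C. compact C \<Longrightarrow> (\<And>Q y. Q \<in> G \<Longrightarrow> y \<in> C \<Longrightarrow> Q *v y \<in> C) \<Longrightarrow>
       measure \<nu> C \<le> measure \<mu> {x. egrad \<psi> x \<in> C}"
proof -
  interpret \<mu>: prob_space \<mu> by fact
  interpret \<nu>: prob_space \<nu> by fact
  note [measurable_cong] = \<mu>(2)
  have sp: "space \<mu> = UNIV" "space \<nu> = UNIV"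
    using sets_eq_imp_space_eq[OF \<mu>(2)] sets_eq_imp_space_eq[OF \<nu>(2)] by auto
  have "continuous_on UNIV (\<lambda>z. - m (fst z) (snd z))" by (intro continuous_intros continuous_on_corr)
  then obtain \<Gamma> where \<Gamma>: "closed \<Gamma>" "cyclically_monotone (\<lambda>x h. - m x h) \<Gamma>"
    "\<And>U K. open U \<Longrightarrow> compact K \<Longrightarrow> U \<subseteq> K \<Longrightarrow> measure \<nu> U \<le> measure \<mu> {x. \<exists>h\<in>K. (x, h) \<in> \<Gamma>}"
    using exists_cyclically_monotone_relation[OF \<mu> \<nu>, of "\<lambda>x h. - m x h"] by blast
  define D where "D = {x. \<exists>h. (x, h) \<in> \<Gamma>}"
  have D_eq: "D = (\<Union>k::nat. {x. \<exists>h\<in>cball 0 (real k). (x, h) \<in> \<Gamma>})"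
  proof (intro equalityI subsetI)
    fix x assume "x \<in> D"
    then obtain h where "(x, h) \<in> \<Gamma>" by (auto simp: D_def)
    moreover obtain k :: nat where "norm h \<le> real k" using real_arch_simple by blast
    ultimately show "x \<in> (\<Union>k::nat. {x. \<exists>h\<in>cball 0 (real k). (x, h) \<in> \<Gamma>})"
      by (intro UN_I[of k]) (auto intro!: bexI[of _ h])
  qed (auto simp: D_def)
  have Dm: "D \<in> sets \<mu>" unfolding D_eq \<mu>(2)
    by (intro sets.countable_UN image_subsetI borel_closed closed_section_preimage \<Gamma>(1) compact_cball)
  \<comment> \<open>Exhausting the space by balls shows that almost every \<open>x\<close> has a
    partner; hence \<open>\<Gamma>\<close> is nonempty and the potential is finite almost
    everywhere.\<close>
  have "measure \<mu> D = 1"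
  proof -
    have "(\<lambda>k. measure \<nu> (ball 0 (real k))) \<longlonglongrightarrow> measure \<nu> (\<Union>k::nat. ball 0 (real k))"
    proof (rule \<nu>.finite_Lim_measure_incseq)
      show "incseq (\<lambda>k. ball 0 (real k))" by (intro incseq_SucI subset_ball) simp
    qed (simp add: image_subset_iff \<nu>(2))
    moreover have "(\<Union>k::nat. ball 0 (real k)) = (UNIV :: 'n rvec set)"
    proof -
      have "\<exists>k::nat. norm y < real k" for y :: "'n rvec" using reals_Archimedean2 by blast
      then show ?thesis by auto
    qed
    moreover have "measure \<nu> (ball 0 (real k)) \<le> measure \<mu> D" for k :: nat
    proof -
      have "measure \<nu> (ball 0 (real k)) \<le> measure \<mu> {x. \<exists>h\<in>cball 0 (real k). (x, h) \<in> \<Gamma>}"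
        by (intro \<Gamma>(3)) auto
      also have "\<dots> \<le> measure \<mu> D" using Dm by (intro \<mu>.finite_measure_mono) (auto simp: D_def)
      finally show ?thesis .
    qed
    ultimately have "1 \<le> measure \<mu> D"
      using \<nu>.prob_space sp by (intro LIMSEQ_le_const2[of "\<lambda>k. measure \<nu> (ball 0 (real k))"]) auto
    then show ?thesis using \<mu>.prob_le_1[of D] by linarith
  qed
  then have AED: "AE x in \<mu>. x \<in> D" using Dm by (simp add: \<mu>.prob_eq_1)
  then obtain z0 where z0: "z0 \<in> \<Gamma>"
  proof -
    have "D \<noteq> {}" using \<open>measure \<mu> D = 1\<close> by auto
    then show ?thesis using that by (auto simp: D_def)
  qed
  define \<psi> where "\<psi> = chain_potential m \<Gamma> z0"
  let ?dom = "{x. \<psi> x \<noteq> \<infinity>}"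
  let ?f = "\<lambda>x. real_of_ereal (\<psi> x)"
  have props: "ereal_convex \<psi>" "ereal_lsc \<psi>" "\<psi> \<in> borel_measurable borel" "\<And>Q x. Q \<in> G \<Longrightarrow> \<psi> (Q *v x) = \<psi> x"
    unfolding \<psi>_def by (fact chain_potential_properties)+
  have contact: "contact m ?dom ?f x h" if "(x, h) \<in> \<Gamma>" for x h
    unfolding \<psi>_def by (rule chain_potential_contact[OF \<Gamma>(2) z0 that])
  have AEc: "AE x in \<mu>. \<exists>h. contact m ?dom ?f x h"
    using AED by eventually_elim (auto simp: D_def intro: contact)
  have AEd: "AE x in \<mu>. ediff_at \<psi> x"
    using ac[OF AE_ediff_at[OF props(1,3)]] AEc by eventually_elim (auto simp: contact_def)
  have [measurable]: "egrad \<psi> \<in> borel_measurable borel" by (rule borel_measurable_egrad[OF props(1,3)])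
  have inv_le: "measure \<nu> U \<le> measure \<mu> {x. egrad \<psi> x \<in> K}"
    if "open U" "compact K" "U \<subseteq> K" and inv: "\<And>Q y. Q \<in> G \<Longrightarrow> y \<in> K \<Longrightarrow> Q *v y \<in> K" for U K
  proof -
    have "measure \<nu> U \<le> measure \<mu> {x. \<exists>h\<in>K. (x, h) \<in> \<Gamma>}" by (rule \<Gamma>(3)) fact+
    also have "\<dots> \<le> measure \<mu> {x. egrad \<psi> x \<in> K}"
    proof (rule \<mu>.finite_measure_mono_AE)
      show "AE x in \<mu>. x \<in> {x. \<exists>h\<in>K. (x, h) \<in> \<Gamma>} \<longrightarrow> x \<in> {x. egrad \<psi> x \<in> K}"
        using AEd
      proof eventually_elim
        case (elim x)
        show ?case
        proof
          assume "x \<in> {x. \<exists>h\<in>K. (x, h) \<in> \<Gamma>}"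
          then obtain h where h: "h \<in> K" "(x, h) \<in> \<Gamma>" by auto
          obtain Q where Q: "Q \<in> G" "m x h = x \<bullet> (Q *v h)" by (rule corr_attained)
          have "Q *v h = egrad \<psi> x" by (rule contact_imp_gradient[OF contact[OF h(2)] elim Q])
          then show "x \<in> {x. egrad \<psi> x \<in> K}" using inv[OF Q(1) h(1)] by simp
        qed
      qed
      have [measurable]: "K \<in> sets borel" using \<open>compact K\<close> by (simp add: compact_imp_closed)
      have "{x \<in> space \<mu>. egrad \<psi> x \<in> K} \<in> sets \<mu>" by measurable
      then show "{x. egrad \<psi> x \<in> K} \<in> sets \<mu>" by (simp add: sp)
    qed
    finally show ?thesis .
  qed
  have "measure \<nu> C \<le> measure \<mu> {x. egrad \<psi> x \<in> C}"
    if C: "compact C" and inv: "\<And>Q y. Q \<in> G \<Longrightarrow> y \<in> C \<Longrightarrow> Q *v y \<in> C" for C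
  proof -
    \<comment> \<open>\<open>inv_le\<close> compares an open set with a compact one. Open and closed
      neighbourhoods of \<open>C\<close> of the same radius fit; the closed ones are invariant
      because the group acts by linear isometries, and they shrink to \<open>C\<close>.\<close>
    define V where "V r = (\<Union>a\<in>C. \<Union>b\<in>ball 0 r. {a + b})" for r :: real
    define K where "K r = (\<Union>a\<in>C. \<Union>b\<in>cball 0 r. {a + b})" for r :: real
    have sub: "C \<subseteq> V r" "C \<subseteq> K r" if "r > 0" for r
    proof -
      have "a \<in> V r" "a \<in> K r" if "a \<in> C" for a
        unfolding V_def K_def using that \<open>r > 0\<close> by (intro UN_I[of a] UN_I[of 0]; simp)+
      then show "C \<subseteq> V r" "C \<subseteq> K r" by auto
    qed
    have K_mono: "K r \<subseteq> K s" if "r \<le> s" for r s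
      unfolding K_def by (rule UN_mono[OF order_refl], rule UN_mono) (use that in auto)
    have K: "compact (K r)" for r unfolding K_def by (intro compact_sums' C compact_cball)
    have le: "measure \<nu> C \<le> measure \<mu> {x. egrad \<psi> x \<in> K (inverse (Suc n))}" for n :: nat
    proof -
      have "open (V (inverse (Suc n)))" unfolding V_def by (intro open_sums) simp
      have "C \<subseteq> V (inverse (Suc n))" by (rule sub) simp
      then have "measure \<nu> C \<le> measure \<nu> (V (inverse (Suc n)))"
        using \<open>open (V (inverse (Suc n)))\<close> by (intro \<nu>.finite_measure_mono) (auto simp: \<nu>(2))
      also have "\<dots> \<le> measure \<mu> {x. egrad \<psi> x \<in> K (inverse (Suc n))}"
      proof (rule inv_le[OF \<open>open (V (inverse (Suc n)))\<close> K])
        show "V (inverse (Suc n)) \<subseteq> K (inverse (Suc n))" unfolding V_def K_def by (intro UN_mono) auto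
        show "Q *v y \<in> K (inverse (Suc n))" if Q: "Q \<in> G" and yK: "y \<in> K (inverse (Suc n))" for Q y
        proof -
          obtain a b where ab: "a \<in> C" "norm b \<le> inverse (Suc n)" "y = a + b" using yK unfolding K_def by auto
          have "Q *v y = Q *v a + Q *v b" using ab by (simp add: matrix_vector_right_distrib)
          then show ?thesis unfolding K_def using inv[OF Q ab(1)] ab(2) norm_act[OF Q, of b]
            by (intro UN_I[of "Q *v a"] UN_I[of "Q *v b"]) auto
        qed
      qed
      finally show ?thesis .
    qed
    have Km: "{x. egrad \<psi> x \<in> K r} \<in> sets \<mu>" for r
    proof -
      have [measurable]: "K r \<in> sets borel" using K by (simp add: compact_imp_closed)
      have "{x \<in> space \<mu>. egrad \<psi> x \<in> K r} \<in> sets \<mu>" by measurable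
      then show ?thesis by (simp add: sp)
    qed
    have "(\<lambda>n. measure \<mu> {x. egrad \<psi> x \<in> K (inverse (Suc n))}) \<longlonglongrightarrow> measure \<mu> (\<Inter>n. {x. egrad \<psi> x \<in> K (inverse (Suc n))})"
    proof (rule \<mu>.finite_Lim_measure_decseq)
      show "decseq (\<lambda>n. {x. egrad \<psi> x \<in> K (inverse (Suc n))})"
      proof (rule decseq_SucI)
        fix n
        have "inverse (real (Suc (Suc n))) \<le> inverse (real (Suc n))" by (simp add: field_simps)
        then have "K (inverse (Suc (Suc n))) \<subseteq> K (inverse (Suc n))" by (rule K_mono)
        then show "{x. egrad \<psi> x \<in> K (inverse (Suc (Suc n)))} \<subseteq> {x. egrad \<psi> x \<in> K (inverse (Suc n))}" by auto
      qed
    qed (use Km in auto)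
    moreover have "(\<Inter>n. {x. egrad \<psi> x \<in> K (inverse (real (Suc n)))}) = {x. egrad \<psi> x \<in> C}"
    proof -
      have "y \<in> C" if y: "\<forall>n. y \<in> K (inverse (real (Suc n)))" for y
      proof -
        have "y \<in> closure C" unfolding closure_approachable
        proof (intro allI impI)
          fix e :: real assume "e > 0"
          then obtain n where n: "inverse (real (Suc n)) < e" using reals_Archimedean by blast
          obtain a b where "a \<in> C" "norm b \<le> inverse (real (Suc n))" "y = a + b" using y by (force simp: K_def)
          then show "\<exists>z\<in>C. dist z y < e" using n by (intro bexI[of _ a]) (auto simp: dist_norm)
        qed
        then show ?thesis using C by (simp add: compact_imp_closed closure_closed)
      qed
      moreover have "C \<subseteq> K (inverse (real (Suc n)))" for n by (rule sub) simp
      ultimately show ?thesis by blast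
    qed
    ultimately show ?thesis using le by (intro LIMSEQ_le_const) auto
  qed
  with props AEd AEc show ?thesis by (rule that)
qed

section \<open>The quotient map under Assumption A1\<close>

context orth_group
begin

lemma A1_orbit_unique:
  assumes "A1_set G \<nu> B" "h \<in> B" "h' \<in> B" "Q \<in> G" "Q' \<in> G" "Q *v h = Q' *v h'"
  shows "h = h'"
proof -
  have "h = transpose Q *v (Q *v h)" using assms(4) by simp
  moreover have "h' = transpose Q' *v (Q *v h)" using assms(5,6) by simp
  ultimately have "\<exists>P\<in>G. h = P *v (Q *v h)" "\<exists>P\<in>G. h' = P *v (Q *v h)"
    using transp[OF assms(4)] transp[OF assms(5)] by blast+
  then show ?thesis using assms(1-3) unfolding A1_set_def by blast
qed

lemma quot_map_act:
  assumes "A1_set G \<nu> B" "h \<in> B" "Q \<in> G"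
  shows "quot_map G B (Q *v h) = h"
  unfolding quot_map_def
proof (rule the_equality)
  show "h \<in> B \<and> (\<exists>P\<in>G. Q *v h = P *v h)" using assms by blast
  show "\<And>x. x \<in> B \<and> (\<exists>P\<in>G. Q *v h = P *v x) \<Longrightarrow> x = h" using A1_orbit_unique[OF assms(1)] assms(2,3) by metis
qed

text \<open>Inner regularity replaces \<open>B\<close> by a \<open>\<sigma>\<close>-compact subset \<open>\<Union>n. K n\<close>, on whose saturation the
  quotient map is Borel; the saturation of \<open>B\<close> itself is only analytic in general.\<close>

theorem exists_quotient_map:
  assumes \<mu>: "prob_space \<mu>" "sets \<mu> = sets borel" and \<nu>: "prob_space \<nu>" "sets \<nu> = sets borel"
    and A1: "A1_set G \<nu> B" and [measurable]: "T \<in> borel_measurable borel"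
    and le: "\<And>C. compact C \<Longrightarrow> (\<And>Q y. Q \<in> G \<Longrightarrow> y \<in> C \<Longrightarrow> Q *v y \<in> C) \<Longrightarrow>
       measure \<nu> C \<le> measure \<mu> {x. T x \<in> C}"
  obtains R where "R \<in> borel_measurable borel" "distr \<mu> borel R = \<nu>"
    "AE x in \<mu>. R x \<in> B \<and> (\<exists>Q\<in>G. T x = Q *v R x)"
proof -
  interpret \<mu>: prob_space \<mu> by fact
  interpret \<nu>: prob_space \<nu> by fact
  note [measurable_cong] = \<mu>(2)
  have sp: "space \<mu> = UNIV" "space \<nu> = UNIV"
    using sets_eq_imp_space_eq[OF \<mu>(2)] sets_eq_imp_space_eq[OF \<nu>(2)] by auto
  have B: "B \<in> sets borel" "emeasure \<nu> B = 1" using A1 by (auto simp: A1_set_def)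
  have reg: "\<exists>K. compact K \<and> K \<subseteq> A \<and> measure \<nu> A - e < measure \<nu> K" if A: "A \<in> sets borel" and e: "e > 0" for A e
  proof (rule ccontr)
    assume neg: "\<not> ?thesis"
    have "emeasure \<nu> A = (SUP K \<in> {K. K \<subseteq> A \<and> compact K}. emeasure \<nu> K)"
      by (rule inner_regular[OF \<nu>(2)]) (use A in \<open>auto simp: \<nu>.emeasure_eq_measure\<close>)
    also have "\<dots> \<le> ennreal (measure \<nu> A - e)"
      using neg by (intro SUP_least) (auto simp: \<nu>.emeasure_eq_measure not_less intro!: ennreal_leI)
    finally have "ennreal (measure \<nu> A) \<le> ennreal (measure \<nu> A - e)" by (simp add: \<nu>.emeasure_eq_measure)
    \<comment> \<open>Truncation at 0 leaves the case where \<open>A\<close> is null; there the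
      empty set contradicts \<open>neg\<close>.\<close>
    then show False using e neg by (auto simp: ennreal_le_iff2)
  qed
  have "\<forall>n::nat. \<exists>K. compact K \<and> K \<subseteq> B \<and> 1 - inverse (Suc n) < measure \<nu> K"
    using reg[OF B(1)] B(2) by (auto simp: \<nu>.emeasure_eq_measure)
  then obtain K where K: "\<And>n::nat. compact (K n)" "\<And>n. K n \<subseteq> B" "\<And>n::nat. 1 - inverse (Suc n) < measure \<nu> (K n)"
    by metis
  define S where "S = (\<Union>n. orbit_set G (K n))"
  have orb: "orbit_set G C \<in> sets borel" if "compact C" for C
    using compact_orbit_set[OF that] by (simp add: compact_imp_closed)
  have [measurable]: "S \<in> sets borel" unfolding S_def using orb[OF K(1)] by auto
  have le': "measure \<nu> C \<le> measure \<mu> {x. T x \<in> orbit_set G C}" if C: "compact C" for C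
  proof -
    have "C \<subseteq> orbit_set G C"
    proof
      fix x assume "x \<in> C"
      then show "x \<in> orbit_set G C" unfolding orbit_set_def using one by (auto intro!: exI[of _ "mat 1"] exI[of _ x])
    qed
    then have "measure \<nu> C \<le> measure \<nu> (orbit_set G C)"
      using orb[OF C] by (intro \<nu>.finite_measure_mono) (auto simp: \<nu>(2))
    also have "\<dots> \<le> measure \<mu> {x. T x \<in> orbit_set G C}"
      by (intro le compact_orbit_set C act_orbit_set)
    finally show ?thesis .
  qed
  have TS: "{x. T x \<in> S} \<in> sets \<mu>"
  proof -
    have "{x \<in> space \<mu>. T x \<in> S} \<in> sets \<mu>" by measurable
    then show ?thesis by (simp add: sp)
  qed
  have "1 \<le> measure \<mu> {x. T x \<in> S}"
  proof (rule LIMSEQ_le_const2)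
    have "(\<lambda>n. 1 - inverse (real (Suc n))) \<longlonglongrightarrow> 1 - 0" by (intro tendsto_intros LIMSEQ_inverse_real_of_nat)
    then show "(\<lambda>n. 1 - inverse (real (Suc n))) \<longlonglongrightarrow> 1" by simp
    have "1 - inverse (real (Suc n)) \<le> measure \<mu> {x. T x \<in> S}" for n
    proof -
      have "measure \<mu> {x. T x \<in> orbit_set G (K n)} \<le> measure \<mu> {x. T x \<in> S}"
        using TS by (intro \<mu>.finite_measure_mono) (auto simp: S_def)
      then show ?thesis using K(3)[of n] le'[OF K(1)[of n]] by linarith
    qed
    then show "\<exists>N. \<forall>n\<ge>N. 1 - inverse (real (Suc n)) \<le> measure \<mu> {x. T x \<in> S}" by blast
  qed
  then have "measure \<mu> {x. T x \<in> S} = 1" using \<mu>.prob_le_1[of "{x. T x \<in> S}"] by linarith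
  then have AES: "AE x in \<mu>. T x \<in> S" using TS by (subst (asm) \<mu>.prob_eq_1) auto
  \<comment> \<open>The value 0 off \<open>S\<close> makes \<open>q\<close> total;
    \<open>AES\<close> shows that \<open>T x\<close> almost surely avoids that region.\<close>
  define q where "q y = (if y \<in> S then quot_map G B y else 0)" for y
  have q_act: "q y = h" if "y \<in> S" "h \<in> B" "Q \<in> G" "y = Q *v h" for y h Q
    using quot_map_act[OF A1] that by (simp add: q_def)
  have S_E: "\<exists>n h Q. h \<in> K n \<and> h \<in> B \<and> Q \<in> G \<and> y = Q *v h" if "y \<in> S" for y
    using that K(2) unfolding S_def orbit_set_def by blast
  \<comment> \<open>For closed \<open>C\<close> each \<open>K n \<inter> C\<close> is compact, and
    so is its orbit set; the formula therefore exhibits the preimage as Borel.\<close>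
  have q_vimage: "q -` C = (\<Union>n. orbit_set G (K n \<inter> C)) \<union> (if 0 \<in> C then - S else {})" for C
  proof -
    have "q y \<in> C \<longleftrightarrow> y \<in> (\<Union>n. orbit_set G (K n \<inter> C))" if y: "y \<in> S" for y
    proof
      assume "q y \<in> C"
      obtain n h Q where "h \<in> K n" "h \<in> B" "Q \<in> G" "y = Q *v h" using S_E[OF y] by blast
      then have "h \<in> C" using q_act[OF y, of h Q] \<open>q y \<in> C\<close> by simp
      then show "y \<in> (\<Union>n. orbit_set G (K n \<inter> C))"
        unfolding orbit_set_def using \<open>h \<in> K n\<close> \<open>Q \<in> G\<close> \<open>y = Q *v h\<close> by blast
    next
      assume "y \<in> (\<Union>n. orbit_set G (K n \<inter> C))"
      then obtain n h Q where "h \<in> K n" "h \<in> C" "Q \<in> G" "y = Q *v h" unfolding orbit_set_def by blast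
      moreover from this have "h \<in> B" using K(2) by blast
      ultimately show "q y \<in> C" using q_act[OF y, of h Q] by simp
    qed
    moreover have "(\<Union>n. orbit_set G (K n \<inter> C)) \<subseteq> S" unfolding S_def orbit_set_def by blast
    moreover have "q y = 0" if "y \<notin> S" for y using that by (simp add: q_def)
    ultimately have "y \<in> q -` C \<longleftrightarrow> y \<in> (\<Union>n. orbit_set G (K n \<inter> C)) \<union> (if 0 \<in> C then - S else {})" for y
      by (cases "y \<in> S") auto
    then show ?thesis by (rule set_eqI)
  qed
  have [measurable]: "q \<in> borel_measurable borel"
    unfolding borel_eq_closed[where 'a = "'n rvec"]
  proof (rule measurable_measure_of)
    fix C :: "'n rvec set" assume "C \<in> Collect closed"
    then have "orbit_set G (K n \<inter> C) \<in> sets borel" for n using orb[OF compact_Int_closed[OF K(1)]] by simp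
    then have "q -` C \<in> sets borel" unfolding q_vimage by auto
    then show "q -` C \<inter> space (sigma UNIV (Collect closed)) \<in> sets (sigma UNIV (Collect closed))"
      by (simp add: borel_eq_closed)
  qed auto
  define R where "R x = q (T x)" for x
  have [measurable]: "R \<in> borel_measurable borel" unfolding R_def by measurable
  have AER: "AE x in \<mu>. R x \<in> B \<and> (\<exists>Q\<in>G. T x = Q *v R x)"
    using AES
  proof eventually_elim
    case (elim x)
    obtain n h Q where "h \<in> K n" "h \<in> B" "Q \<in> G" "T x = Q *v h" using S_E[OF elim] by blast
    then show ?case using q_act[OF elim] by (auto simp: R_def)
  qed
  \<comment> \<open>Approximate \<open>A \<inter> B\<close> from inside by a compact
    \<open>C\<close>. If \<open>T x\<close> lies in the orbit set of \<open>C\<close>, A1 forces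
    \<open>R x\<close> into \<open>C\<close> itself, so invariance of the test sets costs nothing
    here.\<close>
  have leR: "measure \<nu> A \<le> measure (distr \<mu> borel R) A" if A [measurable]: "A \<in> sets borel" for A
  proof (rule field_le_epsilon)
    fix e :: real assume "e > 0"
    have [measurable]: "B \<in> sets borel" by fact
    obtain C where C: "compact C" "C \<subseteq> A \<inter> B" "measure \<nu> (A \<inter> B) - e < measure \<nu> C"
      using reg[of "A \<inter> B" e] \<open>e > 0\<close> B(1) by auto
    have "AE x in \<nu>. x \<in> B" using B \<nu>(2) by (intro \<nu>.AE_prob_1) (simp add: \<nu>.emeasure_eq_measure)
    then have "measure \<nu> A = measure \<nu> (A \<inter> B)"
      using B(1) A \<nu>(2) by (intro \<nu>.finite_measure_eq_AE) (auto elim: eventually_mono)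
    also have "\<dots> \<le> measure \<nu> C + e" using C(3) by simp
    also have "measure \<nu> C \<le> measure \<mu> {x. T x \<in> orbit_set G C}" by (rule le'[OF C(1)])
    also have "\<dots> \<le> measure \<mu> (R -` A \<inter> space \<mu>)"
    proof (rule \<mu>.finite_measure_mono_AE)
      show "AE x in \<mu>. x \<in> {x. T x \<in> orbit_set G C} \<longrightarrow> x \<in> R -` A \<inter> space \<mu>"
        using AES
      proof eventually_elim
        case (elim x)
        show ?case
        proof
          assume "x \<in> {x. T x \<in> orbit_set G C}"
          then obtain Q h where "Q \<in> G" "h \<in> C" "T x = Q *v h" by (auto simp: orbit_set_def)
          moreover from this have "h \<in> B" "h \<in> A" using C(2) by auto
          ultimately show "x \<in> R -` A \<inter> space \<mu>" using q_act[OF elim, of h Q] by (simp add: R_def sp)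
        qed
      qed
    qed measurable
    also have "\<dots> = measure (distr \<mu> borel R) A" by (rule measure_distr[symmetric]) measurable
    finally show "measure \<nu> A \<le> measure (distr \<mu> borel R) A + e" by simp
  qed
  have "distr \<mu> borel R = \<nu>"
  proof (rule measure_eqI)
    fix A assume "A \<in> sets (distr \<mu> borel R)"
    then have A: "A \<in> sets borel" by simp
    interpret R: prob_space "distr \<mu> borel R" by (rule \<mu>.prob_space_distr) measurable
    \<comment> \<open>Domination on the complement is the reverse inequality on \<open>A\<close>,
      both measures having total mass one.\<close>
    have "measure \<nu> (UNIV - A) \<le> measure (distr \<mu> borel R) (UNIV - A)" using A by (intro leR) auto
    then have "measure (distr \<mu> borel R) A \<le> measure \<nu> A"
      using R.prob_compl[of A] \<nu>.prob_compl[of A] A by (simp add: sp \<nu>(2))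
    then show "emeasure (distr \<mu> borel R) A = emeasure \<nu> A"
      using leR[OF A] by (simp add: R.emeasure_eq_measure \<nu>.emeasure_eq_measure)
  qed (simp add: \<nu>(2))
  with AER show ?thesis by (intro that[of R]) auto
qed

end

section \<open>Optimality and uniqueness\<close>

lemma graph_coupling:
  assumes M: "sets M = sets borel" and T: "T \<in> borel_measurable M" and N: "distr M borel T = N"
  shows "distr M borel (\<lambda>x. (x, T x)) \<in> couplings M N"
proof -
  have id: "(\<lambda>x. x) \<in> borel_measurable M" by (simp add: measurable_cong_sets[OF M refl])
  have pair: "(\<lambda>x. (x, T x)) \<in> borel_measurable M" using id T by (rule borel_measurable_Pair)
  have fs: "fst \<in> borel_measurable (borel :: ('a \<times> 'a) measure)" "snd \<in> borel_measurable (borel :: ('a \<times> 'a) measure)"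
    by (auto intro!: borel_measurable_continuous_onI continuous_intros)
  have "distr (distr M borel (\<lambda>x. (x, T x))) borel fst = distr M borel (\<lambda>x. x)"
    by (subst distr_distr[OF fs(1) pair]) (simp add: o_def)
  moreover have "distr M borel (\<lambda>x. x) = M" by (rule distr_id2) (simp add: M)
  moreover have "distr (distr M borel (\<lambda>x. (x, T x))) borel snd = distr M borel T"
    by (subst distr_distr[OF fs(2) pair]) (simp add: o_def)
  ultimately show ?thesis using N by (simp add: couplings_def)
qed

text \<open>\<open>contact\<close> quantifies over all \<open>z\<close> in \<open>A\<close>;
  Fenchel's equality replaces this by one inequality between Borel functions.\<close>

lemma borel_pred_contact:
  fixes m :: "'a::euclidean_space \<Rightarrow> 'a \<Rightarrow> real"
  assumes cont: "continuous_on UNIV (\<lambda>z. m (fst z) (snd z))"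
    and [measurable]: "A \<in> sets borel" "f \<in> borel_measurable borel"
  shows "Measurable.pred borel (\<lambda>z. contact m A f (fst z) (snd z))"
proof -
  have fs [measurable]: "fst \<in> borel_measurable (borel :: ('a \<times> 'a) measure)" "snd \<in> borel_measurable (borel :: ('a \<times> 'a) measure)"
    by (auto intro!: borel_measurable_continuous_onI continuous_intros)
  have "continuous_on UNIV (m x)" for x
    using continuous_on_compose2[OF cont, of UNIV "\<lambda>h. (x, h)"] by (simp add: continuous_intros)
  then have [measurable]: "conjugate m A f \<in> borel_measurable borel" by (rule borel_measurable_conjugate)
  have [measurable]: "(\<lambda>z. m (fst z) (snd z)) \<in> borel_measurable borel" by (rule borel_measurable_continuous_onI[OF cont])
  have "(\<lambda>z. contact m A f (fst z) (snd z)) =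
      (\<lambda>z. fst z \<in> A \<and> conjugate m A f (snd z) \<le> ereal (m (fst z) (snd z) - f (fst z)))"
    using contact_iff_conjugate_le[of _ A m f] by (auto simp: fun_eq_iff contact_def)
  also have "Measurable.pred borel \<dots>" by measurable
  finally show ?thesis .
qed

lemma integrable_coupling:
  fixes f :: "'a::euclidean_space \<Rightarrow> real"
  assumes \<pi>: "\<pi> \<in> couplings M N" and f: "f \<in> borel_measurable borel"
  shows "integrable \<pi> (\<lambda>z. f (fst z)) \<longleftrightarrow> integrable M f" "integrable \<pi> (\<lambda>z. f (snd z)) \<longleftrightarrow> integrable N f"
    and "(\<integral>z. f (fst z) \<partial>\<pi>) = (\<integral>x. f x \<partial>M)" "(\<integral>z. f (snd z) \<partial>\<pi>) = (\<integral>x. f x \<partial>N)"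
proof -
  have fs: "fst \<in> measurable \<pi> borel" "snd \<in> measurable \<pi> borel"
    by (auto simp: measurable_cong_sets[OF couplingsD(1)[OF \<pi>] refl] intro!: borel_measurable_continuous_onI continuous_intros)
  show "integrable \<pi> (\<lambda>z. f (fst z)) \<longleftrightarrow> integrable M f" "(\<integral>z. f (fst z) \<partial>\<pi>) = (\<integral>x. f x \<partial>M)"
    using integrable_distr_eq[OF fs(1) f] integral_distr[OF fs(1) f] by (simp_all add: couplingsD(2)[OF \<pi>])
  show "integrable \<pi> (\<lambda>z. f (snd z)) \<longleftrightarrow> integrable N f" "(\<integral>z. f (snd z) \<partial>\<pi>) = (\<integral>x. f x \<partial>N)"
    using integrable_distr_eq[OF fs(2) f] integral_distr[OF fs(2) f] by (simp_all add: couplingsD(3)[OF \<pi>])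
qed

context orth_group
begin

lemma corr_abs_le: "\<bar>m x h\<bar> \<le> norm x * norm h"
proof -
  obtain Q where Q: "Q \<in> G" "m x h = x \<bullet> (Q *v h)" by (rule corr_attained)
  then show ?thesis using Cauchy_Schwarz_ineq2[of x "Q *v h"] by (simp add: norm_act)
qed

lemma orbit_cost_nonneg: "0 \<le> orbit_cost G x h"
  unfolding orbit_cost_def by (intro cINF_greatest nonempty) simp

lemma orbit_cost_le: "orbit_cost G x h \<le> 2 * (norm x)\<^sup>2 + 2 * (norm h)\<^sup>2"
  using corr_abs_le[of x h] sum_squares_bound[of "norm x" "norm h"] by (simp add: orbit_cost_eq)

text \<open>With \<open>a\<close> and \<open>b\<close> the squared norm minus twice the potential
  and its conjugate, \<open>a x + b h\<close> is at most the cost, with equality exactly at contact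
  pairs. The integrals of \<open>a\<close> and \<open>b\<close> depend on the marginals
  alone.\<close>

theorem contact_coupling_optimal:
  assumes \<mu>: "prob_space \<mu>" and \<pi>0: "\<pi>\<^sub>0 \<in> couplings \<mu> \<nu>" and \<pi>: "\<pi> \<in> couplings \<mu> \<nu>"
    and mom: "(\<integral>\<^sup>+x. ennreal ((norm x)\<^sup>2) \<partial>\<mu>) < \<infinity>" "(\<integral>\<^sup>+h. ennreal ((norm h)\<^sup>2) \<partial>\<nu>) < \<infinity>"
    and [measurable]: "A \<in> sets borel" "f \<in> borel_measurable borel"
    and contact: "AE z in \<pi>\<^sub>0. contact m A f (fst z) (snd z)"
  shows contact_coupling_optimal_le:
      "(\<integral>\<^sup>+z. ennreal (orbit_cost G (fst z) (snd z)) \<partial>\<pi>\<^sub>0) \<le> (\<integral>\<^sup>+z. ennreal (orbit_cost G (fst z) (snd z)) \<partial>\<pi>)"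
    and contact_coupling_optimal_eq:
      "(\<integral>\<^sup>+z. ennreal (orbit_cost G (fst z) (snd z)) \<partial>\<pi>) \<le> (\<integral>\<^sup>+z. ennreal (orbit_cost G (fst z) (snd z)) \<partial>\<pi>\<^sub>0) \<Longrightarrow>
       AE z in \<pi>. contact m A f (fst z) (snd z)"
proof -
  interpret \<pi>0: prob_space \<pi>\<^sub>0 by (rule prob_space_coupling[OF \<pi>0 \<mu>])
  interpret \<pi>: prob_space \<pi> by (rule prob_space_coupling[OF \<pi> \<mu>])
  let ?c = "\<lambda>z. orbit_cost G (fst z) (snd z)"
  define g where "g h = real_of_ereal (conjugate m A f h)" for h
  define a where "a x = (norm x)\<^sup>2 - 2 * f x" for x
  define b where "b h = (norm h)\<^sup>2 - 2 * g h" for h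
  have conj_meas [measurable]: "conjugate m A f \<in> borel_measurable borel"
    by (rule borel_measurable_conjugate[OF continuous_on_corr_right])
  have [measurable]: "a \<in> borel_measurable borel" "b \<in> borel_measurable borel"
    unfolding a_def b_def g_def by measurable
  have c_meas: "?c \<in> borel_measurable borel" by (rule borel_measurable_continuous_onI[OF continuous_on_cost])
  have sq_meas: "(\<lambda>x :: 'n rvec. (norm x)\<^sup>2) \<in> borel_measurable borel" by measurable
  have sets: "sets \<mu> = sets borel" "sets \<nu> = sets borel"
    using couplingsD(2,3)[OF \<pi>0] by auto
  have sq: "integrable \<mu> (\<lambda>x. (norm x)\<^sup>2)" "integrable \<nu> (\<lambda>x. (norm x)\<^sup>2)"
    using mom sq_meas by (auto intro!: integrableI_nonneg simp: measurable_cong_sets[OF sets(1) refl] measurable_cong_sets[OF sets(2) refl])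
  have c_int: "integrable \<pi>' ?c" if \<pi>': "\<pi>' \<in> couplings \<mu> \<nu>" for \<pi>'
  proof (rule Bochner_Integration.integrable_bound)
    show "integrable \<pi>' (\<lambda>z. 2 * (norm (fst z))\<^sup>2 + 2 * (norm (snd z))\<^sup>2)"
      using integrable_coupling(1,2)[OF \<pi>' sq_meas] sq by (intro Bochner_Integration.integrable_add integrable_mult_right) auto
    show "?c \<in> borel_measurable \<pi>'" using c_meas by (simp add: measurable_cong_sets[OF couplingsD(1)[OF \<pi>'] refl])
    show "AE z in \<pi>'. norm (?c z) \<le> norm (2 * (norm (fst z))\<^sup>2 + 2 * (norm (snd z))\<^sup>2)"
      using orbit_cost_le orbit_cost_nonneg by (auto intro!: AE_I2)
  qed
  obtain x1 h1 where x1: "contact m A f x1 h1"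
  proof -
    have "\<exists>z. contact m A f (fst z) (snd z)"
      by (rule eventually_happens'[OF \<pi>0.ae_filter_bot contact])
    then show ?thesis using that by blast
  qed
  have fin0: "AE z in \<pi>\<^sub>0. fst z \<in> A \<and> \<bar>conjugate m A f (snd z)\<bar> \<noteq> \<infinity>"
    using contact by eventually_elim (auto simp: conjugate_contact contact_def)
  have "AE x in \<mu>. x \<in> A" "AE h in \<nu>. \<bar>conjugate m A f h\<bar> \<noteq> \<infinity>"
    using fin0 AE_coupling_fst[OF \<pi>0, of "\<lambda>x. x \<in> A"] AE_coupling_snd[OF \<pi>0, of "\<lambda>h. \<bar>conjugate m A f h\<bar> \<noteq> \<infinity>"] by auto
  then have fin: "AE z in \<pi>. fst z \<in> A \<and> \<bar>conjugate m A f (snd z)\<bar> \<noteq> \<infinity>"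
    using AE_coupling_fst[OF \<pi>, of "\<lambda>x. x \<in> A"] AE_coupling_snd[OF \<pi>, of "\<lambda>h. \<bar>conjugate m A f h\<bar> \<noteq> \<infinity>"] by auto
  have eq_iff: "a x + b h = orbit_cost G x h \<longleftrightarrow> contact m A f x h" and ab_le: "a x + b h \<le> orbit_cost G x h"
    if "x \<in> A" "\<bar>conjugate m A f h\<bar> \<noteq> \<infinity>" for x h
  proof -
    have ge: "m x h - f x \<le> g h" using conjugate_ge[of x A m h f] that by (cases "conjugate m A f h") (auto simp: g_def)
    then show "a x + b h \<le> orbit_cost G x h" by (simp add: a_def b_def orbit_cost_eq)
    have "contact m A f x h \<longleftrightarrow> g h \<le> m x h - f x"
      using contact_iff_conjugate_le[of x A m f h] that by (cases "conjugate m A f h") (auto simp: g_def)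
    then show "a x + b h = orbit_cost G x h \<longleftrightarrow> contact m A f x h"
      using ge by (auto simp: a_def b_def orbit_cost_eq)
  qed
  \<comment> \<open>The contact pair \<open>(x1, h1)\<close> gives minorants of \<open>f\<close> and
    of its conjugate, hence the upper bounds \<open>ua\<close> and \<open>ub\<close>. Lower bounds
    come from \<open>a + b = c \<ge> 0\<close> on contact pairs, so each of \<open>a\<close> and
    \<open>b\<close> is dominated by \<open>ua + ub\<close>.\<close>
  define k where "k = \<bar>f x1 - m x1 h1\<bar>"
  have k: "m x1 h1 - f x1 \<le> k" "0 \<le> k" by (auto simp: k_def)
  define ua where "ua x = 2 * (norm x)\<^sup>2 + (norm h1)\<^sup>2 + 2 * k" for x :: "'n rvec"
  define ub where "ub h = 2 * (norm h)\<^sup>2 + (norm x1)\<^sup>2 + 2 * \<bar>f x1\<bar>" for h :: "'n rvec"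
  have a_le: "a x \<le> ua x" if "x \<in> A" for x
  proof -
    have "f x1 + m x h1 - m x1 h1 \<le> f x" using x1 that by (auto simp: contact_def)
    moreover have "2 * (norm x * norm h1) \<le> (norm x)\<^sup>2 + (norm h1)\<^sup>2"
      using sum_squares_bound[of "norm x" "norm h1"] by simp
    ultimately show ?thesis 
      using abs_le_D2[OF corr_abs_le[of x h1]] k
      unfolding a_def ua_def by linarith
  qed
  have b_le: "b h \<le> ub h" if "\<bar>conjugate m A f h\<bar> \<noteq> \<infinity>" for h
  proof -
    have "x1 \<in> A" using x1 by (simp add: contact_def)
    then have "m x1 h - f x1 \<le> g h" using conjugate_ge[of x1 A m h f] that by (cases "conjugate m A f h") (auto simp: g_def)
    moreover have "2 * (norm x1 * norm h) \<le> (norm x1)\<^sup>2 + (norm h)\<^sup>2"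
      using sum_squares_bound[of "norm x1" "norm h"] by simp
    ultimately show ?thesis 
      using abs_le_D2[OF corr_abs_le[of x1 h]] abs_ge_self[of "f x1"] zero_le_power2[of "norm h"]
      unfolding b_def ub_def by linarith
  qed
  have ub_int: "integrable \<pi>\<^sub>0 (\<lambda>z. ua (fst z) + ub (snd z))"
    unfolding ua_def ub_def using integrable_coupling(1,2)[OF \<pi>0 sq_meas] sq
    by (intro Bochner_Integration.integrable_add integrable_mult_right) auto
  have bounds: "AE z in \<pi>\<^sub>0. \<bar>a (fst z)\<bar> \<le> ua (fst z) + ub (snd z) \<and> \<bar>b (snd z)\<bar> \<le> ua (fst z) + ub (snd z)"
    using contact fin0
  proof eventually_elim
    case (elim z)
    have "a (fst z) + b (snd z) = ?c z" using eq_iff[of "fst z" "snd z"] elim by simp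
    moreover have "0 \<le> ?c z" by (rule orbit_cost_nonneg)
    moreover have "a (fst z) \<le> ua (fst z)" "b (snd z) \<le> ub (snd z)" using a_le b_le elim by simp_all
    moreover have "0 \<le> ua (fst z)" "0 \<le> ub (snd z)" using k by (auto simp: ua_def ub_def)
    ultimately show ?case by linarith
  qed
  have [measurable]: "fst \<in> measurable \<pi>\<^sub>0 borel" "snd \<in> measurable \<pi>\<^sub>0 borel"
    by (auto simp: measurable_cong_sets[OF couplingsD(1)[OF \<pi>0] refl] intro!: borel_measurable_continuous_onI continuous_intros)
  have "integrable \<pi>\<^sub>0 (\<lambda>z. a (fst z))"
  proof (rule Bochner_Integration.integrable_bound[OF ub_int])
    show "AE z in \<pi>\<^sub>0. norm (a (fst z)) \<le> norm (ua (fst z) + ub (snd z))" using bounds by eventually_elim auto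
  qed measurable
  moreover have "integrable \<pi>\<^sub>0 (\<lambda>z. b (snd z))"
  proof (rule Bochner_Integration.integrable_bound[OF ub_int])
    show "AE z in \<pi>\<^sub>0. norm (b (snd z)) \<le> norm (ua (fst z) + ub (snd z))" using bounds by eventually_elim auto
  qed measurable
  ultimately have ab_int: "integrable \<mu> a" "integrable \<nu> b"
    using integrable_coupling(1,2)[OF \<pi>0] by auto
  have dual: "(\<integral>z. ?c z - a (fst z) - b (snd z) \<partial>\<pi>') = (\<integral>z. ?c z \<partial>\<pi>') - (\<integral>x. a x \<partial>\<mu>) - (\<integral>h. b h \<partial>\<nu>)"
    and gap_int: "integrable \<pi>' (\<lambda>z. ?c z - a (fst z) - b (snd z))" if \<pi>': "\<pi>' \<in> couplings \<mu> \<nu>" for \<pi>'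
  proof -
    have "integrable \<pi>' (\<lambda>z. a (fst z))" "integrable \<pi>' (\<lambda>z. b (snd z))"
      using integrable_coupling(1,2)[OF \<pi>'] ab_int by auto
    then show "integrable \<pi>' (\<lambda>z. ?c z - a (fst z) - b (snd z))"
      "(\<integral>z. ?c z - a (fst z) - b (snd z) \<partial>\<pi>') = (\<integral>z. ?c z \<partial>\<pi>') - (\<integral>x. a x \<partial>\<mu>) - (\<integral>h. b h \<partial>\<nu>)"
      using c_int[OF \<pi>'] integrable_coupling(3,4)[OF \<pi>'] by auto
  qed
  have nn: "(\<integral>\<^sup>+z. ennreal (?c z) \<partial>\<pi>') = ennreal (\<integral>z. ?c z \<partial>\<pi>')" if "\<pi>' \<in> couplings \<mu> \<nu>" for \<pi>'
    using c_int[OF that] orbit_cost_nonneg by (intro nn_integral_eq_integral) auto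
  have gap_nonneg: "AE z in \<pi>. 0 \<le> ?c z - a (fst z) - b (snd z)"
    using fin
  proof eventually_elim
    case (elim z)
    then show ?case using ab_le[of "fst z" "snd z"] by simp
  qed
  have "(\<integral>z. ?c z - a (fst z) - b (snd z) \<partial>\<pi>\<^sub>0) = 0"
  proof (rule integral_eq_zero_AE)
    show "AE z in \<pi>\<^sub>0. ?c z - a (fst z) - b (snd z) = 0"
      using contact fin0
    proof eventually_elim
      case (elim z)
      then show ?case using eq_iff[of "fst z" "snd z"] by simp
    qed
  qed
  then have c0: "(\<integral>z. ?c z \<partial>\<pi>\<^sub>0) = (\<integral>x. a x \<partial>\<mu>) + (\<integral>h. b h \<partial>\<nu>)" using dual[OF \<pi>0] by simp
  have "0 \<le> (\<integral>z. ?c z - a (fst z) - b (snd z) \<partial>\<pi>)" using gap_nonneg by (rule integral_nonneg_AE)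
  then have "(\<integral>z. ?c z \<partial>\<pi>\<^sub>0) \<le> (\<integral>z. ?c z \<partial>\<pi>)" using dual[OF \<pi>] c0 by simp
  then show "(\<integral>\<^sup>+z. ennreal (?c z) \<partial>\<pi>\<^sub>0) \<le> (\<integral>\<^sup>+z. ennreal (?c z) \<partial>\<pi>)"
    unfolding nn[OF \<pi>0] nn[OF \<pi>] by (rule ennreal_leI)
  assume "(\<integral>\<^sup>+z. ennreal (?c z) \<partial>\<pi>) \<le> (\<integral>\<^sup>+z. ennreal (?c z) \<partial>\<pi>\<^sub>0)"
  then have "(\<integral>z. ?c z \<partial>\<pi>) \<le> (\<integral>z. ?c z \<partial>\<pi>\<^sub>0)"
    unfolding nn[OF \<pi>0] nn[OF \<pi>] using orbit_cost_nonneg by (subst (asm) ennreal_le_iff) (auto intro!: integral_nonneg_AE)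
  then have "(\<integral>z. ?c z - a (fst z) - b (snd z) \<partial>\<pi>) = 0"
    using dual[OF \<pi>] c0 \<open>0 \<le> (\<integral>z. ?c z - a (fst z) - b (snd z) \<partial>\<pi>)\<close> by linarith
  then have "AE z in \<pi>. ?c z - a (fst z) - b (snd z) = 0"
    using integral_nonneg_eq_0_iff_AE[OF gap_int[OF \<pi>] gap_nonneg] by blast
  with fin show "AE z in \<pi>. contact m A f (fst z) (snd z)"
  proof eventually_elim
    case (elim z)
    then show ?case using eq_iff[of "fst z" "snd z"] by simp
  qed
qed

end

text \<open>Both graphs couple \<open>M\<close> with \<open>N\<close> and are in contact for the
  inner product; \<open>contact_transfer\<close> makes the gradient of \<open>\<phi>\<close> a
  subgradient of \<open>\<psi>\<close>.\<close>

theorem gradient_pushforward_unique: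
  fixes M :: "'a::euclidean_space measure"
  assumes M: "prob_space M" "sets M = sets borel"
    and \<phi>: "ereal_convex \<phi>" "AE x in M. ediff_at \<phi> x" "egrad \<phi> \<in> borel_measurable M" "distr M borel (egrad \<phi>) = N"
    and \<psi>: "ereal_convex \<psi>" "\<psi> \<in> borel_measurable borel" "AE x in M. ediff_at \<psi> x" "distr M borel (egrad \<psi>) = N"
  shows "AE x in M. egrad \<phi> x = egrad \<psi> x"
proof -
  let ?graph = "\<lambda>\<phi>. distr M borel (\<lambda>x. (x, egrad \<phi> x))"
  \<comment> \<open>Nothing makes \<open>\<phi>\<close> or its effective domain Borel. On the
    interior \<open>\<phi>\<close> is continuous, and every differentiability point lies there, so
    cutting off at the interior keeps the contact property.\<close>
  define U where "U = interior {x. \<phi> x \<noteq> \<infinity>}"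
  define f where "f x = (if x \<in> U then real_of_ereal (\<phi> x) else 0)" for x
  have U: "U \<in> sets borel" by (simp add: U_def)
  have "continuous_on U (\<lambda>x. real_of_ereal (\<phi> x))"
    unfolding U_def by (intro convex_on_continuous open_interior ereal_convex_on_interior \<phi>(1))
  then have f: "f \<in> borel_measurable borel"
    unfolding f_def[abs_def] using U by (intro borel_measurable_continuous_on_if) auto
  have \<psi>': "{x. \<psi> x \<noteq> \<infinity>} \<in> sets borel" "(\<lambda>x. real_of_ereal (\<psi> x)) \<in> borel_measurable borel"
    using \<psi>(2) by simp_all
  have grad_\<psi>: "egrad \<psi> \<in> borel_measurable M"
    using borel_measurable_egrad[OF \<psi>(1,2)] by (simp add: measurable_cong_sets[OF M(2) refl])
  have id: "(\<lambda>x. x) \<in> borel_measurable M" by (simp add: measurable_cong_sets[OF M(2) refl])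
  have pair: "(\<lambda>x. (x, egrad \<phi> x)) \<in> measurable M borel" "(\<lambda>x. (x, egrad \<psi> x)) \<in> measurable M borel"
    by (intro borel_measurable_Pair id \<phi>(3) grad_\<psi>)+
  have cont: "continuous_on UNIV (\<lambda>z :: 'a \<times> 'a. fst z \<bullet> snd z)" by (intro continuous_intros)
  have c1: "AE z in ?graph \<phi>. contact (\<bullet>) U f (fst z) (snd z)"
  proof (subst AE_distr_iff[OF pair(1)])
    show "{z \<in> space borel. contact (\<bullet>) U f (fst z) (snd z)} \<in> sets borel"
      using borel_pred_contact[OF cont U f] by (simp add: pred_def)
    show "AE x in M. contact (\<bullet>) U f (fst (x, egrad \<phi> x)) (snd (x, egrad \<phi> x))"
      using \<phi>(2)
    proof eventually_elim
      case (elim x)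
      have g: "has_grad_at \<phi> x (egrad \<phi> x)" by (rule has_grad_at_egrad[OF elim])
      have "x \<in> U" using has_grad_at_interior[OF g] by (simp add: U_def)
      moreover have "real_of_ereal (\<phi> x) + z \<bullet> egrad \<phi> x - x \<bullet> egrad \<phi> x \<le> real_of_ereal (\<phi> z)" if "z \<in> U" for z
        using gradient_inequality[OF \<phi>(1) g, of z] that interior_subset[of "{x. \<phi> x \<noteq> \<infinity>}"]
        by (auto simp: U_def inner_diff_right inner_commute)
      ultimately show ?case by (simp add: contact_def f_def)
    qed
  qed
  have c2: "AE z in ?graph \<psi>. contact (\<bullet>) {x. \<psi> x \<noteq> \<infinity>} (\<lambda>x. real_of_ereal (\<psi> x)) (fst z) (snd z)"
  proof (subst AE_distr_iff[OF pair(2)])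
    show "{z \<in> space borel. contact (\<bullet>) {x. \<psi> x \<noteq> \<infinity>} (\<lambda>x. real_of_ereal (\<psi> x)) (fst z) (snd z)} \<in> sets borel"
      using borel_pred_contact[OF cont \<psi>'] by (simp add: pred_def)
    show "AE x in M. contact (\<bullet>) {x. \<psi> x \<noteq> \<infinity>} (\<lambda>x. real_of_ereal (\<psi> x)) (fst (x, egrad \<psi> x)) (snd (x, egrad \<psi> x))"
      using \<psi>(3)
    proof eventually_elim
      case (elim x)
      have g: "has_grad_at \<psi> x (egrad \<psi> x)" by (rule has_grad_at_egrad[OF elim])
      have "\<psi> x \<noteq> \<infinity>" using has_grad_at_interior[OF g] interior_subset by blast
      moreover have "real_of_ereal (\<psi> x) + z \<bullet> egrad \<psi> x - x \<bullet> egrad \<psi> x \<le> real_of_ereal (\<psi> z)" if "\<psi> z \<noteq> \<infinity>" for z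
        using gradient_inequality[OF \<psi>(1) g that] by (simp add: inner_diff_right inner_commute)
      ultimately show ?case by (simp add: contact_def)
    qed
  qed
  have g1: "?graph \<phi> \<in> couplings M N" and g2: "?graph \<psi> \<in> couplings M N"
    using graph_coupling[OF M(2)] \<phi>(3,4) grad_\<psi> \<psi>(4) by blast+
  have "AE z in ?graph \<phi>. contact (\<bullet>) {x. \<psi> x \<noteq> \<infinity>} (\<lambda>x. real_of_ereal (\<psi> x)) (fst z) (snd z)"
    by (rule contact_transfer[OF g1 g2 prob_space_coupling[OF g1 M(1)] prob_space_coupling[OF g2 M(1)] _ U \<psi>'(1) f \<psi>'(2) c1 c2])
      (intro continuous_intros)
  from AE_distrD[OF pair(1) this] \<psi>(3) show ?thesis
  proof eventually_elim
    case (elim x)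
    show ?case
    proof (rule subgradient_eq_gradient[OF has_grad_at_egrad[OF elim(2)]])
      fix z assume "\<psi> z \<noteq> \<infinity>"
      then show "real_of_ereal (\<psi> x) + egrad \<phi> x \<bullet> (z - x) \<le> real_of_ereal (\<psi> z)"
        using elim(1) by (auto simp: contact_def inner_diff_right inner_commute)
    qed
  qed
qed

theorem mainTheorem3:
  fixes G :: "'n::finite rmat set" and H :: "'n rmat measure"
    and \<mu> \<nu> :: "'n rvec measure" and B :: "'n rvec set"
  assumes G: "compact_orth_subgroup G"
    and H: "haar_uniform G H"
    and mu: "prob_space \<mu>" "sets \<mu> = sets borel"
    and mu_ac: "\<exists>f. f \<in> borel_measurable borel \<and> \<mu> = density lborel f"
    and nu: "prob_space \<nu>" "sets \<nu> = sets borel"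
    and A1: "A1_set G \<nu> B"
  shows "\<exists>R. R \<in> borel_measurable borel \<and>
    (let \<pi>R = distr \<mu> borel (\<lambda>x. (x, R x)); c = orbit_cost G;
         \<mu>S = sym_law H \<mu>; \<nu>S = sym_law H \<nu> in
     \<pi>R \<in> couplings \<mu> \<nu> \<and> cyclically_monotone c (msupport \<pi>R) \<and>
     (\<forall>\<pi>\<in>couplings \<mu> \<nu>. cyclically_monotone c (msupport \<pi>) \<longrightarrow> \<pi> = \<pi>R) \<and>
     (\<forall>R'. R' \<in> borel_measurable borel \<and>
           distr \<mu> borel (\<lambda>x. (x, R' x)) \<in> couplings \<mu> \<nu> \<and>
           cyclically_monotone c (msupport (distr \<mu> borel (\<lambda>x. (x, R' x))))
           \<longrightarrow> (AE x in \<mu>. R' x = R x)) \<and>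
     (\<exists>\<psi>. ereal_convex \<psi> \<and> ereal_lsc \<psi> \<and>
        \<comment> \<open>(i)\<close>
        (AE x in \<mu>. ediff_at \<psi> x \<and> egrad \<psi> x \<in> orbit_set G B \<and>
                     R x = quot_map G B (egrad \<psi> x)) \<and>
        \<comment> \<open>(ii)\<close>
        (AE x in \<mu>S. ediff_at \<psi> x) \<and> egrad \<psi> \<in> borel_measurable \<mu>S \<and>
        distr \<mu>S borel (egrad \<psi>) = \<nu>S \<and>
        (\<forall>\<phi>. ereal_convex \<phi> \<and> (AE x in \<mu>S. ediff_at \<phi> x) \<and>
              egrad \<phi> \<in> borel_measurable \<mu>S \<and> distr \<mu>S borel (egrad \<phi>) = \<nu>S
              \<longrightarrow> (AE x in \<mu>S. egrad \<phi> x = egrad \<psi> x)) \<and>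
        \<comment> \<open>(iii)\<close>
        (\<forall>Q\<in>G. \<forall>x. ediff_at \<psi> x \<and> ediff_at \<psi> (Q *v x) \<longrightarrow>
                     egrad \<psi> (Q *v x) = Q *v egrad \<psi> x) \<and>
        \<comment> \<open>(iv)\<close>
        (AE x in \<mu>. \<forall>Q\<in>G.
            (\<forall>P\<in>G. (norm (transpose Q *v x - R x))\<^sup>2 \<le> (norm (transpose P *v x - R x))\<^sup>2)
            \<longrightarrow> egrad \<psi> x = Q *v R x) \<and>
        \<comment> \<open>(v)\<close>
        ((\<integral>\<^sup>+ x. ennreal ((norm x)\<^sup>2) \<partial>\<mu>) < \<infinity> \<and> (\<integral>\<^sup>+ h. ennreal ((norm h)\<^sup>2) \<partial>\<nu>) < \<infinity> \<longrightarrow>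
           (\<forall>\<pi>\<in>couplings \<mu> \<nu>.
              (\<integral>\<^sup>+ z. ennreal (c (fst z) (snd z)) \<partial>\<pi>R) \<le> (\<integral>\<^sup>+ z. ennreal (c (fst z) (snd z)) \<partial>\<pi>) \<and>
              ((\<integral>\<^sup>+ z. ennreal (c (fst z) (snd z)) \<partial>\<pi>) \<le> (\<integral>\<^sup>+ z. ennreal (c (fst z) (snd z)) \<partial>\<pi>R)
                 \<longrightarrow> \<pi> = \<pi>R)))))"
proof -
  interpret haar_group G H by unfold_locales (rule G, rule H)
  interpret \<mu>: prob_space \<mu> by (rule mu)
  interpret \<nu>: prob_space \<nu> by (rule nu)
  have ac: "AE x in \<mu>. P x" if "AE x in lborel. P x" for P
  proof -
    obtain f where f: "f \<in> borel_measurable borel" "\<mu> = density lborel f" using mu_ac by blast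
    show ?thesis unfolding f(2) using that f(1) by (subst AE_density) (auto elim: eventually_mono)
  qed
  obtain \<psi> where \<psi>: "ereal_convex \<psi>" "ereal_lsc \<psi>" "\<psi> \<in> borel_measurable borel"
    and inv: "\<And>Q x. Q \<in> G \<Longrightarrow> \<psi> (Q *v x) = \<psi> x"
    and diff: "AE x in \<mu>. ediff_at \<psi> x"
    and ex_contact: "AE x in \<mu>. \<exists>h. contact m {x. \<psi> x \<noteq> \<infinity>} (\<lambda>x. real_of_ereal (\<psi> x)) x h"
    and le: "\<And>C. compact C \<Longrightarrow> (\<And>Q y. Q \<in> G \<Longrightarrow> y \<in> C \<Longrightarrow> Q *v y \<in> C) \<Longrightarrow>
       measure \<nu> C \<le> measure \<mu> {x. egrad \<psi> x \<in> C}"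
    using exists_potential[OF mu nu ac] by blast
  define D where "D = {x. \<psi> x \<noteq> \<infinity>}"
  define f where "f = (\<lambda>x. real_of_ereal (\<psi> x))"
  have D [measurable]: "D \<in> sets borel" unfolding D_def using \<psi>(3) by simp
  have f [measurable]: "f \<in> borel_measurable borel" unfolding f_def using \<psi>(3) by simp
  have grad_meas [measurable]: "egrad \<psi> \<in> borel_measurable borel" by (rule borel_measurable_egrad[OF \<psi>(1,3)])
  obtain R where R: "R \<in> borel_measurable borel" and push: "distr \<mu> borel R = \<nu>"
    and RB: "AE x in \<mu>. R x \<in> B \<and> (\<exists>Q\<in>G. egrad \<psi> x = Q *v R x)"
    by (rule exists_quotient_map[OF mu nu A1 grad_meas le])
  have R_contact: "AE x in \<mu>. contact m D f x (R x)"
    using diff ex_contact RB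
  proof eventually_elim
    case (elim x)
    obtain h where h: "contact m D f x h" using elim(2) by (auto simp: D_def f_def)
    obtain Q where Q: "Q \<in> G" "m x h = x \<bullet> (Q *v h)" by (rule corr_attained)
    obtain P where P: "P \<in> G" "egrad \<psi> x = P *v R x" using elim(3) by blast
    have "Q *v h = P *v R x" using contact_imp_gradient[OF h[unfolded D_def f_def] elim(1) Q] P(2) by simp
    \<comment> \<open>\<open>h\<close> and \<open>R x\<close> share the orbit of the gradient, and
      \<open>m\<close> depends on its second argument only through the orbit; contact therefore
      moves from \<open>h\<close> to \<open>R x\<close>.\<close>
    then have "m z h = m z (R x)" for z using corr_act_right[OF Q(1), of z h] corr_act_right[OF P(1), of z "R x"] by simp
    then show ?case using h by (simp add: contact_def)
  qed
  define \<pi>R where "\<pi>R = distr \<mu> borel (\<lambda>x. (x, R x))"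
  have R\<mu>: "R \<in> borel_measurable \<mu>" using R by (simp add: measurable_cong_sets[OF mu(2) refl])
  have pair: "(\<lambda>x. (x, R x)) \<in> measurable \<mu> borel"
    using borel_measurable_Pair[OF _ R, of "\<lambda>x. x"] by (simp add: measurable_cong_sets[OF mu(2) refl])
  have \<pi>R: "\<pi>R \<in> couplings \<mu> \<nu>" unfolding \<pi>R_def by (rule graph_coupling[OF mu(2) R\<mu> push])
  have prob_\<pi>R: "prob_space \<pi>R" by (rule prob_space_coupling[OF \<pi>R mu(1)])
  have contact_meas: "Measurable.pred borel (\<lambda>z. contact m D f (fst z) (snd z))"
    by (rule borel_pred_contact[OF continuous_on_corr D f])
  have \<pi>R_contact: "AE z in \<pi>R. contact m D f (fst z) (snd z)"
    unfolding \<pi>R_def using R_contact contact_meas by (subst AE_distr_iff[OF pair]) (simp_all add: pred_def)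
  \<comment> \<open>\<open>RB\<close> quantifies over \<open>G\<close>; \<open>AE_distrD\<close>
    transfers it without a measurability proof for \<open>P\<close>.\<close>
  have fst_AE: "AE z in \<pi>. P (fst z)" if "\<pi> \<in> couplings \<mu> \<nu>" "AE x in \<mu>. P x" for \<pi> P
  proof -
    have "fst \<in> measurable \<pi> borel"
      by (auto simp: measurable_cong_sets[OF couplingsD(1)[OF that(1)] refl] intro!: borel_measurable_continuous_onI continuous_intros)
    moreover have "AE x in distr \<pi> borel fst. P x" unfolding couplingsD(2)[OF that(1)] by (rule that(2))
    ultimately show ?thesis by (rule AE_distrD)
  qed
  have \<nu>B: "AE h in \<nu>. h \<in> B" and B: "B \<in> sets borel"
    using A1 \<nu>.AE_prob_1[of B] by (auto simp: A1_set_def \<nu>.emeasure_eq_measure)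
  have concentrated: "\<pi> = \<pi>R" if \<pi>: "\<pi> \<in> couplings \<mu> \<nu>" and c: "AE z in \<pi>. contact m D f (fst z) (snd z)" for \<pi>
  proof -
    \<comment> \<open>\<open>snd z\<close> and \<open>R (fst z)\<close> both lie in \<open>B\<close>
      and have the gradient at \<open>fst z\<close> in their orbits, so A1 identifies them.\<close>
    have "AE z in \<pi>. snd z \<in> B" using AE_coupling_snd[OF \<pi>, of "\<lambda>h. h \<in> B"] \<nu>B B by (simp add: pred_def)
    with c fst_AE[OF \<pi> diff] fst_AE[OF \<pi> RB] have "AE z in \<pi>. snd z = R (fst z)"
    proof eventually_elim
      case (elim z)
      obtain Q where Q: "Q \<in> G" "m (fst z) (snd z) = fst z \<bullet> (Q *v snd z)" by (rule corr_attained)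
      obtain P where P: "P \<in> G" "egrad \<psi> (fst z) = P *v R (fst z)" using elim(3) by blast
      have "Q *v snd z = P *v R (fst z)"
        using contact_imp_gradient[OF elim(1)[unfolded D_def f_def] elim(2) Q] P(2) by simp
      then show ?case using A1_orbit_unique[OF A1 elim(4) _ Q(1) P(1)] elim(3) by blast
    qed
    then show ?thesis unfolding \<pi>R_def by (rule coupling_eq_graph[OF \<pi> R])
  qed
  have cm: "cyclically_monotone (orbit_cost G) (msupport \<pi>R)"
  proof -
    have "msupport \<pi>R \<subseteq> closure {(x, h). contact m D f x h}"
      using \<pi>R_contact by (intro msupport_subset_closure couplingsD(1)[OF \<pi>R]) (simp add: case_prod_beta)
    moreover have "cyclically_monotone (\<lambda>x h. - m x h) (closure {(x, h). contact m D f x h})"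
      by (intro cyclically_monotone_closure contact_cyclically_monotone continuous_on_minus continuous_on_corr)
    ultimately show ?thesis unfolding cyclically_monotone_cost_iff by (rule cyclically_monotone_subset[rotated])
  qed
  have unique: "\<pi> = \<pi>R" if \<pi>: "\<pi> \<in> couplings \<mu> \<nu>" and mono: "cyclically_monotone (orbit_cost G) (msupport \<pi>)" for \<pi>
  proof (rule concentrated[OF \<pi>])
    interpret \<pi>: prob_space \<pi> by (rule prob_space_coupling[OF \<pi> mu(1)])
    have supp: "AE z in \<pi>. z \<in> msupport \<pi>" by (rule AE_mem_msupport[OF couplingsD(1)[OF \<pi>]])
    obtain z0 where z0: "z0 \<in> msupport \<pi>" using eventually_happens'[OF \<pi>.ae_filter_bot supp] by blast
    \<comment> \<open>The rival coupling brings the potential of its own support;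
      \<open>contact_transfer\<close> then places it on the contact set of
      \<open>\<psi>\<close>.\<close>
    define \<phi> where "\<phi> = chain_potential m (msupport \<pi>) z0"
    have \<phi>: "\<phi> \<in> borel_measurable borel" unfolding \<phi>_def by (rule chain_potential_properties)
    have c\<phi>: "AE z in \<pi>. contact m {x. \<phi> x \<noteq> \<infinity>} (\<lambda>x. real_of_ereal (\<phi> x)) (fst z) (snd z)"
      using supp
    proof eventually_elim
      case (elim z)
      then show ?case unfolding \<phi>_def
        using mono[unfolded cyclically_monotone_cost_iff] z0 by (intro chain_potential_contact) auto
    qed
    show "AE z in \<pi>. contact m D f (fst z) (snd z)"
      by (rule contact_transfer[OF \<pi> \<pi>R \<pi>.prob_space_axioms prob_\<pi>R continuous_on_corr_right _ D _ f c\<phi> \<pi>R_contact])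
        (use \<phi> in simp_all)
  qed
  have unique_map: "AE x in \<mu>. R' x = R x"
    if R': "R' \<in> borel_measurable borel" "distr \<mu> borel (\<lambda>x. (x, R' x)) = \<pi>R" for R'
  proof -
    have pair': "(\<lambda>x. (x, R' x)) \<in> measurable \<mu> borel"
      using borel_measurable_Pair[OF _ R'(1), of "\<lambda>x. x"] by (simp add: measurable_cong_sets[OF mu(2) refl])
    have fs: "fst \<in> borel_measurable (borel :: ('n rvec \<times> 'n rvec) measure)"
      "snd \<in> borel_measurable (borel :: ('n rvec \<times> 'n rvec) measure)"
      by (auto intro!: borel_measurable_continuous_onI continuous_intros)
    have "(\<lambda>z. snd z - R (fst z)) \<in> borel_measurable borel"
      using fs(2) measurable_compose[OF fs(1) R] by (rule borel_measurable_diff)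
    from measurable_sets[OF this, of "{0}"] have "{z. snd z = R (fst z)} \<in> sets borel"
      by (simp add: vimage_def)
    then have "AE z in \<pi>R. snd z = R (fst z)" unfolding \<pi>R_def by (subst AE_distr_iff[OF pair]) auto
    then show ?thesis unfolding R'(2)[symmetric] using AE_distrD[OF pair'] by fastforce
  qed
  let ?\<mu>S = "sym_law H \<mu>" and ?\<nu>S = "sym_law H \<nu>"
  have diffS: "AE x in ?\<mu>S. ediff_at \<psi> x"
    \<comment> \<open>The set of differentiability points is invariant, so the claim for \<mu> is
      enough.\<close>
    using AE_sym_law_iff[OF mu borel_ediff_at[OF \<psi>(1,3)]] ediff_at_act_iff[OF inv] diff by blast
  have grad_measS: "egrad \<psi> \<in> borel_measurable ?\<mu>S"
    using grad_meas by (simp add: measurable_cong_sets[OF sets_sym_law refl])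
  have pushS: "distr ?\<mu>S borel (egrad \<psi>) = ?\<nu>S"
    unfolding push[symmetric]
  proof (rule distr_sym_law_equivariant[OF mu grad_meas R])
    show "AE x in \<mu>. (\<forall>Q\<in>G. egrad \<psi> (Q *v x) = Q *v egrad \<psi> x) \<and> (\<exists>P\<in>G. egrad \<psi> x = P *v R x)"
      using diff RB by eventually_elim (auto simp: egrad_act[OF inv])
  qed
  have uniqueS: "AE x in ?\<mu>S. egrad \<phi> x = egrad \<psi> x"
    if \<phi>: "ereal_convex \<phi>" "AE x in ?\<mu>S. ediff_at \<phi> x" "egrad \<phi> \<in> borel_measurable ?\<mu>S" "distr ?\<mu>S borel (egrad \<phi>) = ?\<nu>S" for \<phi>
    by (rule gradient_pushforward_unique[OF prob_space_sym_law[OF mu] sets_sym_law \<phi> \<psi>(1,3) diffS pushS])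
  have i: "AE x in \<mu>. ediff_at \<psi> x \<and> egrad \<psi> x \<in> orbit_set G B \<and> R x = quot_map G B (egrad \<psi> x)"
    using diff RB
  proof eventually_elim
    case (elim x)
    then obtain Q where "R x \<in> B" "Q \<in> G" "egrad \<psi> x = Q *v R x" by blast
    then show ?case using elim(1) quot_map_act[OF A1] by (auto simp: orbit_set_def)
  qed
  have iv: "AE x in \<mu>. \<forall>Q\<in>G.
      (\<forall>P\<in>G. (norm (transpose Q *v x - R x))\<^sup>2 \<le> (norm (transpose P *v x - R x))\<^sup>2) \<longrightarrow> egrad \<psi> x = Q *v R x"
    using diff R_contact
  proof eventually_elim
    case (elim x)
    show ?case
    proof (intro ballI impI)
      fix Q assume Q: "Q \<in> G" and min: "\<forall>P\<in>G. (norm (transpose Q *v x - R x))\<^sup>2 \<le> (norm (transpose P *v x - R x))\<^sup>2"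
      obtain P where P: "P \<in> G" "m x (R x) = x \<bullet> (P *v R x)" by (rule corr_attained)
      \<comment> \<open>Minimising the distance is maximising the inner product, by
        \<open>norm_diff_act\<close>.\<close>
      have "m x (R x) = x \<bullet> (Q *v R x)"
        using bspec[OF min P(1)] norm_diff_act[OF Q, of x "R x"] norm_diff_act[OF P(1), of x "R x"] corr_ge[OF Q, of x "R x"] P(2)
        by linarith
      then show "egrad \<psi> x = Q *v R x"
        using contact_imp_gradient[OF elim(2)[unfolded D_def f_def] elim(1) Q] by simp
    qed
  qed
  show ?thesis
    unfolding Let_def
  proof (rule exI[of _ R], fold \<pi>R_def, intro conjI ballI allI impI exI[of _ \<psi>])
    show "AE x in \<mu>. R' x = R x"
      if "R' \<in> borel_measurable borel \<and> distr \<mu> borel (\<lambda>x. (x, R' x)) \<in> couplings \<mu> \<nu> \<and>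
        cyclically_monotone (orbit_cost G) (msupport (distr \<mu> borel (\<lambda>x. (x, R' x))))" for R'
      using unique_map[of R'] unique[of "distr \<mu> borel (\<lambda>x. (x, R' x))"] that by blast
    show "AE x in ?\<mu>S. egrad \<phi> x = egrad \<psi> x"
      if "ereal_convex \<phi> \<and> (AE x in ?\<mu>S. ediff_at \<phi> x) \<and> egrad \<phi> \<in> borel_measurable ?\<mu>S \<and>
        distr ?\<mu>S borel (egrad \<phi>) = ?\<nu>S" for \<phi>
      using uniqueS that by blast
    show "egrad \<psi> (Q *v x) = Q *v egrad \<psi> x" if "Q \<in> G" "ediff_at \<psi> x \<and> ediff_at \<psi> (Q *v x)" for Q x
      using egrad_act[OF inv] that by blast
    assume mom: "(\<integral>\<^sup>+ x. ennreal ((norm x)\<^sup>2) \<partial>\<mu>) < \<infinity> \<and> (\<integral>\<^sup>+ h. ennreal ((norm h)\<^sup>2) \<partial>\<nu>) < \<infinity>"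
    fix \<pi> assume \<pi>: "\<pi> \<in> couplings \<mu> \<nu>"
    show "(\<integral>\<^sup>+ z. ennreal (orbit_cost G (fst z) (snd z)) \<partial>\<pi>R) \<le> (\<integral>\<^sup>+ z. ennreal (orbit_cost G (fst z) (snd z)) \<partial>\<pi>)"
      using mom by (intro contact_coupling_optimal_le[OF mu(1) \<pi>R \<pi> _ _ D f \<pi>R_contact]) auto
    show "\<pi> = \<pi>R"
      if "(\<integral>\<^sup>+ z. ennreal (orbit_cost G (fst z) (snd z)) \<partial>\<pi>) \<le> (\<integral>\<^sup>+ z. ennreal (orbit_cost G (fst z) (snd z)) \<partial>\<pi>R)"
      using mom that by (intro concentrated[OF \<pi>] contact_coupling_optimal_eq[OF mu(1) \<pi>R \<pi> _ _ D f \<pi>R_contact]) auto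
  qed (rule R \<pi>R cm \<psi>(1,2) i diffS grad_measS pushS iv | erule (1) unique)+
qed

end
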